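(* Let $K$ be a field, $I\subset S=K[X_1,\ldots,X_m,Y_1,\ldots,Y_n]$ a squarefree monomial ideal, $R=S/I=K[\Delta]$, and $P=(y_1,\dots,y_n)\subset R$ the ideal generated by the residue classes of $Y_1,\dots,Y_n$. Then for all $i$ and all $k,j\in\mathbb{Z}$ one has $$\dim_K H_{P}^i(K[\Delta])_{(k,j)}=\sum_{F\in \Delta_W,\ G\subseteq V}d(i,F,G)\binom{k-1}{|G|-1}\binom{-j-1}{|F|-1},$$ where $d(i,F,G)=\dim_K \widetilde{H}_{i-|F|-1}\bigl((\operatorname{lk}(F\cup G))_W;K\bigr)$.
   Context: $\Delta$ is the simplicial complex on the vertex set $V\cup W$, $V=\{v_1,\dots,v_m\}$, $W=\{w_1,\dots,w_n\}$ (with $v_p$ corresponding to $X_p$ and $w_q$ to $Y_q$) whose faces are the subsets for which the product of the corresponding variables does not lie in $I$; a singleton need not be a face. $R$ is $\mathbb{Z}\times\mathbb{Z}$-bigraded by giving the classes of the $X_p$ degree $(1,0)$ and the classes of the $Y_q$ degree $(0,1)$, and $H^i_P(R)$ inherits this bigrading; $H^i_P(R)_{(k,j)}$ is the component of bidegree $(k,j)$. Convention for binomial coefficients: $\binom{p}{q}$ is the usual binomial coefficient for $0\le q\le p$, $\binom{-1}{-1}=1$, and $\binom{p}{q}=0$ in all other cases. For $F\subseteq V\cup W$, $\operatorname{lk}F=\{G: F\cup G\in\Delta,\ F\cap G=\emptyset\}$, which is the void complex (no faces at all) if $F\notin\Delta$. For a simplicial complex $\Gamma$, $\Gamma_W$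 denotes the subcomplex of faces of $\Gamma$ contained in $W$. $\widetilde H_\bullet(\,\cdot\,;K)$ is reduced simplicial homology; the void complex has zero reduced homology in all degrees, while the complex $\{\emptyset\}$ has $\widetilde H_{-1}=K$ and zero otherwise. *)

theory Defs
  imports
    "HOL-Library.Poly_Mapping"
    "HOL-Algebra.QuotRing"
    "Jordan_Normal_Form.VS_Connect"
begin

section \<open>Squarefree monomial ideals and Stanley--Reisner rings\<close>

text \<open>
  The $m + n$ variables of $S$ are numbered by natural numbers, and a variable is identified with its
  vertex: $X_{p+1}$ (vertex $v_{p+1}$) is variable $p$ for $p < m$, and $Y_{q+1}$ (vertex $w_{q+1}$)
  is variable $m + q$ for $q < n$.  The values $m = 0$ and $n = 0$ are allowed.
  The field $K$ is a type of class \<open>field\<close>; the corresponding record is \<open>class_ring\<close>.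
\<close>

type_synonym 'k mpoly = "(nat \<Rightarrow>\<^sub>0 nat) \<Rightarrow>\<^sub>0 'k"

definition V_vertices :: "nat \<Rightarrow> nat set" where
  "V_vertices m = {..<m}"

definition W_vertices :: "nat \<Rightarrow> nat \<Rightarrow> nat set" where
  "W_vertices m n = {m..<m + n}"

definition poly_ring :: "nat \<Rightarrow> nat \<Rightarrow> ('k::field) mpoly ring" where
  "poly_ring m n =
     \<lparr>carrier = {p. \<forall>t \<in> Poly_Mapping.keys p. Poly_Mapping.keys t \<subseteq> V_vertices m \<union> W_vertices m n},
      mult = (*), one = 1, zero = 0, add = (+)\<rparr>"

definition var :: "nat \<Rightarrow> ('k::field) mpoly" where
  "var v = Poly_Mapping.single (Poly_Mapping.single v 1) 1"

definition const :: "'k \<Rightarrow> ('k::field) mpoly" where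
  "const a = Poly_Mapping.single 0 a"

definition sqfree_monomial :: "nat set \<Rightarrow> ('k::field) mpoly" where
  "sqfree_monomial F = (\<Prod>v\<in>F. var v)"

definition sqfree_monomial_ideal :: "nat \<Rightarrow> nat \<Rightarrow> ('k::field) mpoly set \<Rightarrow> bool" where
  "sqfree_monomial_ideal m n I \<longleftrightarrow>
     (\<exists>B \<subseteq> Pow (V_vertices m \<union> W_vertices m n).
        I = Idl\<^bsub>poly_ring m n\<^esub> (sqfree_monomial ` B))"

definition SR_ring :: "nat \<Rightarrow> nat \<Rightarrow> ('k::field) mpoly set \<Rightarrow> 'k mpoly set ring" where
  "SR_ring m n I = poly_ring m n Quot I"

definition residue :: "nat \<Rightarrow> nat \<Rightarrow> ('k::field) mpoly set \<Rightarrow> 'k mpoly \<Rightarrow> 'k mpoly set" where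
  "residue m n I p = I +>\<^bsub>poly_ring m n\<^esub> p"

definition SR_complex :: "nat \<Rightarrow> nat \<Rightarrow> ('k::field) mpoly set \<Rightarrow> nat set set" where
  "SR_complex m n I = {F. F \<subseteq> V_vertices m \<union> W_vertices m n \<and> sqfree_monomial F \<notin> I}"


section \<open>Quotient modules\<close>

definition quot_module :: "('a, 'c) module \<Rightarrow> 'c set \<Rightarrow> ('a, 'c set) module" where
  "quot_module M N =
     \<lparr>carrier = a_rcosets\<^bsub>M\<^esub> N, mult = undefined, one = undefined,
      zero = N, add = (<+>\<^bsub>M\<^esub>),
      smult = (\<lambda>a X. \<Union>x\<in>X. N +>\<^bsub>M\<^esub> (a \<odot>\<^bsub>M\<^esub> x))\<rparr>"


section \<open>Simplicial complexes and reduced homology\<close>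

text \<open>
  For a complex \<open>\<Delta>\<close>, closed under subsets, \<open>link \<Delta> F\<close> is the void complex \<open>{}\<close> if \<open>F \<notin> \<Delta>\<close>;
  this is distinct from \<open>{{}}\<close>.
\<close>

definition link :: "nat set set \<Rightarrow> nat set \<Rightarrow> nat set set" where
  "link \<Delta> F = {G. F \<union> G \<in> \<Delta> \<and> F \<inter> G = {}}"

definition induced :: "nat set set \<Rightarrow> nat set \<Rightarrow> nat set set" where
  "induced \<Delta> U = {F \<in> \<Delta>. F \<subseteq> U}"

text \<open>
  Complexes live on finite vertex sets, so a \<open>p\<close>-chain is simply a function supported on the
  faces of dimension \<open>p\<close>.  The empty face has dimension \<open>-1\<close>, whence the homology is reduced.
\<close>

definition chains :: "nat set set \<Rightarrow> int \<Rightarrow> ('k::field, nat set \<Rightarrow> 'k) module" where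
  "chains \<Delta> p =
     \<lparr>carrier = {c. \<forall>F. c F \<noteq> 0 \<longrightarrow> F \<in> \<Delta> \<and> int (card F) - 1 = p},
      mult = undefined, one = undefined,
      zero = (\<lambda>F. 0), add = (\<lambda>c d F. c F + d F), smult = (\<lambda>a c F. a * c F)\<rparr>"

text \<open>
  Faces are oriented by the order of the vertices: the boundary of the face
  $\{u_0 < \dots < u_p\}$ is the sum of the $(-1)^i \{u_0, \dots, \widehat{u_i}, \dots, u_p\}$.
  The formula below is the coefficient of \<open>G\<close> in the boundary of \<open>c\<close>.
\<close>

definition boundary :: "nat set set \<Rightarrow> (nat set \<Rightarrow> 'k) \<Rightarrow> (nat set \<Rightarrow> 'k::field)" where
  "boundary \<Delta> c =
     (\<lambda>G. \<Sum>v\<in>{v. v \<notin> G \<and> insert v G \<in> \<Delta>}. (-1) ^ card {u \<in> G. u < v} * c (insert v G))"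

definition reduced_homology :: "nat set set \<Rightarrow> int \<Rightarrow> ('k::field, (nat set \<Rightarrow> 'k) set) module" where
  "reduced_homology \<Delta> p =
     quot_module
       ((chains \<Delta> p)\<lparr>carrier := {c \<in> carrier (chains \<Delta> p). boundary \<Delta> c = (\<lambda>F. 0)}\<rparr>)
       (boundary \<Delta> ` carrier (chains \<Delta> (p + 1) :: ('k, nat set \<Rightarrow> 'k) module))"


section \<open>Localization at the powers of an element\<close>

definition loc_rel :: "'a ring \<Rightarrow> 'a \<Rightarrow> (('a \<times> nat) \<times> ('a \<times> nat)) set" where
  "loc_rel R f =
     {((r, s), (r', s')). r \<in> carrier R \<and> r' \<in> carrier R \<and>
        (\<exists>u::nat. f [^]\<^bsub>R\<^esub> u \<otimes>\<^bsub>R\<^esub> (f [^]\<^bsub>R\<^esub> s' \<otimes>\<^bsub>R\<^esub> r) = f [^]\<^bsub>R\<^esub> u \<otimes>\<^bsub>R\<^esub> (f [^]\<^bsub>R\<^esub> s \<otimes>\<^bsub>R\<^esub> r'))}"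

text \<open>\<open>frac R f r s\<close> is the fraction $r / f^s$.\<close>

definition frac :: "'a ring \<Rightarrow> 'a \<Rightarrow> 'a \<Rightarrow> nat \<Rightarrow> ('a \<times> nat) set" where
  "frac R f r s = loc_rel R f `` {(r, s)}"

definition localization :: "'a ring \<Rightarrow> 'a \<Rightarrow> ('a, ('a \<times> nat) set) module" where
  "localization R f =
     \<lparr>carrier = (carrier R \<times> UNIV) // loc_rel R f,
      mult = (\<lambda>X Y. \<Union>(r, s)\<in>X. \<Union>(r', s')\<in>Y. frac R f (r \<otimes>\<^bsub>R\<^esub> r') (s + s')),
      one = frac R f \<one>\<^bsub>R\<^esub> 0,
      zero = frac R f \<zero>\<^bsub>R\<^esub> 0,
      add = (\<lambda>X Y. \<Union>(r, s)\<in>X. \<Union>(r', s')\<in>Y.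
               frac R f (f [^]\<^bsub>R\<^esub> s' \<otimes>\<^bsub>R\<^esub> r \<oplus>\<^bsub>R\<^esub> f [^]\<^bsub>R\<^esub> s \<otimes>\<^bsub>R\<^esub> r') (s + s')),
      smult = (\<lambda>a X. \<Union>(r, s)\<in>X. frac R f (a \<otimes>\<^bsub>R\<^esub> r) s)\<rparr>"

text \<open>The canonical map $R_f \to R_{fg}$, $r / f^s \mapsto r g^s / (f g)^s$.\<close>

definition loc_map :: "'a ring \<Rightarrow> 'a \<Rightarrow> 'a \<Rightarrow> ('a \<times> nat) set \<Rightarrow> ('a \<times> nat) set" where
  "loc_map R f g X = (\<Union>(r, s)\<in>X. frac R (f \<otimes>\<^bsub>R\<^esub> g) (r \<otimes>\<^bsub>R\<^esub> g [^]\<^bsub>R\<^esub> s) s)"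


section \<open>Local cohomology\<close>

text \<open>
  For a finite family of elements \<open>y v\<close> (\<open>v \<in> A\<close>) of a Noetherian commutative ring \<open>R\<close>, the local
  cohomology of \<open>R\<close> with support in the ideal generated by the family is defined here as the
  cohomology of the Cech complex
  $C^i = \prod_{\sigma \subseteq A, |\sigma| = i} R_{y_\sigma}$, where
  $y_\sigma = \prod_{v \in \sigma} y_v$.
\<close>

definition cech_index :: "nat set \<Rightarrow> nat \<Rightarrow> nat set set" where
  "cech_index A i = {\<sigma>. \<sigma> \<subseteq> A \<and> card \<sigma> = i}"

definition cech_loc :: "'a ring \<Rightarrow> (nat \<Rightarrow> 'a) \<Rightarrow> nat set \<Rightarrow> ('a, ('a \<times> nat) set) module" where
  "cech_loc R y \<sigma> = localization R (finprod R y \<sigma>)"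

definition cech_cochains ::
    "'a ring \<Rightarrow> (nat \<Rightarrow> 'a) \<Rightarrow> nat set \<Rightarrow> nat \<Rightarrow> ('a, nat set \<Rightarrow> ('a \<times> nat) set) module" where
  "cech_cochains R y A i =
     \<lparr>carrier = (\<Pi>\<^sub>E \<sigma>\<in>cech_index A i. carrier (cech_loc R y \<sigma>)),
      mult = undefined, one = undefined,
      zero = (\<lambda>\<sigma>\<in>cech_index A i. \<zero>\<^bsub>cech_loc R y \<sigma>\<^esub>),
      add = (\<lambda>c d. \<lambda>\<sigma>\<in>cech_index A i. c \<sigma> \<oplus>\<^bsub>cech_loc R y \<sigma>\<^esub> d \<sigma>),
      smult = (\<lambda>a c. \<lambda>\<sigma>\<in>cech_index A i. a \<odot>\<^bsub>cech_loc R y \<sigma>\<^esub> c \<sigma>)\<rparr>"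

definition cech_diff ::
    "'a ring \<Rightarrow> (nat \<Rightarrow> 'a) \<Rightarrow> nat set \<Rightarrow> nat \<Rightarrow>
       (nat set \<Rightarrow> ('a \<times> nat) set) \<Rightarrow> (nat set \<Rightarrow> ('a \<times> nat) set)" where
  "cech_diff R y A i c =
     (\<lambda>\<tau>\<in>cech_index A (Suc i).
        \<Oplus>\<^bsub>cech_loc R y \<tau>\<^esub>q\<in>\<tau>.
          (let x = loc_map R (finprod R y (\<tau> - {q})) (y q) (c (\<tau> - {q}))
           in if even (card {p \<in> \<tau>. p < q}) then x else \<ominus>\<^bsub>cech_loc R y \<tau>\<^esub> x))"

definition cech_cocycles ::
    "'a ring \<Rightarrow> (nat \<Rightarrow> 'a) \<Rightarrow> nat set \<Rightarrow> nat \<Rightarrow> (nat set \<Rightarrow> ('a \<times> nat) set) set" where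
  "cech_cocycles R y A i =
     {c \<in> carrier (cech_cochains R y A i). cech_diff R y A i c = \<zero>\<^bsub>cech_cochains R y A (Suc i)\<^esub>}"

definition cech_coboundaries ::
    "'a ring \<Rightarrow> (nat \<Rightarrow> 'a) \<Rightarrow> nat set \<Rightarrow> nat \<Rightarrow> (nat set \<Rightarrow> ('a \<times> nat) set) set" where
  "cech_coboundaries R y A i =
     (case i of 0 \<Rightarrow> {\<zero>\<^bsub>cech_cochains R y A 0\<^esub>}
      | Suc i' \<Rightarrow> cech_diff R y A i' ` carrier (cech_cochains R y A i'))"

definition local_cohomology ::
    "'a ring \<Rightarrow> (nat \<Rightarrow> 'a) \<Rightarrow> nat set \<Rightarrow> nat \<Rightarrow> ('a, (nat set \<Rightarrow> ('a \<times> nat) set) set) module" where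
  "local_cohomology R y A i =
     quot_module ((cech_cochains R y A i)\<lparr>carrier := cech_cocycles R y A i\<rparr>)
       (cech_coboundaries R y A i)"


section \<open>The bigrading\<close>

definition poly_component :: "nat \<Rightarrow> nat \<Rightarrow> int \<Rightarrow> int \<Rightarrow> ('k::field) mpoly set" where
  "poly_component m n k j =
     {p \<in> carrier (poly_ring m n). \<forall>t \<in> Poly_Mapping.keys p.
        int (\<Sum>v\<in>V_vertices m. Poly_Mapping.lookup t v) = k \<and>
        int (\<Sum>v\<in>W_vertices m n. Poly_Mapping.lookup t v) = j}"

definition SR_component :: "nat \<Rightarrow> nat \<Rightarrow> ('k::field) mpoly set \<Rightarrow> int \<Rightarrow> int \<Rightarrow> 'k mpoly set set" where
  "SR_component m n I k j = residue m n I ` poly_component m n k j"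

text \<open>
  For \<open>\<sigma> \<subseteq> W\<close> the element $y_\sigma$ has bidegree $(0, |\sigma|)$, so $r / y_\sigma^s$ with $r$
  homogeneous of bidegree $(k, j + s |\sigma|)$ has bidegree $(k, j)$.
\<close>

definition loc_component ::
    "nat \<Rightarrow> nat \<Rightarrow> ('k::field) mpoly set \<Rightarrow> nat set \<Rightarrow> int \<Rightarrow> int \<Rightarrow> ('k mpoly set \<times> nat) set set" where
  "loc_component m n I \<sigma> k j =
     {frac (SR_ring m n I) (finprod (SR_ring m n I) (\<lambda>v. residue m n I (var v)) \<sigma>) r s | r s.
        r \<in> SR_component m n I k (j + int s * int (card \<sigma>))}"

text \<open>$H^i_P(R)$ for the ideal $P$ generated by the residue classes of the $Y$-variables.\<close>

definition H_P ::
    "nat \<Rightarrow> nat \<Rightarrow> ('k::field) mpoly set \<Rightarrow> nat \<Rightarrow>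
       ('k mpoly set, (nat set \<Rightarrow> ('k mpoly set \<times> nat) set) set) module" where
  "H_P m n I i =
     local_cohomology (SR_ring m n I) (\<lambda>v. residue m n I (var v)) (W_vertices m n) i"

text \<open>
  The component of bidegree $(k, j)$ consists of the classes of the homogeneous cocycles of that
  bidegree; it is a vector space by restriction of scalars along $K \to R$.
\<close>

definition H_P_component ::
    "nat \<Rightarrow> nat \<Rightarrow> ('k::field) mpoly set \<Rightarrow> nat \<Rightarrow> int \<Rightarrow> int \<Rightarrow>
       ('k, (nat set \<Rightarrow> ('k mpoly set \<times> nat) set) set) module" where
  "H_P_component m n I i k j =
     (let R = SR_ring m n I; y = (\<lambda>v. residue m n I (var v)); W = W_vertices m n; H = H_P m n I i
      in \<lparr>carrier = {cech_coboundaries R y W i +>\<^bsub>cech_cochains R y W i\<^esub> c | c.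
                      c \<in> cech_cocycles R y W i \<and>
                      (\<forall>\<sigma>\<in>cech_index W i. c \<sigma> \<in> loc_component m n I \<sigma> k j)},
          mult = undefined, one = undefined, zero = \<zero>\<^bsub>H\<^esub>, add = (\<oplus>\<^bsub>H\<^esub>),
          smult = (\<lambda>a X. residue m n I (const a) \<odot>\<^bsub>H\<^esub> X)\<rparr>)"


section \<open>Dimensions and binomial coefficients\<close>

text \<open>\<open>has_dim V d\<close>: the \<open>K\<close>-vector space \<open>V\<close> is finite-dimensional, of dimension \<open>d\<close>.
  The first two clauses matter because \<open>vectorspace.dim\<close> is unspecified without them.\<close>

definition has_dim :: "('k::field, 'c) module \<Rightarrow> nat \<Rightarrow> bool" where
  "has_dim V d \<longleftrightarrow>
     vectorspace (class_ring :: 'k ring) V \<and>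
     vectorspace.fin_dim (class_ring :: 'k ring) V \<and>
     vectorspace.dim (class_ring :: 'k ring) V = d"

definition d_num :: "('k::field) itself \<Rightarrow> nat set set \<Rightarrow> nat set \<Rightarrow> nat \<Rightarrow> nat set \<Rightarrow> nat set \<Rightarrow> nat" where
  "d_num _ \<Delta> W i F G =
     vectorspace.dim (class_ring :: 'k ring)
       (reduced_homology (induced (link \<Delta> (F \<union> G)) W) (int i - int (card F) - 1))"

definition binom :: "int \<Rightarrow> int \<Rightarrow> nat" where
  "binom p q =
     (if 0 \<le> q \<and> q \<le> p then nat p choose nat q
      else if p = -1 \<and> q = -1 then 1 else 0)"

end

theory Submission
  imports Defs "HOL-Library.Function_Algebras"
begin

text \<open>
  The Cech complex of $R = K[\Delta]$ on $y_1, \dots, y_n$ is graded by $\mathbb{Z}^{m+n}$, and its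
  cohomology can be computed in one multidegree $e$ at a time.  In multidegree $e$ the localization
  $R_{y_\sigma}$ is $K$ if $e$ is nonnegative outside $\sigma$ and
  $\mathrm{supp}(e) \cup \sigma \in \Delta$, and it is $0$ otherwise.  So the strand of multidegree
  $e$ is the cochain complex of the family of sets \<open>degree_complex \<Delta> W e\<close>, and there are two cases.

  If $e_w > 0$ for some $w \in W$, then adding $w$ to a set or removing it does not change whether the
  set belongs to the family: the family is a cone and its cochain complex is exact
  (\<open>coboundary_cone_exact\<close>).  Otherwise $\mathrm{supp}(e) = F \cup G$, where $F \subseteq W$ carries the
  negative and $G \subseteq V$ the positive entries, and $\sigma \mapsto \sigma \setminus F$ is a bijection
  of the family with $(\mathrm{lk}(F \cup G))_W$ that lowers cardinalities by $|F|$ and respects coboundaries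
  up to a change of signs (\<open>shifted_duality\<close>).  Cohomology of a complex with coefficients in a
  field has the dimension of its homology (\<open>simplicial_duality\<close>), so the multidegree contributes
  $d(i,F,G)$.  The multidegrees of bidegree $(k,j)$ with given $F$ and $G$ are pairs of compositions of
  $k$ into $|G|$ and of $-j$ into $|F|$ positive parts; their number is the product of the two
  binomial coefficients (\<open>card_degrees_with_supports\<close>).

  The Cech modules of a fixed bidegree are in general infinite-dimensional; only their cohomology is
  finite-dimensional.  Hence no dimensions are subtracted.  Instead, cocycles are chosen that represent a
  basis of the cohomology in each of the finitely many contributing multidegrees, and all other
  multidegrees are exact (\<open>graded_combination_spanning\<close>, \<open>graded_combination_independent\<close>).
  The dimension of the module of cosets is then read off from coordinates
  (\<open>has_dim_quotient_by_coordinates\<close>).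

  The bridge to the localizations of the quotient ring is the family of coefficients of a fraction
  (\<open>loc_coeff\<close>).  It identifies $R_{y_\sigma}$ with the finitely supported functions on the
  multidegrees in which it does not vanish, and the Cech differential with the simplicial coboundary
  taken degree by degree (\<open>\<Phi>_diff\<close>).
\<close>

section \<open>Dimensions from coordinates\<close>

definition coord_space :: "'a set \<Rightarrow> ('a \<Rightarrow> 'k::zero) set" where
  "coord_space A = {\<alpha>. \<forall>a. \<alpha> a \<noteq> 0 \<longrightarrow> a \<in> A}"

lemma coord_space_linear:
  fixes \<alpha> \<beta> :: "'a \<Rightarrow> 'k::field"
  assumes "\<alpha> \<in> coord_space A" "\<beta> \<in> coord_space A"
  shows "(\<lambda>a. \<alpha> a + \<beta> a) \<in> coord_space A" "(\<lambda>a. c * \<alpha> a) \<in> coord_space A"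
    "(\<lambda>a. \<alpha> a - \<beta> a) \<in> coord_space A" "(\<lambda>a. - \<alpha> a) \<in> coord_space A"
  using assms by (auto simp: coord_space_def) (metis add.right_neutral, metis)

lemma coord_space_zero [simp]: "(\<lambda>a. 0) \<in> coord_space A"
  by (simp add: coord_space_def)

text \<open>
  The vector space laws hold in \<open>U\<close> because they hold for coordinate vectors and
  \<open>f\<close> transports them.  After an enumeration of \<open>A\<close>, the map \<open>f\<close> is then a linear isomorphism of
  $K^{|A|}$ with \<open>U\<close>.
\<close>

lemma has_dim_by_coordinates:
  fixes U :: "('k::field, 'c) module" and f :: "('a \<Rightarrow> 'k) \<Rightarrow> 'c"
  assumes fin: "finite A"
    and bij: "bij_betw f (coord_space A) (carrier U)"
    and add: "\<And>\<alpha> \<beta>. \<alpha> \<in> coord_space A \<Longrightarrow> \<beta> \<in> coord_space A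
                \<Longrightarrow> f (\<lambda>a. \<alpha> a + \<beta> a) = f \<alpha> \<oplus>\<^bsub>U\<^esub> f \<beta>"
    and smult: "\<And>c \<alpha>. \<alpha> \<in> coord_space A \<Longrightarrow> f (\<lambda>a. c * \<alpha> a) = c \<odot>\<^bsub>U\<^esub> f \<alpha>"
    and zero: "f (\<lambda>a. 0) = \<zero>\<^bsub>U\<^esub>"
  shows "has_dim U (card A)"
proof -
  have img: "\<And>x. x \<in> carrier U \<Longrightarrow> \<exists>\<alpha>\<in>coord_space A. x = f \<alpha>"
    using bij by (auto simp: bij_betw_def)
  have closed: "\<And>\<alpha>. \<alpha> \<in> coord_space A \<Longrightarrow> f \<alpha> \<in> carrier U"
    using bij by (auto simp: bij_betw_def)
  note cl = coord_space_linear
  have grp: "abelian_group U"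
  proof (rule abelian_groupI)
    fix x y z assume "x \<in> carrier U" "y \<in> carrier U" "z \<in> carrier U"
    then obtain \<alpha> \<beta> \<gamma> where ab: "\<alpha> \<in> coord_space A" "\<beta> \<in> coord_space A" "\<gamma> \<in> coord_space A"
      and xy: "x = f \<alpha>" "y = f \<beta>" "z = f \<gamma>" using img by metis
    show "x \<oplus>\<^bsub>U\<^esub> y \<oplus>\<^bsub>U\<^esub> z = x \<oplus>\<^bsub>U\<^esub> (y \<oplus>\<^bsub>U\<^esub> z)"
      unfolding xy using ab by (simp flip: add add: cl add.assoc)
  next
    fix x y assume "x \<in> carrier U" "y \<in> carrier U"
    then obtain \<alpha> \<beta> where ab: "\<alpha> \<in> coord_space A" "\<beta> \<in> coord_space A"
      and xy: "x = f \<alpha>" "y = f \<beta>" using img by metis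
    show "x \<oplus>\<^bsub>U\<^esub> y \<in> carrier U" unfolding xy using ab by (simp flip: add add: cl closed)
    show "x \<oplus>\<^bsub>U\<^esub> y = y \<oplus>\<^bsub>U\<^esub> x" unfolding xy using ab by (simp flip: add add: cl add.commute)
  next
    show "\<zero>\<^bsub>U\<^esub> \<in> carrier U" using closed[of "\<lambda>a. 0"] zero by simp
  next
    fix x assume "x \<in> carrier U"
    then obtain \<alpha> where ab: "\<alpha> \<in> coord_space A" and x: "x = f \<alpha>" using img by metis
    show "\<zero>\<^bsub>U\<^esub> \<oplus>\<^bsub>U\<^esub> x = x" unfolding x zero[symmetric] using ab by (simp flip: add add: cl)
    show "\<exists>y\<in>carrier U. y \<oplus>\<^bsub>U\<^esub> x = \<zero>\<^bsub>U\<^esub>"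
      by (rule bexI[of _ "f (\<lambda>a. - \<alpha> a)"])
         (use ab in \<open>simp_all add: x cl closed zero flip: add\<close>)
  qed
  have mod: "module (class_ring :: 'k ring) U"
  proof (rule moduleI[OF class_cring.cring_axioms grp]; simp)
    fix c d :: 'k and x y assume "x \<in> carrier U"
    then obtain \<alpha> where a: "\<alpha> \<in> coord_space A" and x: "x = f \<alpha>" using img by metis
    show "c \<odot>\<^bsub>U\<^esub> x \<in> carrier U" unfolding x using a by (simp flip: smult add: cl closed)
    show "(c + d) \<odot>\<^bsub>U\<^esub> x = c \<odot>\<^bsub>U\<^esub> x \<oplus>\<^bsub>U\<^esub> d \<odot>\<^bsub>U\<^esub> x"
      unfolding x using a by (simp flip: smult add add: cl distrib_right)
    show "(c * d) \<odot>\<^bsub>U\<^esub> x = c \<odot>\<^bsub>U\<^esub> (d \<odot>\<^bsub>U\<^esub> x)"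
      unfolding x using a by (simp flip: smult add: cl mult.assoc)
    show "1 \<odot>\<^bsub>U\<^esub> x = x" unfolding x using a by (simp flip: smult)
    assume "y \<in> carrier U"
    then obtain \<beta> where b: "\<beta> \<in> coord_space A" and y: "y = f \<beta>" using img by metis
    show "c \<odot>\<^bsub>U\<^esub> (x \<oplus>\<^bsub>U\<^esub> y) = c \<odot>\<^bsub>U\<^esub> x \<oplus>\<^bsub>U\<^esub> c \<odot>\<^bsub>U\<^esub> y"
      unfolding x y using a b by (simp flip: smult add add: cl distrib_left)
  qed
  have vs: "vectorspace (class_ring :: 'k ring) U"
    unfolding vectorspace_def using mod class_field by simp
  define n where "n = card A"
  obtain h where h: "bij_betw h {0..<n} A"
    using ex_bij_betw_nat_finite[OF fin] unfolding n_def by blast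
  define T :: "'k vec \<Rightarrow> 'c" where
    "T = (\<lambda>v. f (\<lambda>a. if a \<in> A then v $ inv_into {0..<n} h a else 0))"
  interpret vec_space "TYPE('k)" n .
  have inv_lt: "\<And>a. a \<in> A \<Longrightarrow> inv_into {0..<n} h a < n"
    using h by (metis atLeastLessThan_iff bij_betw_def inv_into_into)
  have in_A: "(\<lambda>a. if a \<in> A then v $ inv_into {0..<n} h a else 0) \<in> coord_space A" for v :: "'k vec"
    by (simp add: coord_space_def)
  have T_add: "T (v + w) = T v \<oplus>\<^bsub>U\<^esub> T w" if v: "v \<in> carrier_vec n" and w: "w \<in> carrier_vec n" for v w
  proof -
    have "(\<lambda>a. if a \<in> A then (v + w) $ inv_into {0..<n} h a else 0)
        = (\<lambda>a. (if a \<in> A then v $ inv_into {0..<n} h a else 0)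
               + (if a \<in> A then w $ inv_into {0..<n} h a else 0))"
      using v w inv_lt by (intro ext) simp
    then show ?thesis
      unfolding T_def using add[OF in_A[of v] in_A[of w]] by simp
  qed
  have T_smult: "T (c \<cdot>\<^sub>v v) = c \<odot>\<^bsub>U\<^esub> T v" if v: "v \<in> carrier_vec n" for c v
  proof -
    have "(\<lambda>a. if a \<in> A then (c \<cdot>\<^sub>v v) $ inv_into {0..<n} h a else 0)
        = (\<lambda>a. c * (if a \<in> A then v $ inv_into {0..<n} h a else 0))"
      using v inv_lt by (intro ext) simp
    then show ?thesis
      unfolding T_def using smult[OF in_A[of v], of c] by simp
  qed
  have "T \<in> carrier_vec n \<rightarrow> carrier U" unfolding T_def using closed in_A by blast
  then have "T \<in> LinearCombinations.module_hom (class_ring :: 'k ring) V U"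
    unfolding LinearCombinations.module_hom_def using T_add T_smult by simp
  then have lin: "linear_map (class_ring :: 'k ring) V U T"
    unfolding linear_map_def mod_hom_def mod_hom_axioms_def
    using vs mod vectorspace_axioms module_axioms by simp
  interpret T: linear_map "class_ring :: 'k ring" V U T by (rule lin)
  have fin_im: "T ` carrier V = carrier U"
  proof
    show "T ` carrier V \<subseteq> carrier U" unfolding T_def using closed in_A by blast
    show "carrier U \<subseteq> T ` carrier V"
    proof
      fix x assume "x \<in> carrier U"
      then obtain \<alpha> where a: "\<alpha> \<in> coord_space A" and x: "x = f \<alpha>" using img by metis
      have "T (vec n (\<lambda>i. \<alpha> (h i))) = x"
        unfolding T_def x
        by (rule arg_cong[of _ _ f])
           (use a inv_lt h in \<open>auto simp: fun_eq_iff coord_space_def bij_betw_def f_inv_into_f\<close>)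
      then show "x \<in> T ` carrier V" by (metis imageI vec_carrier carrier_vec_dim_vec module_vec_simps(3) dim_vec)
    qed
  qed
  have inj: "inj_on T (carrier V)"
  proof (rule inj_onI)
    fix v w :: "'k vec" assume v: "v \<in> carrier V" and w: "w \<in> carrier V" and eq: "T v = T w"
    have "(\<lambda>a. if a \<in> A then v $ inv_into {0..<n} h a else 0)
        = (\<lambda>a. if a \<in> A then w $ inv_into {0..<n} h a else 0)"
      using eq in_A bij unfolding T_def bij_betw_def inj_on_def by blast
    then have *: "\<And>a. a \<in> A \<Longrightarrow> v $ inv_into {0..<n} h a = w $ inv_into {0..<n} h a"
      by (metis (mono_tags))
    show "v = w"
    proof (rule eq_vecI)
      fix i assume "i < dim_vec w"
      then have "i \<in> {0..<n}" using w by auto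
      then show "v $ i = w $ i" using *[of "h i"] h by (simp add: bij_betw_def inv_into_f_f image_iff) (metis atLeastLessThan_iff imageI zero_le)
    qed (use v w in auto)
  qed
  show ?thesis
    unfolding has_dim_def
    using vs T.surj_fin_dim[OF fin_dim fin_im] T.dim_eq[OF fin_dim inj fin_im] dim_is_n
    by (simp add: n_def)
qed

text \<open>
  A space of cosets \<open>Z / N\<close> has a basis indexed by \<open>A\<close> as soon as \<open>T\<close> assigns to
  coordinate vectors elements of \<open>Z\<close> that are linearly independent modulo \<open>N\<close> and, together with \<open>N\<close>,
  exhaust \<open>Z\<close>.  The injection \<open>e\<close> into functions turns the operations \<open>ad\<close> and \<open>sm\<close> of the ambient set \<open>C\<close>
  into pointwise ones, so that cosets can be compared through their images under \<open>e\<close>.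
\<close>

lemma has_dim_quotient_by_coordinates:
  fixes U :: "('k::field, 'c set) module" and e :: "'c \<Rightarrow> 'x \<Rightarrow> 'k"
    and ad :: "'c \<Rightarrow> 'c \<Rightarrow> 'c" and sm :: "'k \<Rightarrow> 'c \<Rightarrow> 'c" and T :: "('a \<Rightarrow> 'k) \<Rightarrow> 'c"
  assumes fin: "finite A"
    and inj: "inj_on e C"
    and ad: "\<And>x y. x \<in> C \<Longrightarrow> y \<in> C \<Longrightarrow> ad x y \<in> C \<and> e (ad x y) = (\<lambda>t. e x t + e y t)"
    and sm: "\<And>c x. x \<in> C \<Longrightarrow> sm c x \<in> C \<and> e (sm c x) = (\<lambda>t. c * e x t)"
    and Z: "Z \<subseteq> C"
    and N: "N \<subseteq> C" and N0: "(\<lambda>t. 0) \<in> e ` N"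
    and N_add: "\<And>x y. x \<in> N \<Longrightarrow> y \<in> N \<Longrightarrow> ad x y \<in> N"
    and N_sm: "\<And>c x. x \<in> N \<Longrightarrow> sm c x \<in> N"
    and U_carrier: "carrier U = (\<lambda>c. (\<lambda>b. ad b c) ` N) ` Z"
    and U_zero: "\<zero>\<^bsub>U\<^esub> = N"
    and U_add: "\<And>X Y. X \<oplus>\<^bsub>U\<^esub> Y = (\<Union>x\<in>X. \<Union>y\<in>Y. {ad x y})"
    and U_smult: "\<And>c X. c \<odot>\<^bsub>U\<^esub> X = (\<Union>x\<in>X. (\<lambda>b. ad b (sm c x)) ` N)"
    and T: "\<And>\<alpha>. \<alpha> \<in> coord_space A \<Longrightarrow> T \<alpha> \<in> Z"
    and T_add: "\<And>\<alpha> \<beta>. \<alpha> \<in> coord_space A \<Longrightarrow> \<beta> \<in> coord_space A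
                  \<Longrightarrow> e (T (\<lambda>a. \<alpha> a + \<beta> a)) = (\<lambda>t. e (T \<alpha>) t + e (T \<beta>) t)"
    and T_smult: "\<And>c \<alpha>. \<alpha> \<in> coord_space A \<Longrightarrow> e (T (\<lambda>a. c * \<alpha> a)) = (\<lambda>t. c * e (T \<alpha>) t)"
    and T_ker: "\<And>\<alpha>. \<alpha> \<in> coord_space A \<Longrightarrow> T \<alpha> \<in> N \<Longrightarrow> \<alpha> = (\<lambda>a. 0)"
    and T_onto: "\<And>z. z \<in> Z \<Longrightarrow> \<exists>\<alpha>\<in>coord_space A. \<exists>b\<in>N. e z = (\<lambda>t. e b t + e (T \<alpha>) t)"
  shows "has_dim U (card A)"
proof -
  define Q where "Q = (\<lambda>c. (\<lambda>b. ad b c) ` N)"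
  have eN: "e ` Q c = (\<lambda>u t. u t + e c t) ` e ` N" if "c \<in> C" for c
    unfolding Q_def image_image using that N ad by (intro image_cong) auto
  have QC: "Q c \<subseteq> C" if "c \<in> C" for c using that N ad unfolding Q_def by auto
  have N_addE: "(\<lambda>t. u t + v t) \<in> e ` N" if "u \<in> e ` N" "v \<in> e ` N" for u v
  proof -
    from that obtain x y where xy: "x \<in> N" "u = e x" "y \<in> N" "v = e y" by blast
    then have "e (ad x y) = (\<lambda>t. u t + v t)" using ad N by blast
    then show ?thesis using N_add[OF xy(1,3)] by (metis imageI)
  qed
  have N_smE: "(\<lambda>t. a * u t) \<in> e ` N" if "u \<in> e ` N" for a u
  proof -
    from that obtain x where x: "x \<in> N" "u = e x" by blast
    then have "e (sm a x) = (\<lambda>t. a * u t)" using sm N by blast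
    then show ?thesis using N_sm[OF x(1), of a] by (metis imageI)
  qed
  have N_neg: "(\<lambda>t. - u t) \<in> e ` N" if "u \<in> e ` N" for u
    using N_smE[OF that, of "- 1"] by simp
  have Q_eq_iff: "Q c = Q d \<longleftrightarrow> (\<lambda>t. e c t - e d t) \<in> e ` N" if c: "c \<in> C" and d: "d \<in> C" for c d
  proof -
    have "Q c = Q d \<longleftrightarrow> e ` Q c = e ` Q d"
      using inj_on_image_eq_iff[OF inj QC[OF c] QC[OF d]] by simp
    also have "\<dots> \<longleftrightarrow> (\<lambda>t. e c t - e d t) \<in> e ` N"
    proof
      assume eq: "e ` Q c = e ` Q d"
      have "(\<lambda>t. 0 + e c t) \<in> e ` Q c" unfolding eN[OF c] using N0 by (rule imageI)
      then obtain u where u: "u \<in> e ` N" "(\<lambda>t. 0 + e c t) = (\<lambda>t. u t + e d t)"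
        unfolding eq eN[OF d] by blast
      have "(\<lambda>t. e c t - e d t) = u" using fun_cong[OF u(2)] by (simp add: fun_eq_iff)
      then show "(\<lambda>t. e c t - e d t) \<in> e ` N" using u(1) by simp
    next
      assume *: "(\<lambda>t. e c t - e d t) \<in> e ` N"
      show "e ` Q c = e ` Q d"
      proof (intro equalityI subsetI)
        fix x assume "x \<in> e ` Q c"
        then obtain u where u: "u \<in> e ` N" and x: "x = (\<lambda>t. u t + e c t)" unfolding eN[OF c] by blast
        have "x = (\<lambda>t. (u t + (e c t - e d t)) + e d t)" unfolding x by simp
        then show "x \<in> e ` Q d" unfolding eN[OF d] using N_addE[OF u *] by (rule image_eqI)
      next
        fix x assume "x \<in> e ` Q d"
        then obtain u where u: "u \<in> e ` N" and x: "x = (\<lambda>t. u t + e d t)" unfolding eN[OF d] by blast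
        have "x = (\<lambda>t. (u t + - (e c t - e d t)) + e c t)" unfolding x by simp
        then show "x \<in> e ` Q c" unfolding eN[OF c] using N_addE[OF u N_neg[OF *]] by (rule image_eqI)
      qed
    qed
    finally show ?thesis .
  qed
  have Q_eqI: "X = Q d" if "X \<subseteq> C" "d \<in> C" "e ` X = e ` Q d" for X d
    using inj_on_image_eq_iff[OF inj that(1) QC[OF that(2)]] that(3) by simp
  have TC: "T \<alpha> \<in> C" if "\<alpha> \<in> coord_space A" for \<alpha> using T[OF that] Z by blast
  note cl = coord_space_linear
  have T0: "e (T (\<lambda>a. 0)) = (\<lambda>t. 0)" using T_smult[of "\<lambda>a. 0" 0] by simp
  have Q_add: "Q c \<oplus>\<^bsub>U\<^esub> Q d = Q b" if c: "c \<in> C" and d: "d \<in> C" and b: "b \<in> C"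
    and eb: "e b = (\<lambda>t. e c t + e d t)" for b c d
  proof (rule Q_eqI[OF _ b])
    show "Q c \<oplus>\<^bsub>U\<^esub> Q d \<subseteq> C" unfolding U_add using QC[OF c] QC[OF d] ad by auto
    have "e ` (Q c \<oplus>\<^bsub>U\<^esub> Q d) = (\<Union>x\<in>Q c. \<Union>y\<in>Q d. {e (ad x y)})"
      unfolding U_add by blast
    also have "\<dots> = (\<Union>x\<in>Q c. \<Union>y\<in>Q d. {(\<lambda>t. e x t + e y t)})"
      using QC[OF c] QC[OF d] ad by (intro SUP_cong) auto
    also have "\<dots> = (\<Union>u\<in>e ` Q c. \<Union>v\<in>e ` Q d. {(\<lambda>t. u t + v t)})" by blast
    also have "\<dots> = e ` Q b"
      unfolding eN[OF c] eN[OF d] eN[OF b] eb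
    proof (intro equalityI subsetI, goal_cases)
      case (1 x)
      then obtain u v where uv: "u \<in> e ` N" "v \<in> e ` N" "x = (\<lambda>t. (u t + e c t) + (v t + e d t))"
        by blast
      have "x = (\<lambda>t. (u t + v t) + (e c t + e d t))" unfolding uv(3) by (simp add: algebra_simps)
      then show ?case using N_addE[OF uv(1,2)] by (rule image_eqI)
    next
      case (2 x)
      then obtain u where u: "u \<in> e ` N" "x = (\<lambda>t. u t + (e c t + e d t))" by blast
      have "x = (\<lambda>t. (u t + e c t) + (0 + e d t))" unfolding u(2) by (simp add: algebra_simps)
      then show ?case using u(1) N0 by blast
    qed
    finally show "e ` (Q c \<oplus>\<^bsub>U\<^esub> Q d) = e ` Q b" .
  qed
  have Q_smult: "a \<odot>\<^bsub>U\<^esub> Q c = Q b" if c: "c \<in> C" and b: "b \<in> C"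
    and eb: "e b = (\<lambda>t. a * e c t)" for a b c
  proof -
    have "Q (sm a x) = Q b" if xQ: "x \<in> Q c" for x
    proof -
      obtain n where n: "n \<in> N" "x = ad n c" using xQ unfolding Q_def by blast
      have x: "x \<in> C" using QC[OF c] xQ by blast
      have "(\<lambda>t. e (sm a x) t - e b t) = (\<lambda>t. a * e n t)"
        using n c N ad sm x eb by (auto simp: fun_eq_iff algebra_simps subset_iff)
      then show ?thesis using N_smE[of "e n" a] n x Q_eq_iff[OF _ b] sm by simp
    qed
    moreover have "Q c \<noteq> {}" using N0 unfolding Q_def by auto
    ultimately have "(\<Union>x\<in>Q c. Q (sm a x)) = Q b" by auto
    then show ?thesis unfolding U_smult by (simp add: Q_def)
  qed
  show ?thesis
  proof (rule has_dim_by_coordinates[OF fin, where f = "\<lambda>\<alpha>. Q (T \<alpha>)"])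
    show "bij_betw (\<lambda>\<alpha>. Q (T \<alpha>)) (coord_space A) (carrier U)"
      unfolding bij_betw_def
    proof
      show "inj_on (\<lambda>\<alpha>. Q (T \<alpha>)) (coord_space A)"
      proof (rule inj_onI)
        fix \<alpha> \<beta> assume a: "\<alpha> \<in> coord_space A" and b: "\<beta> \<in> coord_space A" and eq: "Q (T \<alpha>) = Q (T \<beta>)"
        have d: "(\<lambda>x. \<alpha> x + (- 1) * \<beta> x) \<in> coord_space A" using a b cl(3) by simp
        have "e (T (\<lambda>x. \<alpha> x + (- 1) * \<beta> x)) = (\<lambda>t. e (T \<alpha>) t - e (T \<beta>) t)"
          using T_add[OF a cl(2)[OF b b], of "- 1"] T_smult[OF b, of "- 1"] by simp
        also have "\<dots> \<in> e ` N" using eq Q_eq_iff TC a b by blast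
        finally have "T (\<lambda>x. \<alpha> x + (- 1) * \<beta> x) \<in> N"
          using inj TC[OF d] N by (auto dest!: inj_onD)
        from T_ker[OF d this] show "\<alpha> = \<beta>" by (simp add: fun_eq_iff)
      qed
      show "(\<lambda>\<alpha>. Q (T \<alpha>)) ` coord_space A = carrier U"
      proof (intro equalityI subsetI)
        fix x assume "x \<in> (\<lambda>\<alpha>. Q (T \<alpha>)) ` coord_space A"
        then show "x \<in> carrier U" unfolding U_carrier Q_def using T by blast
      next
        fix x assume "x \<in> carrier U"
        then obtain z where z: "z \<in> Z" and x: "x = Q z" unfolding U_carrier Q_def by blast
        obtain \<alpha> b where "\<alpha> \<in> coord_space A" "b \<in> N" "e z = (\<lambda>t. e b t + e (T \<alpha>) t)"
          using T_onto[OF z] by blast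
        then have "Q z = Q (T \<alpha>)" using Q_eq_iff[of z "T \<alpha>"] z Z TC[of \<alpha>] by auto
        then show "x \<in> (\<lambda>\<alpha>. Q (T \<alpha>)) ` coord_space A" using x \<open>\<alpha> \<in> coord_space A\<close> by blast
      qed
    qed
    show "Q (T (\<lambda>a. \<alpha> a + \<beta> a)) = Q (T \<alpha>) \<oplus>\<^bsub>U\<^esub> Q (T \<beta>)"
      if "\<alpha> \<in> coord_space A" "\<beta> \<in> coord_space A" for \<alpha> \<beta>
      using Q_add TC T_add that cl(1) by metis
    show "Q (T (\<lambda>a. c * \<alpha> a)) = c \<odot>\<^bsub>U\<^esub> Q (T \<alpha>)" if "\<alpha> \<in> coord_space A" for c \<alpha>
      using Q_smult TC T_smult that cl(2) by metis
    have "e ` Q (T (\<lambda>a. 0)) = e ` N" unfolding eN[OF TC[OF coord_space_zero]] T0 by simp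
    then show "Q (T (\<lambda>a. 0)) = \<zero>\<^bsub>U\<^esub>"
      unfolding U_zero using Q_eqI QC[OF TC[OF coord_space_zero]] N inj_on_image_eq_iff[OF inj] by metis
  qed
qed

section \<open>Dual bases in spaces of functions\<close>

text \<open>
  Pointwise scaling is named so that functions can interpret the locale of vector spaces.
\<close>

definition fscale :: "'k::field \<Rightarrow> ('a \<Rightarrow> 'k) \<Rightarrow> 'a \<Rightarrow> 'k" where
  "fscale c f = (\<lambda>x. c * f x)"

lemma fscale_apply [simp]: "fscale c f x = c * f x"
  by (simp add: fscale_def)

interpretation fun_vs: vector_space "fscale :: 'k::field \<Rightarrow> ('a \<Rightarrow> 'k) \<Rightarrow> 'a \<Rightarrow> 'k"
  by unfold_locales (auto simp: fun_eq_iff algebra_simps)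

interpretation fun_vs_pair: vector_space_pair
  "fscale :: 'k::field \<Rightarrow> ('a \<Rightarrow> 'k) \<Rightarrow> 'a \<Rightarrow> 'k" "fscale :: 'k::field \<Rightarrow> ('b \<Rightarrow> 'k) \<Rightarrow> 'b \<Rightarrow> 'k"
  by unfold_locales

lemma sum_fun_apply: "sum f A x = (\<Sum>a\<in>A. f a x)"
  by (induction A rule: infinite_finite_induct) auto

lemma subspace_coord_space: "fun_vs.subspace (coord_space X :: ('a \<Rightarrow> 'k::field) set)"
  unfolding fun_vs.subspace_def coord_space_def
  by auto (metis add.right_neutral)

definition pairing :: "'a set \<Rightarrow> ('a \<Rightarrow> 'k::field) \<Rightarrow> ('a \<Rightarrow> 'k) \<Rightarrow> 'k" where
  "pairing X f x = (\<Sum>F\<in>X. f F * x F)"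

definition unit_fun :: "'a \<Rightarrow> 'a \<Rightarrow> 'k::field" where
  "unit_fun F = (\<lambda>G. if G = F then 1 else 0)"

lemma unit_fun_coord_space: "F \<in> X \<Longrightarrow> unit_fun F \<in> coord_space X"
  by (simp add: unit_fun_def coord_space_def)

lemma pairing_unit_fun: "finite X \<Longrightarrow> F \<in> X \<Longrightarrow> pairing X f (unit_fun F) = f F"
  by (simp add: pairing_def unit_fun_def if_distrib cong: if_cong)

lemma pairing_linear:
  "pairing X f (x + y) = pairing X f x + pairing X f y"
  "pairing X f (fscale c x) = c * pairing X f x"
  by (simp_all add: pairing_def algebra_simps sum.distrib sum_distrib_left)

lemma pairing_sum: "pairing X f (sum g A) = (\<Sum>a\<in>A. pairing X f (g a))"
  unfolding pairing_def sum_fun_apply sum_distrib_left by (rule sum.swap)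

lemma pairing_diff_left: "pairing X (\<lambda>F. f F - g F) x = pairing X f x - pairing X g x"
  by (simp add: pairing_def algebra_simps sum_subtractf)

lemma pairing_lincomb_left:
  "pairing X (\<lambda>F. \<Sum>a\<in>A. \<alpha> a * \<zeta> a F) x = (\<Sum>a\<in>A. \<alpha> a * pairing X (\<zeta> a) x)"
  unfolding pairing_def sum_distrib_left sum_distrib_right
  by (subst sum.swap) (simp add: mult.assoc)

lemma coord_space_expansion:
  assumes "finite X" "x \<in> coord_space X"
  shows "x = (\<Sum>F\<in>X. fscale (x F) (unit_fun F))"
proof
  fix G
  show "x G = (\<Sum>F\<in>X. fscale (x F) (unit_fun F)) G"
    using assms by (cases "G \<in> X") (auto simp: sum_fun_apply unit_fun_def coord_space_def if_distrib cong: if_cong)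
qed

text \<open>
  Extend a basis of \<open>B\<close> to one of \<open>Z\<close> and further to one of all functions.  The vectors
  added in the first extension form \<open>A\<close>, a basis of \<open>Z / B\<close>; the coordinate functionals
  belonging to them are the \<open>\<zeta> a\<close>.  They represent a basis of the quotient of the
  annihilator of \<open>B\<close> by the annihilator of \<open>Z\<close>, dual to \<open>A\<close>.
\<close>

lemma dual_bases:
  fixes B Z :: "('a \<Rightarrow> 'k::field) set"
  assumes fin: "finite X" and BZ: "B \<subseteq> Z" and ZX: "Z \<subseteq> coord_space X"
    and sB: "fun_vs.subspace B" and sZ: "fun_vs.subspace Z"
  obtains A :: "('a \<Rightarrow> 'k) set" and \<zeta> where
    "finite A" "A \<subseteq> Z" "\<And>a. a \<in> A \<Longrightarrow> \<zeta> a \<in> coord_space X"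
    "\<And>a b. a \<in> A \<Longrightarrow> b \<in> B \<Longrightarrow> pairing X (\<zeta> a) b = 0"
    "\<And>a b. a \<in> A \<Longrightarrow> b \<in> A \<Longrightarrow> pairing X (\<zeta> a) b = (if a = b then 1 else 0)"
    "\<And>x. x \<in> Z \<Longrightarrow> x - (\<Sum>a\<in>A. fscale (pairing X (\<zeta> a) x) a) \<in> B"
    "\<And>f x. \<forall>b\<in>B. pairing X f b = 0 \<Longrightarrow> x \<in> Z
       \<Longrightarrow> pairing X (\<lambda>F. f F - (\<Sum>a\<in>A. pairing X f a * \<zeta> a F)) x = 0"
proof -
  obtain b0 where b0: "b0 \<subseteq> B" "fun_vs.independent b0" "B \<subseteq> fun_vs.span b0"
    using fun_vs.maximal_independent_subset by blast
  obtain b1 where b1: "b0 \<subseteq> b1" "b1 \<subseteq> Z" "fun_vs.independent b1" "Z \<subseteq> fun_vs.span b1"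
    using fun_vs.maximal_independent_subset_extend[OF subset_trans[OF b0(1) BZ] b0(2)] by metis
  obtain b2 where b2: "b1 \<subseteq> b2" "fun_vs.independent b2" "UNIV \<subseteq> fun_vs.span b2"
    using fun_vs.maximal_independent_subset_extend[OF subset_UNIV b1(3)] by metis
  have in_span: "x \<in> fun_vs.span b2" for x using b2 by blast
  have "b1 \<subseteq> fun_vs.span (unit_fun ` X)"
  proof
    fix x assume "x \<in> b1"
    then have "x = (\<Sum>F\<in>X. fscale (x F) (unit_fun F))"
      using coord_space_expansion[OF fin] b1 ZX by blast
    also have "\<dots> \<in> fun_vs.span (unit_fun ` X)"
      by (intro fun_vs.span_sum fun_vs.span_scale fun_vs.span_base) auto
    finally show "x \<in> fun_vs.span (unit_fun ` X)" .
  qed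
  then have fin1: "finite b1" using fun_vs.independent_span_bound[OF _ b1(3)] fin by blast
  define A where "A = b1 - b0"
  define \<zeta> :: "('a \<Rightarrow> 'k) \<Rightarrow> 'a \<Rightarrow> 'k" where
    "\<zeta> = (\<lambda>a F. if F \<in> X then fun_vs.representation b2 (unit_fun F) a else 0)"
  have \<zeta>: "pairing X (\<zeta> a) x = fun_vs.representation b2 x a" if x: "x \<in> coord_space X" for a x
  proof -
    have "fun_vs.representation b2 x a
        = fun_vs.representation b2 (\<Sum>F\<in>X. fscale (x F) (unit_fun F)) a"
      using coord_space_expansion[OF fin x] by simp
    also have "\<dots> = (\<Sum>F\<in>X. x F * fun_vs.representation b2 (unit_fun F) a)"
      by (simp add: fun_vs.representation_sum[OF b2(2)] fun_vs.representation_scale[OF b2(2)] in_span)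
    also have "\<dots> = pairing X (\<zeta> a) x"
      unfolding pairing_def \<zeta>_def by (intro sum.cong) auto
    finally show ?thesis by simp
  qed
  have rep_basis: "fun_vs.representation b2 b a = (if a = b then 1 else 0)" if "b \<in> b2" for a b
    using fun_vs.representation_basis[OF b2(2) that] by simp
  have sub: "b1 \<subseteq> coord_space X" "b0 \<subseteq> coord_space X" using b1 ZX BZ b0 by auto
  have rep_span: "fun_vs.representation b2 x a = 0" if "x \<in> fun_vs.span b" "b \<subseteq> b2" "a \<notin> b" for x a b
    using fun_vs.representation_extend[OF b2(2) that(1,2)] fun_vs.representation_ne_zero that(3) by metis
  have expand: "x = (\<Sum>b\<in>b1. fscale (fun_vs.representation b2 x b) b)" if "x \<in> Z" for x
  proof -
    have "x \<in> fun_vs.span b1" using that b1 by blast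
    then show ?thesis
      using fun_vs.sum_representation_eq[OF b1(3) _ fin1 order_refl]
        fun_vs.representation_extend[OF b2(2) _ b2(1)] by metis
  qed
  show ?thesis
  proof (rule that[of A \<zeta>])
    show "finite A" unfolding A_def using fin1 by blast
    show "A \<subseteq> Z" unfolding A_def using b1 by blast
    show "\<zeta> a \<in> coord_space X" for a by (simp add: \<zeta>_def coord_space_def)
    show "pairing X (\<zeta> a) b = 0" if "a \<in> A" "b \<in> B" for a b
    proof -
      have "b \<in> coord_space X" "b \<in> fun_vs.span b0" "b0 \<subseteq> b2" "a \<notin> b0"
        using that b0(3) b1(1) b2(1) BZ ZX unfolding A_def by auto
      then show ?thesis using \<zeta> rep_span by simp
    qed
    show "pairing X (\<zeta> a) b = (if a = b then 1 else 0)" if "a \<in> A" "b \<in> A" for a b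
    proof -
      have "b \<in> coord_space X" "b \<in> b2" using that sub(1) b2(1) unfolding A_def by auto
      then show ?thesis using \<zeta> rep_basis by simp
    qed
    show "x - (\<Sum>a\<in>A. fscale (pairing X (\<zeta> a) x) a) \<in> B" if "x \<in> Z" for x
    proof -
      have "x = (\<Sum>b\<in>b0. fscale (fun_vs.representation b2 x b) b)
               + (\<Sum>a\<in>A. fscale (fun_vs.representation b2 x a) a)"
        using expand[OF that] sum.subset_diff[OF b1(1) fin1] unfolding A_def by (metis (no_types, lifting) add.commute)
      also have "(\<Sum>a\<in>A. fscale (fun_vs.representation b2 x a) a) = (\<Sum>a\<in>A. fscale (pairing X (\<zeta> a) x) a)"
        using \<zeta> that ZX by (intro sum.cong) auto
      finally have "x - (\<Sum>a\<in>A. fscale (pairing X (\<zeta> a) x) a)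
          = (\<Sum>b\<in>b0. fscale (fun_vs.representation b2 x b) b)"
        by (metis (no_types, lifting) add_diff_cancel_right')
      also have "\<dots> \<in> B"
        using b0(1) by (intro fun_vs.subspace_sum[OF sB] fun_vs.subspace_scale[OF sB]) auto
      finally show ?thesis .
    qed
    show "pairing X (\<lambda>F. f F - (\<Sum>a\<in>A. pairing X f a * \<zeta> a F)) x = 0"
      if f: "\<forall>b\<in>B. pairing X f b = 0" and x: "x \<in> Z" for f x
    proof -
      let ?g = "\<lambda>F. f F - (\<Sum>a\<in>A. pairing X f a * \<zeta> a F)"
      have *: "pairing X ?g b = 0" if b: "b \<in> b1" for b
      proof -
        have "pairing X ?g b = pairing X f b - (\<Sum>a\<in>A. pairing X f a * (if a = b then 1 else 0))"
          unfolding pairing_diff_left pairing_lincomb_left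
          using \<zeta>[OF subsetD[OF sub(1) b]] rep_basis[OF subsetD[OF b2(1) b]] by simp
        also have "\<dots> = 0"
        proof (cases "b \<in> b0")
          case True
          then show ?thesis using f b0 by (auto simp: A_def intro!: sum.neutral)
        next
          case False
          then have "b \<in> A" "finite A" using b fin1 unfolding A_def by auto
          then show ?thesis by (simp add: if_distrib cong: if_cong)
        qed
        finally show ?thesis .
      qed
      have "pairing X ?g x = (\<Sum>b\<in>b1. fun_vs.representation b2 x b * pairing X ?g b)"
        by (subst expand[OF x]) (simp add: pairing_sum pairing_linear)
      then show ?thesis using * by simp
    qed
  qed
qed

section \<open>Duality of simplicial homology and cohomology\<close>

definition simplicial :: "nat set set \<Rightarrow> bool" where
  "simplicial \<Gamma> \<longleftrightarrow> finite \<Gamma> \<and> (\<forall>F\<in>\<Gamma>. finite F \<and> (\<forall>G\<subseteq>F. G \<in> \<Gamma>))"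

definition faces :: "nat set set \<Rightarrow> int \<Rightarrow> nat set set" where
  "faces \<Gamma> p = {F \<in> \<Gamma>. int (card F) - 1 = p}"

definition sgn_in :: "nat set \<Rightarrow> nat \<Rightarrow> 'k::field" where
  "sgn_in F v = (-1) ^ card {u \<in> F. u < v}"

text \<open>
  For a simplicial complex this is the transpose of the boundary map.  It is also used for families that are not
  closed under subsets; there \<open>h\<close> is taken to vanish outside of the family.
\<close>

definition coboundary :: "nat set set \<Rightarrow> (nat set \<Rightarrow> 'k::field) \<Rightarrow> nat set \<Rightarrow> 'k" where
  "coboundary \<Gamma> h F = (if F \<in> \<Gamma> then \<Sum>v\<in>F. sgn_in F v * h (F - {v}) else 0)"

lemma sgn_in_square [simp]: "sgn_in F v * sgn_in F v = (1 :: 'k::field)"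
  by (simp add: sgn_in_def flip: power_mult_distrib)

lemma sgn_in_remove: "sgn_in (F - {v}) v = sgn_in F v"
  unfolding sgn_in_def by (metis Diff_iff less_irrefl singletonD)

lemma sgn_in_insert:
  assumes "finite F" "v \<notin> F"
  shows "sgn_in (insert v F) w = (if v < w then - sgn_in F w else (sgn_in F w :: 'k::field))"
proof -
  have "{u \<in> insert v F. u < w} = (if v < w then insert v {u \<in> F. u < w} else {u \<in> F. u < w})"
    by auto
  then show ?thesis using assms by (simp add: sgn_in_def)
qed

lemma boundary_eq: "boundary \<Gamma> c G = (\<Sum>v\<in>{v. v \<notin> G \<and> insert v G \<in> \<Gamma>}. sgn_in G v * c (insert v G))"
  by (simp add: boundary_def sgn_in_def)

lemma simplicial_finite_insertions:
  assumes "simplicial \<Gamma>" shows "finite {v. v \<notin> G \<and> insert v G \<in> \<Gamma>}"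
  by (rule finite_subset[of _ "\<Union>\<Gamma>"]) (use assms in \<open>auto simp: simplicial_def\<close>)

lemma faces_subset: "faces \<Gamma> p \<subseteq> \<Gamma>" by (auto simp: faces_def)

lemma finite_faces: "simplicial \<Gamma> \<Longrightarrow> finite (faces \<Gamma> p)"
  using finite_subset[OF faces_subset] by (auto simp: simplicial_def)

lemma boundary_faces:
  assumes "simplicial \<Gamma>" "c \<in> coord_space (faces \<Gamma> (p + 1))"
  shows "boundary \<Gamma> c \<in> coord_space (faces \<Gamma> p)"
  unfolding coord_space_def
proof (intro CollectI allI impI)
  fix G assume "boundary \<Gamma> c G \<noteq> 0"
  then obtain v where v: "v \<notin> G" "insert v G \<in> \<Gamma>" "c (insert v G) \<noteq> 0"
    unfolding boundary_eq by (metis (mono_tags, lifting) mem_Collect_eq mult_zero_right sum.neutral)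
  have "finite (insert v G)" "G \<in> \<Gamma>"
    using assms(1) v(2) subset_insertI[of G v] unfolding simplicial_def by auto
  moreover have "int (card (insert v G)) - 1 = p + 1"
    using assms(2) v(3) unfolding coord_space_def faces_def by blast
  ultimately have "int (card (insert v G)) - 1 = p + 1" "finite G" "G \<in> \<Gamma>" by simp_all
  then show "G \<in> faces \<Gamma> p" using v by (simp add: faces_def)
qed

lemma coboundary_faces:
  assumes "simplicial \<Gamma>" "h \<in> coord_space (faces \<Gamma> (p - 1))"
  shows "coboundary \<Gamma> h \<in> coord_space (faces \<Gamma> p)"
  unfolding coord_space_def
proof (intro CollectI allI impI)
  fix F assume *: "coboundary \<Gamma> h F \<noteq> 0"
  then have F: "F \<in> \<Gamma>" by (auto simp: coboundary_def split: if_splits)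
  then obtain v where v: "v \<in> F" "h (F - {v}) \<noteq> 0"
    using * unfolding coboundary_def by (metis (mono_tags, lifting) mult_zero_right sum.neutral)
  then have "int (card (F - {v})) - 1 = p - 1" "finite F"
    using assms F unfolding simplicial_def coord_space_def faces_def by auto
  then show "F \<in> faces \<Gamma> p" using v F by (simp add: faces_def card_Diff_singleton card_gt_0_iff of_nat_diff Suc_leI) (metis One_nat_def Suc_leI card_gt_0_iff empty_iff of_nat_1 of_nat_diff diff_add_cancel)
qed

text \<open>
  Both sides are sums over the pairs of a face and one of its vertices; on the right the
  face is recorded by what remains after the vertex has been removed.
\<close>

lemma coboundary_adjoint:
  fixes h c :: "nat set \<Rightarrow> 'k::field"
  assumes "simplicial \<Gamma>"
  shows "pairing \<Gamma> (coboundary \<Gamma> h) c = pairing \<Gamma> h (boundary \<Gamma> c)"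
proof -
  let ?ins = "\<lambda>G. {v. v \<notin> G \<and> insert v G \<in> \<Gamma>}"
  have fin: "finite \<Gamma>" "\<And>F. F \<in> \<Gamma> \<Longrightarrow> finite F" using assms by (auto simp: simplicial_def)
  have closed: "\<And>F v. F \<in> \<Gamma> \<Longrightarrow> F - {v} \<in> \<Gamma>" using assms by (auto simp: simplicial_def)
  have "pairing \<Gamma> (coboundary \<Gamma> h) c = (\<Sum>F\<in>\<Gamma>. \<Sum>v\<in>F. sgn_in F v * h (F - {v}) * c F)"
    by (simp add: pairing_def coboundary_def sum_distrib_right)
  also have "\<dots> = (\<Sum>(F, v)\<in>Sigma \<Gamma> (\<lambda>F. F). sgn_in F v * h (F - {v}) * c F)"
    using fin by (simp add: sum.Sigma)
  also have "\<dots> = (\<Sum>(G, v)\<in>Sigma \<Gamma> ?ins. sgn_in G v * h G * c (insert v G))"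
    by (rule sum.reindex_bij_witness[where j = "\<lambda>(F, v). (F - {v}, v)" and i = "\<lambda>(G, v). (insert v G, v)"])
       (auto simp: closed sgn_in_remove insert_absorb)
  also have "\<dots> = (\<Sum>G\<in>\<Gamma>. \<Sum>v\<in>?ins G. sgn_in G v * h G * c (insert v G))"
    using fin simplicial_finite_insertions[OF assms] by (simp add: sum.Sigma)
  also have "\<dots> = pairing \<Gamma> h (boundary \<Gamma> c)"
    by (simp add: pairing_def boundary_eq sum_distrib_left algebra_simps)
  finally show ?thesis .
qed

text \<open>
  Vertices \<open>v\<close> and \<open>w\<close> can be added to \<open>G\<close> in two orders, with opposite signs.  The sum is
  split into \<open>v < w\<close> and \<open>w < v\<close> and the two halves are compared: that a quantity equals its own
  negative would not suffice in characteristic 2.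
\<close>

lemma boundary_boundary:
  fixes c :: "nat set \<Rightarrow> 'k::field"
  assumes simp: "simplicial \<Gamma>"
  shows "boundary \<Gamma> (boundary \<Gamma> c) G = 0"
proof -
  let ?ins = "\<lambda>G. {v. v \<notin> G \<and> insert v G \<in> \<Gamma>}"
  let ?t = "\<lambda>v w. sgn_in G v * (sgn_in (insert v G) w * c (insert w (insert v G)))"
  define S where "S = (SIGMA v:?ins G. ?ins (insert v G))"
  have finS: "finite S"
    unfolding S_def using simplicial_finite_insertions[OF simp] by (intro finite_SigmaI)
  have S_iff: "(v, w) \<in> S \<longleftrightarrow> v \<notin> G \<and> w \<notin> G \<and> v \<noteq> w \<and> insert w (insert v G) \<in> \<Gamma>" for v w
    using simp unfolding S_def simplicial_def by auto (meson subset_insertI)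
  have finG: "finite G" if "(v, w) \<in> S" for v w
    using simp that unfolding S_iff simplicial_def by (metis finite_insert)
  have anti: "?t w v = - ?t v w" if "(v, w) \<in> S" "v < w" for v w
  proof -
    have *: "v \<notin> G" "w \<notin> G" using that S_iff by auto
    show ?thesis
      using that(2) finG[OF that(1)]
      by (simp add: sgn_in_insert * insert_commute algebra_simps)
  qed
  have "boundary \<Gamma> (boundary \<Gamma> c) G = (\<Sum>(v, w)\<in>S. ?t v w)"
    unfolding boundary_eq[of _ _ G] boundary_eq[of _ _ "insert _ G"] sum_distrib_left S_def
    by (rule sum.Sigma) (intro ballI simplicial_finite_insertions[OF simp])+
  also have "S = {x \<in> S. fst x < snd x} \<union> {x \<in> S. snd x < fst x}"
    using S_iff by force
  also have "(\<Sum>(v, w)\<in>\<dots>. ?t v w)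
      = (\<Sum>(v, w)\<in>{x \<in> S. fst x < snd x}. ?t v w) + (\<Sum>(v, w)\<in>{x \<in> S. snd x < fst x}. ?t v w)"
    by (rule sum.union_disjoint) (use finS in auto)
  also have "(\<Sum>(v, w)\<in>{x \<in> S. snd x < fst x}. ?t v w) = (\<Sum>(v, w)\<in>{x \<in> S. fst x < snd x}. ?t w v)"
    by (rule sum.reindex_bij_witness[where i = "\<lambda>(v, w). (w, v)" and j = "\<lambda>(v, w). (w, v)"])
       (auto simp: S_iff insert_commute)
  also have "\<dots> = (\<Sum>(v, w)\<in>{x \<in> S. fst x < snd x}. - ?t v w)"
    using anti by (intro sum.cong refl) (auto simp del: mult_minus_left mult_minus_right)
  finally show ?thesis by (simp add: case_prod_unfold sum_negf)
qed

lemma boundary_linear: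
  fixes c d :: "nat set \<Rightarrow> 'k::field"
  shows "boundary \<Gamma> (c + d) = boundary \<Gamma> c + boundary \<Gamma> d"
    "boundary \<Gamma> (fscale a c) = fscale a (boundary \<Gamma> c)"
  by (simp_all add: fun_eq_iff boundary_eq algebra_simps sum.distrib sum_distrib_left)

lemma linear_boundary: "Vector_Spaces.linear fscale fscale (boundary \<Gamma> :: (nat set \<Rightarrow> 'k::field) \<Rightarrow> _)"
  unfolding Vector_Spaces.linear_iff
  by (simp add: boundary_linear fun_vs.vector_space_axioms)

lemma pairing_supported:
  assumes "finite Y" "X \<subseteq> Y" "f \<in> coord_space X \<or> x \<in> coord_space X"
  shows "pairing X f x = pairing Y f x"
  unfolding pairing_def by (rule sum.mono_neutral_left) (use assms in \<open>auto simp: coord_space_def\<close>)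

text \<open>
  Over a field the boundary map has a linear right inverse \<open>g\<close> on its image.  A chain
  \<open>x\<close> differs from \<open>g (boundary \<Gamma> x)\<close> by a cycle, so a functional that vanishes on cycles factors
  through the boundary map, which says that it is a coboundary.
\<close>

lemma annihilator_of_cycles:
  fixes f :: "nat set \<Rightarrow> 'k::field"
  assumes simp: "simplicial \<Gamma>" and f: "f \<in> coord_space (faces \<Gamma> p)"
    and ann: "\<And>x. x \<in> coord_space (faces \<Gamma> p) \<Longrightarrow> boundary \<Gamma> x = 0 \<Longrightarrow> pairing (faces \<Gamma> p) f x = 0"
  obtains h where "h \<in> coord_space (faces \<Gamma> (p - 1))" "f = coboundary \<Gamma> h"
proof -
  let ?X = "faces \<Gamma> p" and ?Y = "faces \<Gamma> (p - 1)"
  have fin: "finite \<Gamma>" "finite ?X" "finite ?Y" using simp finite_faces by (auto simp: simplicial_def)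
  obtain g :: "(nat set \<Rightarrow> 'k) \<Rightarrow> nat set \<Rightarrow> 'k"
    where g: "g ` UNIV \<subseteq> coord_space ?X" "Vector_Spaces.linear fscale fscale g"
      "\<forall>y\<in>boundary \<Gamma> ` coord_space ?X. boundary \<Gamma> (g y) = y"
    using fun_vs_pair.linear_exists_right_inverse_on[OF linear_boundary subspace_coord_space] by metis
  interpret bd: Vector_Spaces.linear fscale fscale "boundary \<Gamma> :: (nat set \<Rightarrow> 'k) \<Rightarrow> _"
    by (rule linear_boundary)
  interpret g: Vector_Spaces.linear fscale fscale g by (rule g(2))
  define h where "h = (\<lambda>G. if G \<in> ?Y then pairing ?X f (g (unit_fun G)) else 0)"
  have h: "h \<in> coord_space ?Y" by (simp add: h_def coord_space_def)
  have "f F = coboundary \<Gamma> h F" for F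
  proof (cases "F \<in> ?X")
    case False
    then have "f F = 0" "coboundary \<Gamma> h F = 0"
      using f coboundary_faces[OF simp h] unfolding coord_space_def by blast+
    then show ?thesis by simp
  next
    case True
    then have F\<Gamma>: "F \<in> \<Gamma>" using faces_subset by blast
    let ?e = "unit_fun F :: nat set \<Rightarrow> 'k"
    let ?d = "boundary \<Gamma> ?e"
    have e: "?e \<in> coord_space ?X" using True by (rule unit_fun_coord_space)
    have d: "?d \<in> coord_space ?Y" using boundary_faces[OF simp, of ?e "p - 1"] e by simp
    have gd: "g ?d \<in> coord_space ?X" using g(1) by blast
    have "?e - g ?d \<in> coord_space ?X"
      using fun_vs.subspace_diff[OF subspace_coord_space e gd] .
    moreover have "boundary \<Gamma> (?e - g ?d) = 0"
      using g(3) e by (simp add: bd.diff)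
    ultimately have "pairing ?X f (?e - g ?d) = 0" by (rule ann)
    moreover have "pairing ?X f ((?e - g ?d) + g ?d) = pairing ?X f (?e - g ?d) + pairing ?X f (g ?d)"
      by (rule pairing_linear)
    ultimately have "pairing ?X f ?e = pairing ?X f (g ?d)" by simp
    then have "f F = pairing ?X f (g ?d)" using pairing_unit_fun[OF fin(2) True] by metis
    also have "\<dots> = pairing ?X f (\<Sum>G\<in>?Y. fscale (?d G) (g (unit_fun G)))"
      by (subst coord_space_expansion[OF fin(3) d]) (simp add: g.sum g.scale)
    also have "\<dots> = pairing ?Y h ?d"
      unfolding pairing_sum pairing_linear
      by (simp add: pairing_def[of ?Y] h_def mult.commute)
    also have "\<dots> = pairing \<Gamma> h ?d"
      using pairing_supported[OF fin(1) faces_subset] h by blast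
    also have "\<dots> = pairing \<Gamma> (coboundary \<Gamma> h) ?e" by (rule coboundary_adjoint[OF simp, symmetric])
    also have "\<dots> = coboundary \<Gamma> h F" by (rule pairing_unit_fun[OF fin(1) F\<Gamma>])
    finally show ?thesis .
  qed
  then show ?thesis using that h by blast
qed

lemma coboundary_pairing_boundary:
  assumes simp: "simplicial \<Gamma>" and f: "f \<in> coord_space (faces \<Gamma> p)"
  shows "coboundary \<Gamma> f = (\<lambda>F. 0) \<longleftrightarrow>
     (\<forall>b\<in>boundary \<Gamma> ` coord_space (faces \<Gamma> (p + 1)). pairing (faces \<Gamma> p) f b = (0 :: 'k::field))"
proof -
  have fin: "finite \<Gamma>" using simp by (simp add: simplicial_def)
  have eq: "pairing (faces \<Gamma> p) f (boundary \<Gamma> c) = pairing \<Gamma> (coboundary \<Gamma> f) c" for c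
    unfolding coboundary_adjoint[OF simp]
    by (rule pairing_supported[OF fin faces_subset]) (use f in simp)
  have "coboundary \<Gamma> f F = 0" if all: "\<forall>c\<in>coord_space (faces \<Gamma> (p + 1)). pairing \<Gamma> (coboundary \<Gamma> f) c = 0" for F
  proof (cases "F \<in> faces \<Gamma> (p + 1)")
    case True
    then have "pairing \<Gamma> (coboundary \<Gamma> f) (unit_fun F) = 0"
      using bspec[OF all unit_fun_coord_space] by simp
    then show ?thesis using pairing_unit_fun[OF fin] True faces_subset by (metis subsetD)
  next
    case False
    then show ?thesis using coboundary_faces[OF simp, of f "p + 1"] f unfolding coord_space_def by auto
  qed
  then show ?thesis unfolding ball_simps eq by (auto simp: pairing_def fun_eq_iff)
qed

lemma carrier_chains: "carrier (chains \<Gamma> p) = coord_space (faces \<Gamma> p)"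
  by (simp add: chains_def coord_space_def faces_def)

text \<open>
  The \<open>\<zeta> a\<close> are cocycles of dimension \<open>p\<close> whose classes form a basis of the cohomology
  of the family \<open>K\<close>.
\<close>

definition cohomology_basis :: "nat set set \<Rightarrow> int \<Rightarrow> 'a set \<Rightarrow> ('a \<Rightarrow> nat set \<Rightarrow> 'k::field) \<Rightarrow> bool" where
  "cohomology_basis K p A \<zeta> \<longleftrightarrow> finite A
     \<and> (\<forall>a\<in>A. \<zeta> a \<in> coord_space (faces K p) \<and> coboundary K (\<zeta> a) = (\<lambda>F. 0))
     \<and> (\<forall>\<alpha>\<in>coord_space A. \<forall>h\<in>coord_space (faces K (p - 1)).
          (\<lambda>F. \<Sum>a\<in>A. \<alpha> a * \<zeta> a F) = coboundary K h \<longrightarrow> \<alpha> = (\<lambda>a. 0))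
     \<and> (\<forall>f\<in>coord_space (faces K p). coboundary K f = (\<lambda>F. 0) \<longrightarrow>
          (\<exists>\<alpha>\<in>coord_space A. \<exists>h\<in>coord_space (faces K (p - 1)).
             f = (\<lambda>F. coboundary K h F + (\<Sum>a\<in>A. \<alpha> a * \<zeta> a F))))"

lemma cohomology_basisD:
  assumes "cohomology_basis K p A \<zeta>"
  shows "finite A"
    "a \<in> A \<Longrightarrow> \<zeta> a \<in> coord_space (faces K p)"
    "a \<in> A \<Longrightarrow> coboundary K (\<zeta> a) = (\<lambda>F. 0)"
    "\<alpha> \<in> coord_space A \<Longrightarrow> h \<in> coord_space (faces K (p - 1)) \<Longrightarrow>
       (\<lambda>F. \<Sum>a\<in>A. \<alpha> a * \<zeta> a F) = coboundary K h \<Longrightarrow> \<alpha> = (\<lambda>a. 0)"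
    "f \<in> coord_space (faces K p) \<Longrightarrow> coboundary K f = (\<lambda>F. 0) \<Longrightarrow>
       \<exists>\<alpha>\<in>coord_space A. \<exists>h\<in>coord_space (faces K (p - 1)).
             f = (\<lambda>F. coboundary K h F + (\<Sum>a\<in>A. \<alpha> a * \<zeta> a F))"
  using assms unfolding cohomology_basis_def by blast+

text \<open>
  Cocycles are the annihilator of the boundaries and coboundaries the annihilator of the
  cycles, so dual bases for boundaries inside cycles give a basis of homology and one of cohomology with the
  same index set.  The index set consists of the cycles that represent the basis of homology.
\<close>

lemma simplicial_duality:
  assumes simp: "simplicial \<Gamma>"
  shows "\<exists>(A :: (nat set \<Rightarrow> 'k::field) set) (\<zeta> :: (nat set \<Rightarrow> 'k) \<Rightarrow> nat set \<Rightarrow> 'k).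
    has_dim (reduced_homology \<Gamma> p :: ('k, _) module) (card A) \<and> cohomology_basis \<Gamma> p A \<zeta>"
proof -
  let ?X = "faces \<Gamma> p"
  define Z :: "(nat set \<Rightarrow> 'k) set" where "Z = {c \<in> coord_space ?X. boundary \<Gamma> c = 0}"
  define B :: "(nat set \<Rightarrow> 'k) set" where "B = boundary \<Gamma> ` coord_space (faces \<Gamma> (p + 1))"
  have fin: "finite \<Gamma>" "finite ?X" using simp finite_faces by (auto simp: simplicial_def)
  interpret bd: Vector_Spaces.linear fscale fscale "boundary \<Gamma> :: (nat set \<Rightarrow> 'k) \<Rightarrow> _"
    by (rule linear_boundary)
  have sB: "fun_vs.subspace B" unfolding B_def by (rule bd.subspace_image[OF subspace_coord_space])
  have "Z = coord_space ?X \<inter> {c. boundary \<Gamma> c = 0}" by (auto simp: Z_def)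
  then have sZ: "fun_vs.subspace Z"
    using fun_vs.subspace_inter[OF subspace_coord_space bd.subspace_kernel] by simp
  have BZ: "B \<subseteq> Z"
    using boundary_faces[OF simp] boundary_boundary[OF simp] by (auto simp: B_def Z_def fun_eq_iff)
  have ZX: "Z \<subseteq> coord_space ?X" by (auto simp: Z_def)
  obtain A :: "(nat set \<Rightarrow> 'k) set" and \<zeta> where A: "finite A" "A \<subseteq> Z"
    "\<And>a. a \<in> A \<Longrightarrow> \<zeta> a \<in> coord_space ?X"
    and \<zeta>B: "\<And>a b. a \<in> A \<Longrightarrow> b \<in> B \<Longrightarrow> pairing ?X (\<zeta> a) b = 0"
    and \<zeta>A: "\<And>a b. a \<in> A \<Longrightarrow> b \<in> A \<Longrightarrow> pairing ?X (\<zeta> a) b = (if a = b then 1 else 0)"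
    and Z_expand: "\<And>x. x \<in> Z \<Longrightarrow> x - (\<Sum>a\<in>A. fscale (pairing ?X (\<zeta> a) x) a) \<in> B"
    and ann: "\<And>f x. \<forall>b\<in>B. pairing ?X f b = 0 \<Longrightarrow> x \<in> Z
       \<Longrightarrow> pairing ?X (\<lambda>F. f F - (\<Sum>a\<in>A. pairing ?X f a * \<zeta> a F)) x = 0"
  proof (rule dual_bases[OF fin(2) BZ ZX sB sZ], goal_cases)
    case (1 A \<zeta>)
    show ?case by (rule 1(1)[OF 1(2-)])
  qed
  have lin_coeff: "pairing ?X (\<lambda>F. \<Sum>a\<in>A. \<alpha> a * \<zeta> a F) b = \<alpha> b" if "b \<in> A" for \<alpha> b
  proof -
    have "(\<Sum>a\<in>A. \<alpha> a * pairing ?X (\<zeta> a) b) = (\<Sum>a\<in>A. if a = b then \<alpha> a else 0)"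
      by (rule sum.cong) (simp_all add: \<zeta>A that)
    then show ?thesis unfolding pairing_lincomb_left using A(1) that by simp
  qed
  have lin_coeff': "pairing ?X (\<zeta> b) (\<Sum>a\<in>A. fscale (\<alpha> a) a) = \<alpha> b" if "b \<in> A" for \<alpha> b
  proof -
    have "(\<Sum>a\<in>A. \<alpha> a * pairing ?X (\<zeta> b) a) = (\<Sum>a\<in>A. if a = b then \<alpha> a else 0)"
      by (rule sum.cong) (simp_all add: \<zeta>A that)
    then show ?thesis unfolding pairing_sum pairing_linear using A(1) that by simp
  qed
  have lin_Z: "(\<Sum>a\<in>A. fscale (\<alpha> a) a) \<in> Z" for \<alpha>
    using A(2) by (intro fun_vs.subspace_sum[OF sZ] fun_vs.subspace_scale[OF sZ]) auto
  have hd: "has_dim (reduced_homology \<Gamma> p :: ('k, _) module) (card A)"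
  proof (rule has_dim_quotient_by_coordinates[where e = "\<lambda>x. x" and C = "coord_space ?X" and N = B and Z = Z
        and ad = "(+)" and sm = fscale and T = "\<lambda>\<alpha>. \<Sum>a\<in>A. fscale (\<alpha> a) a"])
    show "carrier (reduced_homology \<Gamma> p :: ('k, _) module) = (\<lambda>c. (\<lambda>b. b + c) ` B) ` Z"
      by (auto simp: reduced_homology_def quot_module_def A_RCOSETS_def' a_r_coset_def' carrier_chains
          Z_def B_def zero_fun_def) (auto simp: chains_def plus_fun_def)
    show "\<zero>\<^bsub>reduced_homology \<Gamma> p :: ('k, _) module\<^esub> = B"
      by (simp add: reduced_homology_def quot_module_def carrier_chains B_def)
    show "S \<oplus>\<^bsub>reduced_homology \<Gamma> p :: ('k, _) module\<^esub> Y = (\<Union>x\<in>S. \<Union>y\<in>Y. {x + y})" for S Y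
      by (auto simp: reduced_homology_def quot_module_def set_add_def' chains_def plus_fun_def)
    show "c \<odot>\<^bsub>reduced_homology \<Gamma> p :: ('k, _) module\<^esub> S = (\<Union>x\<in>S. (\<lambda>b. b + fscale c x) ` B)" for c S
      by (auto simp: reduced_homology_def quot_module_def a_r_coset_def' carrier_chains B_def)
         (auto simp: chains_def plus_fun_def fscale_def)
    show "\<alpha> = (\<lambda>a. 0)" if \<alpha>: "\<alpha> \<in> coord_space A" and "(\<Sum>a\<in>A. fscale (\<alpha> a) a) \<in> B" for \<alpha>
    proof
      fix b show "\<alpha> b = 0"
      proof (cases "b \<in> A")
        case True
        then show ?thesis using lin_coeff'[of b \<alpha>] \<zeta>B that(2) by metis
      qed (use \<alpha> in \<open>auto simp: coord_space_def\<close>)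
    qed
    show "\<exists>\<alpha>\<in>coord_space A. \<exists>b\<in>B. z = (\<lambda>t. b t + (\<Sum>a\<in>A. fscale (\<alpha> a) a) t)" if "z \<in> Z" for z
    proof (intro bexI)
      let ?\<alpha> = "\<lambda>a. if a \<in> A then pairing ?X (\<zeta> a) z else 0"
      have "(\<Sum>a\<in>A. fscale (?\<alpha> a) a) = (\<Sum>a\<in>A. fscale (pairing ?X (\<zeta> a) z) a)"
        by (rule sum.cong) auto
      then show "z - (\<Sum>a\<in>A. fscale (?\<alpha> a) a) \<in> B" using Z_expand[OF that] by simp
      show "?\<alpha> \<in> coord_space A" by (simp add: coord_space_def)
      show "z = (\<lambda>t. (z - (\<Sum>a\<in>A. fscale (?\<alpha> a) a)) t + (\<Sum>a\<in>A. fscale (?\<alpha> a) a) t)"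
        by (simp add: fun_eq_iff)
    qed
    show "(\<lambda>t. 0) \<in> (\<lambda>x. x) ` B" using fun_vs.subspace_0[OF sB] by (simp add: zero_fun_def)
    show "x + y \<in> B" if "x \<in> B" "y \<in> B" for x y using fun_vs.subspace_add[OF sB that] .
    show "fscale c x \<in> B" if "x \<in> B" for c x using fun_vs.subspace_scale[OF sB that] .
    show "x + y \<in> coord_space ?X \<and> x + y = (\<lambda>t. x t + y t)"
      if "x \<in> coord_space ?X" "y \<in> coord_space ?X" for x y :: "nat set \<Rightarrow> 'k"
      using fun_vs.subspace_add[OF subspace_coord_space that] by (simp add: plus_fun_def)
    show "fscale c x \<in> coord_space ?X \<and> fscale c x = (\<lambda>t. c * x t)"
      if "x \<in> coord_space ?X" for x :: "nat set \<Rightarrow> 'k" and c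
      using fun_vs.subspace_scale[OF subspace_coord_space that] by (simp add: fscale_def)
    show "B \<subseteq> coord_space ?X" using BZ ZX by blast
  qed (use A ZX lin_Z in \<open>auto simp: sum_fun_apply fun_eq_iff algebra_simps sum.distrib sum_distrib_left\<close>)
  have "cohomology_basis \<Gamma> p A \<zeta>"
    unfolding cohomology_basis_def
  proof (intro conjI ballI impI)
    show "coboundary \<Gamma> (\<zeta> a) = (\<lambda>F. 0)" if "a \<in> A" for a
      using coboundary_pairing_boundary[OF simp A(3)[OF that]] \<zeta>B that unfolding B_def by blast
    show "\<alpha> = (\<lambda>a. 0)" if \<alpha>: "\<alpha> \<in> coord_space A" and eq: "(\<lambda>F. \<Sum>a\<in>A. \<alpha> a * \<zeta> a F) = coboundary \<Gamma> h" for \<alpha> h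
    proof
      fix b show "\<alpha> b = 0"
      proof (cases "b \<in> A")
        case True
        then have b: "b \<in> coord_space ?X" "boundary \<Gamma> b = 0" using A(2) by (auto simp: Z_def)
        have "\<alpha> b = pairing ?X (coboundary \<Gamma> h) b" using lin_coeff[OF True, of \<alpha>] eq by simp
        also have "\<dots> = pairing \<Gamma> (coboundary \<Gamma> h) b"
          by (rule pairing_supported[OF fin(1) faces_subset]) (use b in simp)
        also have "\<dots> = 0" unfolding coboundary_adjoint[OF simp] b(2) by (simp add: pairing_def)
        finally show ?thesis .
      qed (use \<alpha> in \<open>auto simp: coord_space_def\<close>)
    qed
    show "\<exists>\<alpha>\<in>coord_space A. \<exists>h\<in>coord_space (faces \<Gamma> (p - 1)).
         f = (\<lambda>F. coboundary \<Gamma> h F + (\<Sum>a\<in>A. \<alpha> a * \<zeta> a F))"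
      if f: "f \<in> coord_space ?X" and cf: "coboundary \<Gamma> f = (\<lambda>F. 0)" for f
    proof -
      let ?\<alpha> = "\<lambda>a. if a \<in> A then pairing ?X f a else 0"
      let ?g = "\<lambda>F. f F - (\<Sum>a\<in>A. pairing ?X f a * \<zeta> a F)"
      have fB: "\<forall>b\<in>B. pairing ?X f b = 0"
        using coboundary_pairing_boundary[OF simp f] cf unfolding B_def by blast
      have "?g F = 0" if "F \<notin> ?X" for F
      proof -
        have "f F = 0" "\<forall>a\<in>A. \<zeta> a F = 0" using that f A(3) by (auto simp: coord_space_def)
        then show ?thesis by simp
      qed
      then have g: "?g \<in> coord_space ?X" unfolding coord_space_def by blast
      have "pairing ?X ?g x = 0" if "x \<in> coord_space ?X" "boundary \<Gamma> x = 0" for x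
        by (rule ann[OF fB]) (use that in \<open>simp add: Z_def\<close>)
      then obtain h where h: "h \<in> coord_space (faces \<Gamma> (p - 1))" "?g = coboundary \<Gamma> h"
        by (rule annihilator_of_cycles[OF simp g])
      have f_eq: "f = (\<lambda>F. coboundary \<Gamma> h F + (\<Sum>a\<in>A. ?\<alpha> a * \<zeta> a F))"
        unfolding h(2)[symmetric] by (auto simp: fun_eq_iff cong: sum.cong)
      show ?thesis
      proof (intro bexI)
        show "f = (\<lambda>F. coboundary \<Gamma> h F + (\<Sum>a\<in>A. ?\<alpha> a * \<zeta> a F))" by (rule f_eq)
      qed (use h(1) in \<open>simp_all add: coord_space_def\<close>)
    qed
  qed (use A in auto)
  then show ?thesis using hd by blast
qed

section \<open>Cones and shifted complexes\<close>

lemma cohomology_basis_exact: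
  fixes \<zeta> :: "'a \<Rightarrow> nat set \<Rightarrow> 'k::field"
  assumes "\<And>x :: nat set \<Rightarrow> 'k. x \<in> coord_space (faces K p) \<Longrightarrow> coboundary K x = (\<lambda>F. 0)
    \<Longrightarrow> \<exists>h\<in>coord_space (faces K (p - 1)). x = coboundary K h"
  shows "cohomology_basis K p {} \<zeta>"
proof -
  have "(coord_space {} :: ('a \<Rightarrow> 'k) set) = {\<lambda>a. 0}" by (auto simp: coord_space_def)
  then show ?thesis using assms unfolding cohomology_basis_def by simp
qed

text \<open>
  The contracting homotopy adds the apex \<open>v\<close>:
  \<open>h \<sigma> = \<plusminus> x (insert v \<sigma>)\<close> if \<open>v \<notin> \<sigma>\<close>, and \<open>h \<sigma> = 0\<close> otherwise.  On sets that contain \<open>v\<close>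
  the equation \<open>x = coboundary K h\<close> holds by definition; on a set \<open>\<tau>\<close> without \<open>v\<close> it is the cocycle
  condition for \<open>x\<close> at \<open>insert v \<tau>\<close>.
\<close>

lemma coboundary_cone_exact:
  fixes x :: "nat set \<Rightarrow> 'k::field"
  assumes fin: "\<And>\<sigma>. \<sigma> \<in> K \<Longrightarrow> finite \<sigma>" and cone: "\<And>\<sigma>. insert v \<sigma> \<in> K \<longleftrightarrow> \<sigma> \<in> K"
    and x: "x \<in> coord_space (faces K p)" and cocycle: "coboundary K x = (\<lambda>\<sigma>. 0)"
  obtains h where "h \<in> coord_space (faces K (p - 1))" "x = coboundary K h"
proof -
  define h where "h = (\<lambda>\<sigma>. if v \<notin> \<sigma> \<and> \<sigma> \<in> K then sgn_in (insert v \<sigma>) v * x (insert v \<sigma>) else 0)"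
  have h: "h \<in> coord_space (faces K (p - 1))"
    unfolding coord_space_def
  proof (intro CollectI allI impI)
    fix \<sigma> assume *: "h \<sigma> \<noteq> 0"
    then have \<sigma>: "v \<notin> \<sigma>" "\<sigma> \<in> K" "x (insert v \<sigma>) \<noteq> 0" by (auto simp: h_def split: if_splits)
    then have "int (card (insert v \<sigma>)) - 1 = p" using x by (auto simp: coord_space_def faces_def)
    then show "\<sigma> \<in> faces K (p - 1)" using \<sigma> fin[OF \<sigma>(2)] by (simp add: faces_def)
  qed
  have rem: "\<sigma> - {v} \<in> K \<longleftrightarrow> \<sigma> \<in> K" for \<sigma>
    using cone[of "\<sigma> - {v}"] cone[of \<sigma>] by (simp add: insert_Diff_if)
  have "x \<tau> = coboundary K h \<tau>" for \<tau>
  proof (cases "\<tau> \<in> K")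
    case False
    then show ?thesis using x by (auto simp: coboundary_def coord_space_def faces_def)
  next
    case \<tau>: True
    have fin\<tau>: "finite \<tau>" by (rule fin[OF \<tau>])
    show ?thesis
    proof (cases "v \<in> \<tau>")
      case True
      have "(\<Sum>q\<in>\<tau>. sgn_in \<tau> q * h (\<tau> - {q})) = (\<Sum>q\<in>{v}. sgn_in \<tau> q * h (\<tau> - {q}))"
        by (rule sum.mono_neutral_right) (use fin\<tau> True in \<open>auto simp: h_def\<close>)
      also have "\<dots> = sgn_in \<tau> v * (sgn_in \<tau> v * x \<tau>)"
        using True \<tau> rem by (simp add: h_def insert_absorb)
      also have "\<dots> = x \<tau>" by (simp flip: mult.assoc)
      finally show ?thesis using \<tau> by (simp add: coboundary_def)
    next
      case False
      have key: "sgn_in \<tau> q * h (\<tau> - {q}) =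
          - (sgn_in (insert v \<tau>) v * (sgn_in (insert v \<tau>) q * x (insert v \<tau> - {q})))"
        if q: "q \<in> \<tau>" for q
      proof (cases "\<tau> - {q} \<in> K")
        case True
        have qv: "q \<noteq> v" using q False by blast
        have s1: "sgn_in (insert v (\<tau> - {q})) v = (sgn_in (\<tau> - {q}) v :: 'k)"
          using sgn_in_insert[of "\<tau> - {q}" v v] fin\<tau> False by simp
        have s2: "sgn_in (insert v \<tau>) v = (if q < v then - sgn_in (\<tau> - {q}) v else (sgn_in (\<tau> - {q}) v :: 'k))"
        proof -
          have "sgn_in (insert v \<tau>) v = (sgn_in \<tau> v :: 'k)"
            using sgn_in_insert[of \<tau> v v] fin\<tau> False by simp
          also have "\<dots> = sgn_in (insert q (\<tau> - {q})) v" using q by (simp add: insert_absorb)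
          also have "\<dots> = (if q < v then - sgn_in (\<tau> - {q}) v else sgn_in (\<tau> - {q}) v)"
            using fin\<tau> by (intro sgn_in_insert) auto
          finally show ?thesis .
        qed
        have s3: "sgn_in (insert v \<tau>) q = (if v < q then - sgn_in \<tau> q else (sgn_in \<tau> q :: 'k))"
          using sgn_in_insert[of \<tau> v q] fin\<tau> False by simp
        have s4: "insert v \<tau> - {q} = insert v (\<tau> - {q})" using qv by auto
        have s5: "h (\<tau> - {q}) = sgn_in (\<tau> - {q}) v * x (insert v (\<tau> - {q}))"
          using True False unfolding h_def s1 by simp
        have "q < v \<or> v < q" using qv by auto
        then show ?thesis
          unfolding s2 s3 s4 s5 by (elim disjE) (simp_all add: mult.left_commute)
      next
        case no: False
        have "insert v \<tau> - {q} = insert v (\<tau> - {q})" using q False by auto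
        then have "insert v \<tau> - {q} \<notin> K" using no cone by simp
        then have "x (insert v \<tau> - {q}) = 0" using x by (auto simp: coord_space_def faces_def)
        then show ?thesis using no by (simp add: h_def)
      qed
      have "0 = coboundary K x (insert v \<tau>)" by (simp add: cocycle)
      also have "\<dots> = sgn_in (insert v \<tau>) v * x \<tau> + (\<Sum>q\<in>\<tau>. sgn_in (insert v \<tau>) q * x (insert v \<tau> - {q}))"
        using \<tau> cone False fin\<tau> by (simp add: coboundary_def)
      finally have "sgn_in (insert v \<tau>) v * (sgn_in (insert v \<tau>) v * x \<tau>
           + (\<Sum>q\<in>\<tau>. sgn_in (insert v \<tau>) q * x (insert v \<tau> - {q}))) = 0" by simp
      then have "x \<tau> = - (\<Sum>q\<in>\<tau>. sgn_in (insert v \<tau>) v * (sgn_in (insert v \<tau>) q * x (insert v \<tau> - {q})))"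
        unfolding distrib_left sum_distrib_left mult.assoc[symmetric] sgn_in_square
        by (simp add: eq_neg_iff_add_eq_0)
      also have "\<dots> = (\<Sum>q\<in>\<tau>. sgn_in \<tau> q * h (\<tau> - {q}))"
        by (simp add: key sum_negf)
      finally show ?thesis using \<tau> by (simp add: coboundary_def)
    qed
  qed
  then show ?thesis using that h by blast
qed

text \<open>
  The sign of the permutation that sorts the concatenation of \<open>\<tau>\<close> and \<open>N\<close>.
\<close>

definition shuffle_sgn :: "nat set \<Rightarrow> nat set \<Rightarrow> 'k::field" where
  "shuffle_sgn N \<tau> = (\<Prod>q\<in>\<tau>. sgn_in N q)"

lemma shuffle_sgn_square [simp]: "shuffle_sgn N \<tau> * shuffle_sgn N \<tau> = (1 :: 'k::field)"
  by (simp add: shuffle_sgn_def flip: prod.distrib)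

lemma shuffle_sgn_remove:
  assumes "finite \<tau>" "q \<in> \<tau>"
  shows "shuffle_sgn N \<tau> = sgn_in N q * (shuffle_sgn N (\<tau> - {q}) :: 'k::field)"
  unfolding shuffle_sgn_def by (rule prod.remove[OF assms])

text \<open>
  This factorization is why the change of signs by \<open>shuffle_sgn\<close> absorbs the
  difference between the orientations of \<open>\<tau>\<close> and of \<open>N \<union> \<tau>\<close>.
\<close>

lemma sgn_in_disjoint_Un:
  assumes "finite N" "finite \<tau>" "N \<inter> \<tau> = {}"
  shows "sgn_in (N \<union> \<tau>) q = sgn_in N q * (sgn_in \<tau> q :: 'k::field)"
proof -
  have "{u \<in> N \<union> \<tau>. u < q} = {u \<in> N. u < q} \<union> {u \<in> \<tau>. u < q}" by auto
  then have "card {u \<in> N \<union> \<tau>. u < q} = card {u \<in> N. u < q} + card {u \<in> \<tau>. u < q}"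
    using assms by (auto intro!: card_Un_disjoint)
  then show ?thesis by (simp add: sgn_in_def power_add)
qed

definition twist :: "nat set \<Rightarrow> (nat set \<Rightarrow> 'k::field) \<Rightarrow> nat set \<Rightarrow> 'k" where
  "twist N g \<sigma> = (if N \<subseteq> \<sigma> then shuffle_sgn N (\<sigma> - N) * g (\<sigma> - N) else 0)"

definition untwist :: "nat set \<Rightarrow> (nat set \<Rightarrow> 'k::field) \<Rightarrow> nat set \<Rightarrow> 'k" where
  "untwist N x \<tau> = (if N \<inter> \<tau> = {} then shuffle_sgn N \<tau> * x (N \<union> \<tau>) else 0)"

locale shifted_complex =
  fixes \<Gamma> :: "nat set set" and N :: "nat set"
  assumes simp: "simplicial \<Gamma>" and finN: "finite N" and disj: "\<And>\<tau>. \<tau> \<in> \<Gamma> \<Longrightarrow> N \<inter> \<tau> = {}"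
begin

abbreviation "K \<equiv> (\<union>) N ` \<Gamma>"

lemma in_K_iff: "N \<inter> \<tau> = {} \<Longrightarrow> N \<union> \<tau> \<in> K \<longleftrightarrow> \<tau> \<in> \<Gamma>"
proof
  assume d: "N \<inter> \<tau> = {}" and "N \<union> \<tau> \<in> K"
  then obtain \<tau>' where \<tau>': "\<tau>' \<in> \<Gamma>" "N \<union> \<tau> = N \<union> \<tau>'" by blast
  have "\<tau> = N \<union> \<tau> - N" using d by auto
  also have "\<dots> = \<tau>'" using \<tau>'(2) disj[OF \<tau>'(1)] by auto
  finally show "\<tau> \<in> \<Gamma>" using \<tau>'(1) by simp
qed simp

lemma K_faces_iff: "N \<inter> \<tau> = {} \<Longrightarrow> N \<union> \<tau> \<in> faces K p \<longleftrightarrow> \<tau> \<in> faces \<Gamma> (p - int (card N))"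
proof -
  assume d: "N \<inter> \<tau> = {}"
  have "card (N \<union> \<tau>) = card N + card \<tau>" if "\<tau> \<in> \<Gamma>"
    using that simp finN d by (intro card_Un_disjoint) (auto simp: simplicial_def)
  then show ?thesis using in_K_iff[OF d] by (auto simp: faces_def)
qed

lemma K_superset: "\<sigma> \<in> K \<Longrightarrow> N \<subseteq> \<sigma>" by auto

lemma decompose: "N \<subseteq> \<sigma> \<Longrightarrow> N \<union> (\<sigma> - N) = \<sigma>" by auto

text \<open>
  The shift of dimension by \<open>card N\<close> comes from \<open>card (N \<union> \<tau>) = card N + card \<tau>\<close>.
\<close>

lemma twist_supported:
  assumes "g \<in> coord_space (faces \<Gamma> (p - int (card N)))"
  shows "twist N g \<in> coord_space (faces K p)"
  unfolding coord_space_def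
proof (intro CollectI allI impI)
  fix \<sigma> assume "twist N g \<sigma> \<noteq> 0"
  then have "N \<subseteq> \<sigma>" "g (\<sigma> - N) \<noteq> 0" by (auto simp: twist_def split: if_splits)
  moreover from this have "\<sigma> - N \<in> faces \<Gamma> (p - int (card N))" using assms by (auto simp: coord_space_def)
  ultimately show "\<sigma> \<in> faces K p" using K_faces_iff[of "\<sigma> - N" p] decompose by auto
qed

lemma untwist_supported:
  assumes "x \<in> coord_space (faces K p)"
  shows "untwist N x \<in> coord_space (faces \<Gamma> (p - int (card N)))"
  unfolding coord_space_def
proof (intro CollectI allI impI)
  fix \<tau> assume "untwist N x \<tau> \<noteq> 0"
  then have "N \<inter> \<tau> = {}" "x (N \<union> \<tau>) \<noteq> 0" by (auto simp: untwist_def split: if_splits)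
  then show "\<tau> \<in> faces \<Gamma> (p - int (card N))"
    using assms K_faces_iff by (auto simp: coord_space_def)
qed

lemma twist_untwist:
  assumes "x \<in> coord_space (faces K p)"
  shows "twist N (untwist N x) = x"
proof
  fix \<sigma>
  show "twist N (untwist N x) \<sigma> = x \<sigma>"
  proof (cases "N \<subseteq> \<sigma>")
    case True
    then show ?thesis by (simp add: twist_def untwist_def Un_absorb1 flip: mult.assoc)
  next
    case False
    then have "x \<sigma> = 0" using assms K_superset by (auto simp: coord_space_def faces_def)
    then show ?thesis using False by (simp add: twist_def)
  qed
qed

lemma untwist_twist:
  assumes "g \<in> coord_space (faces \<Gamma> p)"
  shows "untwist N (twist N g) = g"
proof
  fix \<tau>
  show "untwist N (twist N g) \<tau> = g \<tau>"
  proof (cases "N \<inter> \<tau> = {}")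
    case True
    then have "N \<union> \<tau> - N = \<tau>" by auto
    then show ?thesis using True by (simp add: twist_def untwist_def flip: mult.assoc)
  next
    case False
    then have "g \<tau> = 0" using assms disj by (auto simp: coord_space_def faces_def)
    then show ?thesis using False by (simp add: untwist_def)
  qed
qed

text \<open>
  Removing an element of \<open>N\<close> from \<open>\<sigma>\<close> leaves a set that does not contain \<open>N\<close>, where twisted
  cochains vanish.  So only the elements of \<open>\<sigma> - N\<close> contribute, as in the coboundary of \<open>\<Gamma>\<close>.
\<close>

lemma coboundary_twist: "coboundary K (twist N g) = twist N (coboundary \<Gamma> g)"
proof
  fix \<sigma>
  show "coboundary K (twist N g) \<sigma> = twist N (coboundary \<Gamma> g) \<sigma>"
  proof (cases "\<sigma> \<in> K")
    case False
    then have "N \<subseteq> \<sigma> \<Longrightarrow> \<sigma> - N \<notin> \<Gamma>" using decompose by (metis imageI)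
    then show ?thesis using False by (auto simp: coboundary_def twist_def)
  next
    case True
    then obtain \<tau> where \<tau>: "\<tau> \<in> \<Gamma>" "\<sigma> = N \<union> \<tau>" by blast
    have d: "N \<inter> \<tau> = {}" by (rule disj[OF \<tau>(1)])
    have fin\<tau>: "finite \<tau>" using simp \<tau>(1) by (simp add: simplicial_def)
    have "(\<Sum>q\<in>\<sigma>. sgn_in \<sigma> q * twist N g (\<sigma> - {q})) = (\<Sum>q\<in>\<tau>. sgn_in \<sigma> q * twist N g (\<sigma> - {q}))"
      by (rule sum.mono_neutral_right) (use \<tau> fin\<tau> finN in \<open>auto simp: twist_def\<close>)
    also have "\<dots> = (\<Sum>q\<in>\<tau>. shuffle_sgn N \<tau> * (sgn_in \<tau> q * g (\<tau> - {q})))"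
    proof (rule sum.cong[OF refl])
      fix q assume q: "q \<in> \<tau>"
      have *: "N \<subseteq> \<sigma> - {q}" "\<sigma> - {q} - N = \<tau> - {q}" using \<tau>(2) d q by auto
      have "sgn_in \<sigma> q * twist N g (\<sigma> - {q}) = sgn_in N q * sgn_in \<tau> q * (shuffle_sgn N (\<tau> - {q}) * g (\<tau> - {q}))"
        unfolding \<tau>(2) sgn_in_disjoint_Un[OF finN fin\<tau> d] twist_def
        using * \<tau>(2) by simp
      then show "sgn_in \<sigma> q * twist N g (\<sigma> - {q}) = shuffle_sgn N \<tau> * (sgn_in \<tau> q * g (\<tau> - {q}))"
        unfolding shuffle_sgn_remove[OF fin\<tau> q, of N] by (simp add: algebra_simps)
    qed
    also have "\<dots> = twist N (coboundary \<Gamma> g) \<sigma>"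
    proof -
      have "\<sigma> - N = \<tau>" "N \<subseteq> \<sigma>" using \<tau>(2) d by auto
      then show ?thesis using \<tau>(1) by (simp add: twist_def coboundary_def sum_distrib_left)
    qed
    finally show ?thesis using True by (simp add: coboundary_def)
  qed
qed

lemma twist_lincomb: "twist N (\<lambda>F. \<Sum>a\<in>A. \<alpha> a * \<zeta> a F) = (\<lambda>\<sigma>. \<Sum>a\<in>A. \<alpha> a * twist N (\<zeta> a) \<sigma>)"
  by (auto simp: twist_def fun_eq_iff sum_distrib_left mult.left_commute)

lemma twist_add: "twist N (\<lambda>F. f F + g F) = (\<lambda>\<sigma>. twist N f \<sigma> + twist N g \<sigma>)"
  by (auto simp: twist_def fun_eq_iff algebra_simps)

text \<open>
  A basis of the cohomology of \<open>\<Gamma>\<close> is carried to one of \<open>K\<close> by the isomorphism \<open>twist N\<close> of cochain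
  complexes.
\<close>

lemma shifted_duality:
  "\<exists>(A :: (nat set \<Rightarrow> 'k::field) set) (\<zeta> :: (nat set \<Rightarrow> 'k) \<Rightarrow> nat set \<Rightarrow> 'k).
    has_dim (reduced_homology \<Gamma> (p - int (card N)) :: ('k, _) module) (card A) \<and> cohomology_basis K p A \<zeta>"
proof -
  let ?p = "p - int (card N)"
  obtain A :: "(nat set \<Rightarrow> 'k) set" and \<zeta> :: "(nat set \<Rightarrow> 'k) \<Rightarrow> nat set \<Rightarrow> 'k"
    where dim: "has_dim (reduced_homology \<Gamma> ?p :: ('k, _) module) (card A)"
      and basis: "cohomology_basis \<Gamma> ?p A \<zeta>"
    using simplicial_duality[OF simp] by metis
  note A = cohomology_basisD[OF basis]
  have p1: "?p - 1 = p - 1 - int (card N)" by simp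
  have lin_supp: "(\<lambda>F. \<Sum>a\<in>A. \<alpha> a * \<zeta> a F) \<in> coord_space (faces \<Gamma> ?p)" for \<alpha>
    unfolding coord_space_def
  proof (intro CollectI allI impI)
    fix F assume *: "(\<Sum>a\<in>A. \<alpha> a * \<zeta> a F) \<noteq> 0"
    then obtain a where "a \<in> A" "\<zeta> a F \<noteq> 0" by (metis (mono_tags, lifting) mult_zero_right sum.neutral)
    then show "F \<in> faces \<Gamma> ?p" using A(2) by (auto simp: coord_space_def)
  qed
  have "cohomology_basis K p A (\<lambda>a. twist N (\<zeta> a))"
    unfolding cohomology_basis_def
  proof (intro conjI ballI impI)
    show "twist N (\<zeta> a) \<in> coord_space (faces K p)" if "a \<in> A" for a
      by (rule twist_supported[OF A(2)[OF that]])
    show "coboundary K (twist N (\<zeta> a)) = (\<lambda>F. 0)" if "a \<in> A" for a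
      unfolding coboundary_twist A(3)[OF that] by (auto simp: twist_def)
    show "\<alpha> = (\<lambda>a. 0)" if \<alpha>: "\<alpha> \<in> coord_space A" and h: "h \<in> coord_space (faces K (p - 1))"
      and eq: "(\<lambda>F. \<Sum>a\<in>A. \<alpha> a * twist N (\<zeta> a) F) = coboundary K h" for \<alpha> h
    proof (rule A(4)[OF \<alpha>])
      let ?h = "untwist N h"
      show "?h \<in> coord_space (faces \<Gamma> (?p - 1))" unfolding p1 by (rule untwist_supported[OF h])
      have "twist N (\<lambda>F. \<Sum>a\<in>A. \<alpha> a * \<zeta> a F) = twist N (coboundary \<Gamma> ?h)"
        using eq unfolding twist_lincomb coboundary_twist[symmetric] twist_untwist[OF h] .
      then have "untwist N (twist N (\<lambda>F. \<Sum>a\<in>A. \<alpha> a * \<zeta> a F)) = untwist N (twist N (coboundary \<Gamma> ?h))"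
        by simp
      moreover have "coboundary \<Gamma> ?h \<in> coord_space (faces \<Gamma> ?p)"
        using coboundary_faces[OF simp, of ?h ?p] untwist_supported[OF h] p1 by simp
      ultimately show "(\<lambda>F. \<Sum>a\<in>A. \<alpha> a * \<zeta> a F) = coboundary \<Gamma> ?h"
        unfolding untwist_twist[OF lin_supp] by (simp add: untwist_twist)
    qed
    show "\<exists>\<alpha>\<in>coord_space A. \<exists>h\<in>coord_space (faces K (p - 1)).
         f = (\<lambda>F. coboundary K h F + (\<Sum>a\<in>A. \<alpha> a * twist N (\<zeta> a) F))"
      if f: "f \<in> coord_space (faces K p)" and cf: "coboundary K f = (\<lambda>F. 0)" for f
    proof -
      let ?f = "untwist N f"
      have ff: "?f \<in> coord_space (faces \<Gamma> ?p)" by (rule untwist_supported[OF f])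
      have "twist N (coboundary \<Gamma> ?f) = (\<lambda>F. 0)"
        unfolding coboundary_twist[symmetric] twist_untwist[OF f] by (rule cf)
      then have "untwist N (twist N (coboundary \<Gamma> ?f)) = (\<lambda>F. 0)" by (auto simp: untwist_def)
      moreover have "coboundary \<Gamma> ?f \<in> coord_space (faces \<Gamma> (?p + 1))"
        using coboundary_faces[OF simp, of ?f "?p + 1"] ff by simp
      ultimately have "coboundary \<Gamma> ?f = (\<lambda>F. 0)" by (simp add: untwist_twist)
      then obtain \<alpha> h where \<alpha>: "\<alpha> \<in> coord_space A" and h: "h \<in> coord_space (faces \<Gamma> (?p - 1))"
        and eq: "?f = (\<lambda>F. coboundary \<Gamma> h F + (\<Sum>a\<in>A. \<alpha> a * \<zeta> a F))"
        using A(5)[OF ff] by blast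
      have "f = twist N (\<lambda>F. coboundary \<Gamma> h F + (\<Sum>a\<in>A. \<alpha> a * \<zeta> a F))"
        unfolding eq[symmetric] twist_untwist[OF f] ..
      also have "\<dots> = (\<lambda>F. coboundary K (twist N h) F + (\<Sum>a\<in>A. \<alpha> a * twist N (\<zeta> a) F))"
        unfolding twist_add twist_lincomb coboundary_twist ..
      finally have f_eq: "f = (\<lambda>F. coboundary K (twist N h) F + (\<Sum>a\<in>A. \<alpha> a * twist N (\<zeta> a) F))" .
      show ?thesis
      proof (intro bexI)
        show "f = (\<lambda>F. coboundary K (twist N h) F + (\<Sum>a\<in>A. \<alpha> a * twist N (\<zeta> a) F))" by (rule f_eq)
        show "twist N h \<in> coord_space (faces K (p - 1))"
          using twist_supported[of h "p - 1"] h p1 by simp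
      qed (rule \<alpha>)
    qed
  qed (rule A(1))
  then show ?thesis using dim by blast
qed

end

section \<open>Cochains graded by a set of degrees\<close>

text \<open>
  A family of cochains, one on each \<open>K e\<close>, as an element of a direct sum: each value at \<open>\<sigma>\<close>
  involves finitely many degrees.
\<close>

definition graded_cochains :: "('e \<Rightarrow> nat set set) \<Rightarrow> int \<Rightarrow> (nat set \<Rightarrow> 'e \<Rightarrow> 'k::field) set" where
  "graded_cochains K p = {g. (\<forall>\<sigma> e. g \<sigma> e \<noteq> 0 \<longrightarrow> \<sigma> \<in> faces (K e) p) \<and> (\<forall>\<sigma>. finite {e. g \<sigma> e \<noteq> 0})}"

definition graded_coboundary :: "('e \<Rightarrow> nat set set) \<Rightarrow> (nat set \<Rightarrow> 'e \<Rightarrow> 'k::field) \<Rightarrow> nat set \<Rightarrow> 'e \<Rightarrow> 'k" where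
  "graded_coboundary K g = (\<lambda>\<sigma> e. coboundary (K e) (\<lambda>\<sigma>. g \<sigma> e) \<sigma>)"

lemma coboundary_zero: "coboundary K (\<lambda>F. 0) = (\<lambda>F. 0)"
  by (simp add: coboundary_def fun_eq_iff)

lemma graded_cochains_component:
  "g \<in> graded_cochains K p \<Longrightarrow> (\<lambda>\<sigma>. g \<sigma> e) \<in> coord_space (faces (K e) p)"
  by (auto simp: graded_cochains_def coord_space_def)

definition graded_combination ::
    "'e set \<Rightarrow> ('e \<Rightarrow> 'a set) \<Rightarrow> ('e \<Rightarrow> 'a \<Rightarrow> nat set \<Rightarrow> 'k::field) \<Rightarrow> ('e \<times> 'a \<Rightarrow> 'k) \<Rightarrow> nat set \<Rightarrow> 'e \<Rightarrow> 'k" where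
  "graded_combination D A \<zeta> \<alpha> = (\<lambda>\<sigma> e. if e \<in> D then \<Sum>a\<in>A e. \<alpha> (e, a) * \<zeta> e a \<sigma> else 0)"

context
  fixes K :: "'e \<Rightarrow> nat set set" and W :: "nat set" and D H :: "'e set" and p :: int
    and A :: "'e \<Rightarrow> 'a set" and \<zeta> :: "'e \<Rightarrow> 'a \<Rightarrow> nat set \<Rightarrow> 'k::field"
  assumes finW: "finite W" and KW: "\<And>e. K e \<subseteq> Pow W" and finD: "finite D" and DH: "D \<subseteq> H"
    and basis: "\<And>e. e \<in> H \<Longrightarrow> cohomology_basis (K e) p (A e) (\<zeta> e)"
    and exact: "\<And>e. e \<in> H - D \<Longrightarrow> A e = {}"
begin

lemma combination_supported:
  assumes "e \<in> D"
  shows "(\<lambda>\<sigma>. \<Sum>a\<in>A e. \<alpha> (e, a) * \<zeta> e a \<sigma>) \<in> coord_space (faces (K e) p)"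
  unfolding coord_space_def
proof (intro CollectI allI impI)
  fix F assume "(\<Sum>a\<in>A e. \<alpha> (e, a) * \<zeta> e a F) \<noteq> 0"
  then obtain a where "a \<in> A e" "\<zeta> e a F \<noteq> 0" by (metis (mono_tags, lifting) mult_zero_right sum.neutral)
  then show "F \<in> faces (K e) p"
    using cohomology_basisD(2)[OF basis, of e a] assms DH by (auto simp: coord_space_def)
qed

lemma graded_combination_cochain: "graded_combination D A \<zeta> \<alpha> \<in> graded_cochains K p"
  unfolding graded_cochains_def
proof (intro CollectI conjI allI impI)
  fix \<sigma> e assume "graded_combination D A \<zeta> \<alpha> \<sigma> e \<noteq> 0"
  then show "\<sigma> \<in> faces (K e) p"
    using combination_supported[of e \<alpha>] by (auto simp: graded_combination_def coord_space_def split: if_splits)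
next
  show "finite {e. graded_combination D A \<zeta> \<alpha> \<sigma> e \<noteq> 0}" for \<sigma>
    by (rule finite_subset[OF _ finD]) (auto simp: graded_combination_def split: if_splits)
qed

lemma graded_combination_cocycle: "graded_coboundary K (graded_combination D A \<zeta> \<alpha>) = (\<lambda>\<sigma> e. 0)"
proof (intro ext)
  fix \<sigma> e
  show "graded_coboundary K (graded_combination D A \<zeta> \<alpha>) \<sigma> e = 0"
  proof (cases "e \<in> D \<and> \<sigma> \<in> K e")
    case True
    have cz: "(\<Sum>q\<in>\<sigma>. sgn_in \<sigma> q * \<zeta> e a (\<sigma> - {q})) = 0" if "a \<in> A e" for a
      using cohomology_basisD(3)[OF basis, of e a] True DH that
      by (auto simp: coboundary_def fun_eq_iff split: if_splits)
    have "graded_coboundary K (graded_combination D A \<zeta> \<alpha>) \<sigma> e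
        = (\<Sum>q\<in>\<sigma>. sgn_in \<sigma> q * (\<Sum>a\<in>A e. \<alpha> (e, a) * \<zeta> e a (\<sigma> - {q})))"
      using True by (simp add: graded_coboundary_def graded_combination_def coboundary_def)
    also have "\<dots> = (\<Sum>a\<in>A e. \<alpha> (e, a) * (\<Sum>q\<in>\<sigma>. sgn_in \<sigma> q * \<zeta> e a (\<sigma> - {q})))"
      unfolding sum_distrib_left by (subst sum.swap) (simp add: mult.left_commute)
    finally show ?thesis using cz by simp
  qed (auto simp: graded_coboundary_def graded_combination_def coboundary_def)
qed

lemma graded_combination_independent:
  assumes \<alpha>: "\<alpha> \<in> coord_space (Sigma D A)" and h: "h \<in> graded_cochains K (p - 1)"
    and eq: "graded_combination D A \<zeta> \<alpha> = graded_coboundary K h"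
  shows "\<alpha> = (\<lambda>x. 0)"
proof (intro ext)
  fix x show "\<alpha> x = 0"
  proof (cases "x \<in> Sigma D A")
    case True
    then obtain e a where x: "x = (e, a)" "e \<in> D" "a \<in> A e" by blast
    have "(\<lambda>a. if a \<in> A e then \<alpha> (e, a) else 0) = (\<lambda>a. 0)"
    proof (rule cohomology_basisD(4)[OF basis])
      show "e \<in> H" using x(2) DH by blast
      show "(\<lambda>\<sigma>. h \<sigma> e) \<in> coord_space (faces (K e) (p - 1))" by (rule graded_cochains_component[OF h])
      show "(\<lambda>F. \<Sum>a\<in>A e. (if a \<in> A e then \<alpha> (e, a) else 0) * \<zeta> e a F) = coboundary (K e) (\<lambda>\<sigma>. h \<sigma> e)"
      proof
        fix F
        have "(\<Sum>a\<in>A e. (if a \<in> A e then \<alpha> (e, a) else 0) * \<zeta> e a F) = graded_combination D A \<zeta> \<alpha> F e"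
          using x(2) by (simp add: graded_combination_def)
        then show "(\<Sum>a\<in>A e. (if a \<in> A e then \<alpha> (e, a) else 0) * \<zeta> e a F) = coboundary (K e) (\<lambda>\<sigma>. h \<sigma> e) F"
          unfolding eq by (simp add: graded_coboundary_def)
      qed
    qed (simp add: coord_space_def)
    from fun_cong[OF this, of a] show ?thesis using x by simp
  next
    case False
    then show ?thesis using \<alpha> unfolding coord_space_def by blast
  qed
qed

text \<open>
  In each degree the component of \<open>g\<close> is a coboundary plus a combination of the basis.
  In the degrees where \<open>g\<close> vanishes the coboundary and the combination are chosen to be 0; since \<open>W\<close> is finite,
  only finitely many degrees remain, and the pieces fit together to an element of the direct sum.
\<close>

lemma graded_combination_spanning:
  assumes g: "g \<in> graded_cochains K p" and cocycle: "graded_coboundary K g = (\<lambda>\<sigma> e. 0)"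
    and hom: "\<And>\<sigma> e. g \<sigma> e \<noteq> 0 \<Longrightarrow> e \<in> H"
  obtains \<alpha> h where "\<alpha> \<in> coord_space (Sigma D A)" "h \<in> graded_cochains K (p - 1)"
    "g = (\<lambda>\<sigma> e. graded_coboundary K h \<sigma> e + graded_combination D A \<zeta> \<alpha> \<sigma> e)"
proof -
  define E where "E = {e. \<exists>\<sigma>. g \<sigma> e \<noteq> 0}"
  have "E = (\<Union>\<sigma>\<in>Pow W. {e. g \<sigma> e \<noteq> 0})"
  proof -
    have "\<sigma> \<in> Pow W" if "g \<sigma> e \<noteq> 0" for \<sigma> e
      using that g KW[of e] unfolding graded_cochains_def faces_def by blast
    then show ?thesis unfolding E_def by blast
  qed
  then have finE: "finite E" using g finW by (simp add: graded_cochains_def)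
  define R where "R = (\<lambda>e \<alpha> h. \<alpha> \<in> coord_space (A e) \<and> h \<in> coord_space (faces (K e) (p - 1)) \<and>
     (\<lambda>\<sigma>. g \<sigma> e) = (\<lambda>\<sigma>. coboundary (K e) h \<sigma> + (\<Sum>a\<in>A e. \<alpha> a * \<zeta> e a \<sigma>)))"
  have "\<exists>\<alpha> h. R e \<alpha> h" if e: "e \<in> E" for e
  proof -
    have cz: "coboundary (K e) (\<lambda>\<sigma>. g \<sigma> e) = (\<lambda>\<sigma>. 0)"
      using cocycle by (simp add: graded_coboundary_def fun_eq_iff)
    have "e \<in> H" using e hom unfolding E_def by blast
    from cohomology_basisD(5)[OF basis[OF this] graded_cochains_component[OF g] cz]
    show ?thesis unfolding R_def by (elim bexE) (intro exI conjI)
  qed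
  then obtain \<alpha> h where R: "\<And>e. e \<in> E \<Longrightarrow> R e (\<alpha> e) (h e)" by metis
  have \<alpha>: "\<And>e. e \<in> E \<Longrightarrow> \<alpha> e \<in> coord_space (A e)"
    and h: "\<And>e. e \<in> E \<Longrightarrow> h e \<in> coord_space (faces (K e) (p - 1))"
    and eq: "\<And>e. e \<in> E \<Longrightarrow> (\<lambda>\<sigma>. g \<sigma> e) = (\<lambda>\<sigma>. coboundary (K e) (h e) \<sigma> + (\<Sum>a\<in>A e. \<alpha> e a * \<zeta> e a \<sigma>))"
    using R unfolding R_def by simp_all
  \<comment> \<open>outside of \<open>E\<close>, where \<open>g\<close> vanishes, both parts are set to 0\<close>
  define \<alpha>' where "\<alpha>' = (\<lambda>(e, a). if e \<in> E \<and> e \<in> D then \<alpha> e a else 0)"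
  define h' where "h' = (\<lambda>\<sigma> e. if e \<in> E then h e \<sigma> else 0)"
  show ?thesis
  proof (rule that)
    show "\<alpha>' \<in> coord_space (Sigma D A)"
      using \<alpha> unfolding \<alpha>'_def coord_space_def by (auto split: if_splits)
    show "h' \<in> graded_cochains K (p - 1)"
      unfolding graded_cochains_def
    proof (intro CollectI conjI allI impI)
      show "\<sigma> \<in> faces (K e) (p - 1)" if "h' \<sigma> e \<noteq> 0" for \<sigma> e
        using that h unfolding h'_def coord_space_def by (auto split: if_splits)
      show "finite {e. h' \<sigma> e \<noteq> 0}" for \<sigma>
        by (rule finite_subset[OF _ finE]) (auto simp: h'_def)
    qed
    show "g = (\<lambda>\<sigma> e. graded_coboundary K h' \<sigma> e + graded_combination D A \<zeta> \<alpha>' \<sigma> e)"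
    proof (intro ext)
      fix \<sigma> e
      show "g \<sigma> e = graded_coboundary K h' \<sigma> e + graded_combination D A \<zeta> \<alpha>' \<sigma> e"
      proof (cases "e \<in> E")
        case True
        then have eH: "e \<in> H" using hom unfolding E_def by blast
        \<comment> \<open>for \<open>e \<in> H - D\<close> the sum is empty, as \<open>A e = {}\<close>\<close>
        have "graded_combination D A \<zeta> \<alpha>' \<sigma> e = (\<Sum>a\<in>A e. \<alpha> e a * \<zeta> e a \<sigma>)"
          using exact[of e] True eH by (auto simp: graded_combination_def \<alpha>'_def)
        moreover have "graded_coboundary K h' \<sigma> e = coboundary (K e) (h e) \<sigma>"
          using True by (simp add: graded_coboundary_def h'_def)
        ultimately show ?thesis using fun_cong[OF eq[OF True], of \<sigma>] by simp
      next
        case False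
        then have "g \<sigma> e = 0" by (auto simp: E_def)
        moreover have "graded_coboundary K h' \<sigma> e = 0"
          using False by (simp add: graded_coboundary_def h'_def coboundary_zero)
        ultimately show ?thesis using False by (simp add: graded_combination_def \<alpha>'_def)
      qed
    qed
  qed
qed

end

section \<open>Multidegrees and their contributions\<close>

abbreviation (input) keys :: "('a \<Rightarrow>\<^sub>0 'b::zero) \<Rightarrow> 'a set" where "keys \<equiv> Poly_Mapping.keys"
abbreviation (input) single :: "'a \<Rightarrow> 'b \<Rightarrow> ('a \<Rightarrow>\<^sub>0 'b::zero)" where "single \<equiv> Poly_Mapping.single"
abbreviation (input) lookup :: "('a \<Rightarrow>\<^sub>0 'b::zero) \<Rightarrow> 'a \<Rightarrow> 'b" where "lookup \<equiv> Poly_Mapping.lookup"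

definition compositions :: "nat set \<Rightarrow> int \<Rightarrow> (nat \<Rightarrow> int) set" where
  "compositions S k = {f. (\<forall>v\<in>S. 0 < f v) \<and> (\<forall>v. v \<notin> S \<longrightarrow> f v = 0) \<and> sum f S = k}"

text \<open>
  The term for \<open>x = k\<close> vanishes by the convention for binomial coefficients with upper
  entry \<open>- 1\<close>; the others form a column sum in Pascal's triangle.
\<close>

lemma sum_binom_hockey_stick:
  assumes "1 \<le> s"
  shows "(\<Sum>x\<in>{1..k}. binom (k - x - 1) (int s - 1)) = binom (k - 1) (int s)"
proof (cases "k \<le> 1")
  case True
  then have "k = 1 \<or> {1..k} = {}" by auto
  then show ?thesis using assms True by (auto simp: binom_def)
next
  case False
  obtain r where s: "s = Suc r" using assms by (cases s) auto
  define N where "N = nat (k - 2)"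
  have k: "k = int N + 2" using False by (simp add: N_def)
  have "(\<Sum>x\<in>{1..k}. binom (k - x - 1) (int s - 1)) = (\<Sum>x\<in>{1..k - 1}. binom (k - x - 1) (int s - 1))"
    by (rule sum.mono_neutral_right) (auto simp: s binom_def)
  also have "\<dots> = (\<Sum>y\<in>{..N}. binom (int y) (int r))"
    by (rule sum.reindex_bij_witness[where i = "\<lambda>y. k - 1 - int y" and j = "\<lambda>x. nat (k - x - 1)"])
       (auto simp: k s)
  also have "\<dots> = (\<Sum>y\<in>{..N}. y choose r)"
    by (rule sum.cong) (auto simp: binom_def)
  also have "\<dots> = Suc N choose Suc r" by (rule sum_choose_upper)
  also have "\<dots> = binom (k - 1) (int s)"
    unfolding s k binom_def by (auto simp: nat_add_distrib)
  finally show ?thesis .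
qed

text \<open>
  By induction: the value \<open>x\<close> at a new element \<open>a\<close> leaves a composition of \<open>k - x\<close>.  When
  \<open>a\<close> is the first element, only \<open>x = k\<close> is possible; this is where the convention
  \<open>binom (- 1) (- 1) = 1\<close> is needed.
\<close>

lemma card_compositions:
  assumes "finite S"
  shows "finite (compositions S k) \<and> card (compositions S k) = binom (k - 1) (int (card S) - 1)"
  using assms
proof (induction S arbitrary: k rule: finite_induct)
  case empty
  have "compositions {} k = (if k = 0 then {\<lambda>v. 0} else {})" by (auto simp: compositions_def)
  then show ?case by (auto simp: binom_def)
next
  case (insert a S)
  let ?ext = "\<lambda>(x, f :: nat \<Rightarrow> int). f(a := x)"
  have sum_upd: "sum (f(a := x)) S = sum f S" for f :: "nat \<Rightarrow> int" and x
    using insert.hyps by (intro sum.cong) auto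
  have eq: "compositions (insert a S) k = ?ext ` (SIGMA x:{1..k}. compositions S (k - x))"
  proof (intro equalityI subsetI)
    fix f assume f: "f \<in> compositions (insert a S) k"
    have "0 \<le> sum f S" using f by (intro sum_nonneg) (auto simp: compositions_def less_imp_le)
    then have "f a \<in> {1..k}" using f insert.hyps by (auto simp: compositions_def)
    moreover have "f(a := 0) \<in> compositions S (k - f a)"
      using f insert.hyps sum_upd[of f 0] by (auto simp: compositions_def)
    moreover have "f = ?ext (f a, f(a := 0))" by auto
    ultimately show "f \<in> ?ext ` (SIGMA x:{1..k}. compositions S (k - x))" by blast
  next
    fix g assume "g \<in> ?ext ` (SIGMA x:{1..k}. compositions S (k - x))"
    then obtain x f where "x \<in> {1..k}" "f \<in> compositions S (k - x)" "g = f(a := x)" by auto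
    then show "g \<in> compositions (insert a S) k"
      using insert.hyps sum_upd[of f x] by (auto simp: compositions_def)
  qed
  have inj: "inj_on ?ext (SIGMA x:{1..k}. compositions S (k - x))"
  proof (rule inj_onI, clarify)
    fix x f y g assume "f \<in> compositions S (k - x)" "g \<in> compositions S (k - y)" and eq: "f(a := x) = g(a := y)"
    then have "f a = g a" using insert.hyps by (auto simp: compositions_def)
    moreover have "f v = g v" if "v \<noteq> a" for v using fun_cong[OF eq, of v] that by simp
    ultimately have "f = g" by (metis ext)
    moreover have "x = y" using fun_cong[OF eq, of a] by simp
    ultimately show "x = y \<and> f = g" by blast
  qed
  have "card (compositions (insert a S) k) = (\<Sum>x\<in>{1..k}. card (compositions S (k - x)))"
    unfolding eq card_image[OF inj] using insert.IH by (intro card_SigmaI) auto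
  also have "\<dots> = (\<Sum>x\<in>{1..k}. binom (k - x - 1) (int (card S) - 1))" using insert.IH by simp
  also have "\<dots> = binom (k - 1) (int (card S))"
  proof (cases "S = {}")
    case True
    have "(\<Sum>x\<in>{1..k}. binom (k - x - 1) (- 1)) = (\<Sum>x\<in>{1..k}. if x = k then 1 else 0)"
      by (rule sum.cong) (auto simp: binom_def)
    also have "\<dots> = binom (k - 1) 0" by (auto simp: binom_def)
    finally show ?thesis using True by simp
  next
    case False
    then have "1 \<le> card S" using insert.hyps by (simp add: Suc_leI card_gt_0_iff)
    then show ?thesis by (rule sum_binom_hockey_stick)
  qed
  finally show ?case using insert by (auto simp: eq)
qed

definition neg_support :: "(nat \<Rightarrow>\<^sub>0 int) \<Rightarrow> nat set" where
  "neg_support e = {v. lookup e v < 0}"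

text \<open>
  The sets \<open>\<sigma>\<close> for which the localization of the Stanley--Reisner ring at the product of
  the variables in \<open>\<sigma>\<close> has a nonzero component of multidegree \<open>e\<close>.
\<close>

definition degree_complex :: "nat set set \<Rightarrow> nat set \<Rightarrow> (nat \<Rightarrow>\<^sub>0 int) \<Rightarrow> nat set set" where
  "degree_complex \<Delta> W e = {\<sigma>. \<sigma> \<subseteq> W \<and> keys e \<union> \<sigma> \<in> \<Delta> \<and> neg_support e \<subseteq> \<sigma>}"

definition bidegrees :: "nat set \<Rightarrow> nat set \<Rightarrow> int \<Rightarrow> int \<Rightarrow> (nat \<Rightarrow>\<^sub>0 int) set" where
  "bidegrees V W k j = {e. sum (lookup e) V = k \<and> sum (lookup e) W = j}"

text \<open>
  The condition \<open>neg_support e \<in> \<Delta>\<close> excludes only multidegrees with empty \<open>degree_complex\<close>.  It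
  makes the negative supports range over exactly the faces of \<open>\<Delta>\<close> inside \<open>W\<close>.
\<close>

definition contributing_degrees :: "nat set set \<Rightarrow> nat set \<Rightarrow> nat set \<Rightarrow> int \<Rightarrow> int \<Rightarrow> (nat \<Rightarrow>\<^sub>0 int) set" where
  "contributing_degrees \<Delta> V W k j =
     {e \<in> bidegrees V W k j. keys e \<subseteq> V \<union> W \<and> (\<forall>v\<in>V. 0 \<le> lookup e v)
        \<and> (\<forall>v\<in>W. lookup e v \<le> 0) \<and> neg_support e \<in> \<Delta>}"

locale two_part_complex =
  fixes \<Delta> :: "nat set set" and V W :: "nat set"
  assumes finV: "finite V" and finW: "finite W" and VW: "V \<inter> W = {}"
    and \<Delta>_sub: "\<Delta> \<subseteq> Pow (V \<union> W)" and \<Delta>_closed: "\<And>F G. F \<in> \<Delta> \<Longrightarrow> G \<subseteq> F \<Longrightarrow> G \<in> \<Delta>"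
begin

lemma simplicial_induced_link: "simplicial (induced (link \<Delta> F) W)"
proof -
  have sub: "induced (link \<Delta> F) W \<subseteq> Pow W" by (auto simp: induced_def)
  have "G' \<in> induced (link \<Delta> F) W" if "G \<in> induced (link \<Delta> F) W" "G' \<subseteq> G" for G G'
    using that \<Delta>_closed[of "F \<union> G" "F \<union> G'"] by (auto simp: induced_def link_def)
  then show ?thesis
    using sub finW finite_subset unfolding simplicial_def by (meson PowD finite_Pow_iff subset_iff)
qed

lemma contributing_degree_supports:
  assumes "e \<in> contributing_degrees \<Delta> V W k j"
  shows "neg_support e \<subseteq> W" "keys e = neg_support e \<union> (keys e \<inter> V)"
proof -
  show *: "neg_support e \<subseteq> W"
  proof
    fix v assume v: "v \<in> neg_support e"
    then have "v \<in> keys e" by (auto simp: neg_support_def in_keys_iff)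
    then show "v \<in> W" using assms v by (force simp: contributing_degrees_def neg_support_def)
  qed
  show "keys e = neg_support e \<union> (keys e \<inter> V)"
  proof (intro equalityI subsetI)
    fix v assume v: "v \<in> keys e"
    show "v \<in> neg_support e \<union> (keys e \<inter> V)"
    proof (cases "v \<in> V")
      case False
      then have "v \<in> W" using v assms by (auto simp: contributing_degrees_def)
      then have "lookup e v \<le> 0" using assms by (auto simp: contributing_degrees_def)
      then show ?thesis using v by (auto simp: neg_support_def in_keys_iff)
    qed (use v in auto)
  qed (auto simp: neg_support_def in_keys_iff)
qed

text \<open>
  Adding \<open>\<tau>\<close> to \<open>keys e\<close> or to \<open>neg_support e \<union> (keys e \<inter> V)\<close> is the same, and
  disjointness from \<open>keys e \<inter> V\<close> is automatic for subsets of \<open>W\<close>.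
\<close>

lemma degree_complex_contributing:
  assumes e: "e \<in> contributing_degrees \<Delta> V W k j"
  shows "degree_complex \<Delta> W e
     = (\<union>) (neg_support e) ` induced (link \<Delta> (neg_support e \<union> (keys e \<inter> V))) W"
    (is "_ = ?R")
proof (intro equalityI subsetI)
  note s = contributing_degree_supports[OF e]
  fix \<sigma> assume \<sigma>: "\<sigma> \<in> degree_complex \<Delta> W e"
  then have "neg_support e \<union> (\<sigma> - neg_support e) = \<sigma>" by (auto simp: degree_complex_def)
  moreover have "\<sigma> - neg_support e \<in> induced (link \<Delta> (neg_support e \<union> (keys e \<inter> V))) W"
  proof -
    have "neg_support e \<union> (keys e \<inter> V) \<union> (\<sigma> - neg_support e) = keys e \<union> \<sigma>"
      using s(2) by blast
    moreover have "(neg_support e \<union> (keys e \<inter> V)) \<inter> (\<sigma> - neg_support e) = {}"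
      using \<sigma> VW by (auto simp: degree_complex_def)
    ultimately show ?thesis using \<sigma> by (auto simp: degree_complex_def induced_def link_def)
  qed
  ultimately show "\<sigma> \<in> ?R" by (metis imageI)
next
  note s = contributing_degree_supports[OF e]
  fix \<sigma> assume "\<sigma> \<in> ?R"
  then obtain \<tau> where \<tau>: "\<sigma> = neg_support e \<union> \<tau>" "\<tau> \<subseteq> W"
    "neg_support e \<union> (keys e \<inter> V) \<union> \<tau> \<in> \<Delta>"
    by (auto simp: induced_def link_def)
  moreover have "keys e \<union> \<sigma> = neg_support e \<union> (keys e \<inter> V) \<union> \<tau>"
    using s(2) \<tau>(1) by blast
  ultimately show "\<sigma> \<in> degree_complex \<Delta> W e" using s(1) by (auto simp: degree_complex_def)
qed

lemma cohomology_contributing: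
  assumes e: "e \<in> contributing_degrees \<Delta> V W k j"
  shows "\<exists>(A :: (nat set \<Rightarrow> 'k::field) set) \<zeta> :: _ \<Rightarrow> _ \<Rightarrow> 'k.
     cohomology_basis (degree_complex \<Delta> W e) (int i - 1) A \<zeta> \<and>
     card A = d_num TYPE('k) \<Delta> W i (neg_support e) (keys e \<inter> V)"
proof -
  let ?N = "neg_support e"
  let ?\<Gamma> = "induced (link \<Delta> (?N \<union> (keys e \<inter> V))) W"
  interpret shifted_complex ?\<Gamma> ?N
  proof
    show "finite ?N" using contributing_degree_supports(1)[OF e] finW finite_subset by blast
  qed (use simplicial_induced_link in \<open>auto simp: induced_def link_def\<close>)
  have p: "int i - 1 - int (card ?N) = int i - int (card ?N) - 1" by simp
  obtain A :: "(nat set \<Rightarrow> 'k) set" and \<zeta> :: "(nat set \<Rightarrow> 'k) \<Rightarrow> nat set \<Rightarrow> 'k"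
    where dim: "has_dim (reduced_homology ?\<Gamma> (int i - 1 - int (card ?N)) :: ('k, _) module) (card A)"
      and basis: "cohomology_basis K (int i - 1) A \<zeta>"
    using shifted_duality by metis
  have "card A = d_num TYPE('k) \<Delta> W i ?N (keys e \<inter> V)"
    using dim unfolding has_dim_def d_num_def p by simp
  moreover have "cohomology_basis (degree_complex \<Delta> W e) (int i - 1) A \<zeta>"
    unfolding degree_complex_contributing[OF e] by (rule basis)
  ultimately show ?thesis by blast
qed

text \<open>
  Unless the family is empty, a multidegree of the right bidegree fails to
  contribute only if it is positive somewhere on \<open>W\<close>, and then the family is a cone.
\<close>

lemma cohomology_not_contributing:
  fixes \<zeta> :: "'a \<Rightarrow> nat set \<Rightarrow> 'k::field"
  assumes e: "e \<in> bidegrees V W k j - contributing_degrees \<Delta> V W k j"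
  shows "cohomology_basis (degree_complex \<Delta> W e) p {} \<zeta>"
proof (rule cohomology_basis_exact)
  fix x :: "nat set \<Rightarrow> 'k"
  let ?K = "degree_complex \<Delta> W e"
  assume x: "x \<in> coord_space (faces ?K p)" and cocycle: "coboundary ?K x = (\<lambda>F. 0)"
  show "\<exists>h\<in>coord_space (faces ?K (p - 1)). x = coboundary ?K h"
  proof (cases "?K = {}")
    case True
    then have "x = (\<lambda>F. 0)" using x by (auto simp: coord_space_def faces_def)
    then show ?thesis using True by (intro bexI[of _ "\<lambda>F. 0"]) (simp_all add: coboundary_zero)
  next
    case False
    then obtain \<sigma> where \<sigma>: "\<sigma> \<subseteq> W" "keys e \<union> \<sigma> \<in> \<Delta>" "neg_support e \<subseteq> \<sigma>"
      by (auto simp: degree_complex_def)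
    have "keys e \<subseteq> V \<union> W" using \<sigma>(2) \<Delta>_sub by blast
    moreover have "\<forall>v\<in>V. 0 \<le> lookup e v"
    proof
      fix v assume "v \<in> V"
      then have "v \<notin> neg_support e" using \<sigma> VW by blast
      then show "0 \<le> lookup e v" by (simp add: neg_support_def)
    qed
    moreover have "neg_support e \<in> \<Delta>" by (rule \<Delta>_closed[OF \<sigma>(2)]) (use \<sigma>(3) in blast)
    ultimately obtain v where v: "v \<in> W" "0 < lookup e v"
      using e by (auto simp: contributing_degrees_def not_le)
    have cone: "insert v \<sigma> \<in> ?K \<longleftrightarrow> \<sigma> \<in> ?K" for \<sigma>
    proof -
      have "v \<in> keys e" "v \<notin> neg_support e" using v by (auto simp: in_keys_iff neg_support_def)
      then have "keys e \<union> insert v \<sigma> = keys e \<union> \<sigma>"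
        "neg_support e \<subseteq> insert v \<sigma> \<longleftrightarrow> neg_support e \<subseteq> \<sigma>" by auto
      then show ?thesis using v(1) by (simp add: degree_complex_def)
    qed
    have "finite \<tau>" if "\<tau> \<in> ?K" for \<tau> using that finW finite_subset by (auto simp: degree_complex_def)
    from coboundary_cone_exact[OF this cone x cocycle] show ?thesis by blast
  qed
qed

text \<open>
  Such a multidegree is \<open>f - g\<close> for a composition \<open>f\<close> of \<open>k\<close> supported on \<open>G\<close> and a
  composition \<open>g\<close> of \<open>- j\<close> supported on \<open>F\<close>.
\<close>

lemma card_degrees_with_supports:
  assumes F: "F \<in> induced \<Delta> W" and G: "G \<subseteq> V"
  shows "finite {e \<in> contributing_degrees \<Delta> V W k j. neg_support e = F \<and> keys e \<inter> V = G}"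
      (is "finite ?D")
    and "card {e \<in> contributing_degrees \<Delta> V W k j. neg_support e = F \<and> keys e \<inter> V = G}
      = binom (k - 1) (int (card G) - 1) * binom (- j - 1) (int (card F) - 1)"
proof -
  have FW: "F \<subseteq> W" "F \<in> \<Delta>" using F by (auto simp: induced_def)
  have fin: "finite F" "finite G" using FW G finV finW finite_subset by blast+
  let ?C = "compositions G k \<times> compositions F (- j)"
  let ?to = "\<lambda>(f, g). Abs_poly_mapping (\<lambda>v. f v - g v) :: nat \<Rightarrow>\<^sub>0 int"
  let ?from = "\<lambda>e. (\<lambda>v. if v \<in> V then lookup e v else 0, \<lambda>v. if v \<in> W then - lookup e v else 0)"
  have lookup: "lookup (?to (f, g)) = (\<lambda>v. f v - g v)"
    if "f \<in> compositions G k" "g \<in> compositions F (- j)" for f g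
  proof -
    have "{v. f v - g v \<noteq> 0} \<subseteq> F \<union> G"
      using that unfolding compositions_def by auto
    then have "finite {v. f v - g v \<noteq> 0}" using fin finite_subset by blast
    then show ?thesis by simp
  qed
  have vals: "f v - g v = (if v \<in> G then f v else if v \<in> F then - g v else 0)"
    if "f \<in> compositions G k" "g \<in> compositions F (- j)" for f g v
    using that G FW VW by (auto simp: compositions_def)
  have pos: "f v > 0" if "f \<in> compositions S k" "v \<in> S" for f v S k using that by (simp add: compositions_def)
  have bij: "bij_betw ?to ?C ?D"
  proof (rule bij_betw_byWitness[where f' = ?from])
    show "\<forall>a\<in>?C. ?from (?to a) = a"
    proof
      fix a assume "a \<in> ?C"
      then obtain f g where a: "a = (f, g)" and fg: "f \<in> compositions G k" "g \<in> compositions F (- j)"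
        by blast
      have "(if v \<in> V then f v - g v else 0) = f v" for v
        using fg G FW VW by (auto simp: compositions_def)
      moreover have "(if v \<in> W then - (f v - g v) else 0) = g v" for v
        using fg G FW VW by (auto simp: compositions_def)
      ultimately show "?from (?to a) = a" unfolding a lookup[OF fg] by simp
    qed
    show "\<forall>e\<in>?D. ?to (?from e) = e"
    proof
      fix e assume e: "e \<in> ?D"
      have "(if v \<in> V then lookup e v else 0) - (if v \<in> W then - lookup e v else 0)
          = lookup e v" for v
        using e VW by (auto simp: contributing_degrees_def in_keys_iff)
      then show "?to (?from e) = e" by simp
    qed
    show "?to ` ?C \<subseteq> ?D"
    proof (rule image_subsetI)
      fix a assume "a \<in> ?C"
      then obtain f g where a: "a = (f, g)" and fg: "f \<in> compositions G k" "g \<in> compositions F (- j)"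
        by blast
      let ?e = "?to (f, g)"
      note l = lookup[OF fg] and vl = vals[OF fg] and pf = pos[OF fg(1)] and pg = pos[OF fg(2)]
      have sgn_cases: "(f v - g v \<noteq> 0 \<longleftrightarrow> v \<in> F \<union> G) \<and> (f v - g v < 0 \<longleftrightarrow> v \<in> F)" for v
      proof -
        have "v \<notin> F" if "v \<in> G" using that G FW VW by blast
        then show ?thesis using pf[of v] pg[of v] by (cases "v \<in> G"; cases "v \<in> F") (simp_all add: vl)
      qed
      have keys: "keys ?e = F \<union> G"
        unfolding set_eq_iff in_keys_iff l using sgn_cases by simp
      have neg: "neg_support ?e = F"
        unfolding set_eq_iff neg_support_def mem_Collect_eq l using sgn_cases by simp
      have "(\<Sum>v\<in>V. f v - g v) = (\<Sum>v\<in>G. f v - g v)"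
        by (rule sum.mono_neutral_right) (use finV G FW VW vl in auto)
      also have "\<dots> = k" using fg by (simp add: vl) (simp add: compositions_def)
      finally have sV: "(\<Sum>v\<in>V. f v - g v) = k" .
      have "(\<Sum>v\<in>W. f v - g v) = (\<Sum>v\<in>F. f v - g v)"
        by (rule sum.mono_neutral_right) (use finW G FW VW vl in auto)
      also have "\<dots> = (\<Sum>v\<in>F. - g v)" by (rule sum.cong) (use G FW VW vl in auto)
      also have "\<dots> = j" using fg by (simp add: sum_negf compositions_def)
      finally have sW: "(\<Sum>v\<in>W. f v - g v) = j" .
      have "v \<notin> F" if "v \<in> V" for v using that FW VW by blast
      then have "\<forall>v\<in>V. 0 \<le> f v - g v" using sgn_cases by (meson not_less)
      moreover have "f v - g v \<le> 0" if "v \<in> W" for v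
      proof -
        have "v \<notin> G" using that G VW by blast
        then show ?thesis using sgn_cases[of v] by auto
      qed
      ultimately show "?to a \<in> ?D"
        unfolding a contributing_degrees_def bidegrees_def mem_Collect_eq neg keys l
        using sV sW FW G VW by auto
    qed
    show "?from ` ?D \<subseteq> ?C"
    proof (rule image_subsetI)
      fix e assume "e \<in> ?D"
      then have e: "e \<in> contributing_degrees \<Delta> V W k j" and F: "F = neg_support e"
        and G: "G = keys e \<inter> V" by auto
      note s = contributing_degree_supports[OF e]
      have eV: "\<forall>v\<in>V. 0 \<le> lookup e v" and eW: "\<forall>v\<in>W. lookup e v \<le> 0"
        and sums: "sum (lookup e) V = k" "sum (lookup e) W = j"
        using e by (auto simp: contributing_degrees_def bidegrees_def)
      show "?from e \<in> ?C"
        unfolding mem_Times_iff fst_conv snd_conv F G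
      proof
        have "(\<Sum>v\<in>keys e \<inter> V. if v \<in> V then lookup e v else 0) = sum (lookup e) V"
          by (rule sum.mono_neutral_cong_left) (use finV in \<open>auto simp: in_keys_iff\<close>)
        then show "(\<lambda>v. if v \<in> V then lookup e v else 0) \<in> compositions (keys e \<inter> V) k"
          using eV sums by (auto simp: compositions_def in_keys_iff order.strict_iff_order)
        have "(\<Sum>v\<in>neg_support e. if v \<in> W then - lookup e v else 0) = (\<Sum>v\<in>W. - lookup e v)"
          by (rule sum.mono_neutral_cong_left) (use finW s(1) eW in \<open>auto simp: neg_support_def not_less intro: antisym\<close>)
        also have "\<dots> = - j" using sums by (simp add: sum_negf)
        finally show "(\<lambda>v. if v \<in> W then - lookup e v else 0) \<in> compositions (neg_support e) (- j)"
          using eW s(1) by (auto simp: compositions_def neg_support_def intro: antisym)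
      qed
    qed
  qed
  note c = card_compositions[OF fin(2), of k] card_compositions[OF fin(1), of "- j"]
  show "finite ?D" using bij_betw_finite[OF bij] c by simp
  show "card ?D = binom (k - 1) (int (card G) - 1) * binom (- j - 1) (int (card F) - 1)"
    using bij_betw_same_card[OF bij] c by (simp add: card_cartesian_product)
qed

lemma contributing_degrees_sum:
  fixes d :: "nat set \<Rightarrow> nat set \<Rightarrow> nat"
  shows "finite (contributing_degrees \<Delta> V W k j)"
    and "(\<Sum>e\<in>contributing_degrees \<Delta> V W k j. d (neg_support e) (keys e \<inter> V))
     = (\<Sum>F\<in>induced \<Delta> W. \<Sum>G\<in>Pow V. d F G * binom (k - 1) (int (card G) - 1) * binom (- j - 1) (int (card F) - 1))"
proof -
  let ?D = "contributing_degrees \<Delta> V W k j"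
  let ?supp = "\<lambda>e. (neg_support e, keys e \<inter> V)"
  have fin_ind: "finite (induced \<Delta> W)" using finW by (auto simp: induced_def intro: finite_subset[of _ "Pow W"])
  have maps: "?supp ` ?D \<subseteq> induced \<Delta> W \<times> Pow V"
    using contributing_degree_supports(1) by (auto simp: induced_def contributing_degrees_def)
  have "?D = (\<Union>(F, G)\<in>induced \<Delta> W \<times> Pow V. {e \<in> ?D. neg_support e = F \<and> keys e \<inter> V = G})"
    using maps by auto
  also have "finite \<dots>" using fin_ind finV card_degrees_with_supports(1) by auto
  finally show fin: "finite ?D" .
  have "(\<Sum>e\<in>?D. d (neg_support e) (keys e \<inter> V))
      = (\<Sum>x\<in>induced \<Delta> W \<times> Pow V. \<Sum>e\<in>{e \<in> ?D. ?supp e = x}. d (neg_support e) (keys e \<inter> V))"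
    using sum.group[OF fin _ maps, of "\<lambda>e. d (neg_support e) (keys e \<inter> V)"] fin_ind finV by simp
  also have "\<dots> = (\<Sum>x\<in>induced \<Delta> W \<times> Pow V.
       d (fst x) (snd x) * binom (k - 1) (int (card (snd x)) - 1) * binom (- j - 1) (int (card (fst x)) - 1))"
  proof (rule sum.cong[OF refl])
    fix x assume x: "x \<in> induced \<Delta> W \<times> Pow V"
    have "(\<Sum>e\<in>{e \<in> ?D. ?supp e = x}. d (neg_support e) (keys e \<inter> V))
        = (\<Sum>e\<in>{e \<in> ?D. neg_support e = fst x \<and> keys e \<inter> V = snd x}. d (fst x) (snd x))"
      by (rule sum.cong) auto
    also have "\<dots> = d (fst x) (snd x) * binom (k - 1) (int (card (snd x)) - 1) * binom (- j - 1) (int (card (fst x)) - 1)"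
      using card_degrees_with_supports(2)[of "fst x" "snd x" k j] x by auto
    finally show "(\<Sum>e\<in>{e \<in> ?D. ?supp e = x}. d (neg_support e) (keys e \<inter> V))
      = d (fst x) (snd x) * binom (k - 1) (int (card (snd x)) - 1) * binom (- j - 1) (int (card (fst x)) - 1)" .
  qed
  finally show "(\<Sum>e\<in>?D. d (neg_support e) (keys e \<inter> V))
     = (\<Sum>F\<in>induced \<Delta> W. \<Sum>G\<in>Pow V. d F G * binom (k - 1) (int (card G) - 1) * binom (- j - 1) (int (card F) - 1))"
    by (simp add: sum.cartesian_product case_prod_unfold)
qed

end

section \<open>Coefficients in the Stanley--Reisner ring\<close>

text \<open>
  The exponent of the \<open>u\<close>-th power of the product of the variables in \<open>F\<close>.
\<close>

definition power_exponent :: "nat \<Rightarrow> nat set \<Rightarrow> nat \<Rightarrow>\<^sub>0 nat" where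
  "power_exponent u F = (\<Sum>v\<in>F. single v u)"

definition monomial :: "(nat \<Rightarrow>\<^sub>0 nat) \<Rightarrow> 'k::field mpoly" where
  "monomial a = single a 1"

lemma lookup_power_exponent: "finite F \<Longrightarrow> lookup (power_exponent u F) v = (if v \<in> F then u else 0)"
  by (simp add: power_exponent_def lookup_sum lookup_single when_def)

lemma keys_power_exponent_subset: "finite F \<Longrightarrow> keys (power_exponent u F) \<subseteq> F"
  by (auto simp: in_keys_iff lookup_power_exponent split: if_splits)

lemma power_exponent_add: "power_exponent u F + power_exponent w F = power_exponent (u + w) F"
  by (simp add: power_exponent_def single_add sum.distrib)

lemma monomial_mult: "monomial a * monomial b = monomial (a + b)"
  by (simp add: monomial_def mult_single)

lemma sqfree_monomial_eq: "sqfree_monomial F = monomial (power_exponent 1 F)"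
  unfolding sqfree_monomial_def power_exponent_def
  by (induction F rule: infinite_finite_induct) (simp_all add: var_def monomial_def mult_single)

lemma keys_add_nat: "keys (a + b) = keys a \<union> keys b" for a b :: "'a \<Rightarrow>\<^sub>0 nat"
  by (auto simp: in_keys_iff lookup_add)

lemma lookup_single_mult:
  fixes p :: "('a::cancel_comm_monoid_add) \<Rightarrow>\<^sub>0 'k::comm_semiring_1"
  shows "lookup (single a c * p) (a + t) = c * lookup p t"
proof -
  have "lookup (single a c * p) (a + t)
      = Sum_any (\<lambda>l. (c * Sum_any (\<lambda>q. lookup p q when a + t = a + q)) when l = a)"
    unfolding lookup_mult by (rule Sum_any.cong) (simp add: lookup_single when_def)
  also have "\<dots> = c * Sum_any (\<lambda>q. lookup p q when q = t)"
    by (simp add: eq_commute)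
  finally show ?thesis by simp
qed

lemma lookup_single_mult_not_multiple:
  fixes p :: "('a::cancel_comm_monoid_add) \<Rightarrow>\<^sub>0 'k::comm_semiring_1"
  assumes "\<And>t'. t \<noteq> a + t'"
  shows "lookup (single a c * p) t = 0"
proof (rule ccontr)
  assume "\<not> ?thesis"
  then have "t \<in> keys (single a c * p)" by (simp add: in_keys_iff)
  then show False using keys_mult[of "single a c" p] assms by (auto split: if_splits)
qed

lemma poly_mapping_expansion: "p = (\<Sum>t\<in>keys p. single t (lookup p t))"
  by (rule poly_mapping_eqI) (simp add: lookup_sum lookup_single when_def in_keys_iff)

lemma carrier_poly_ring: "p \<in> carrier (poly_ring m n) \<longleftrightarrow> (\<forall>t\<in>keys p. keys t \<subseteq> V_vertices m \<union> W_vertices m n)"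
  by (simp add: poly_ring_def)

lemma poly_ring_simps [simp]:
  "p \<otimes>\<^bsub>poly_ring m n\<^esub> q = p * q" "\<one>\<^bsub>poly_ring m n\<^esub> = 1" "\<zero>\<^bsub>poly_ring m n\<^esub> = 0" "p \<oplus>\<^bsub>poly_ring m n\<^esub> q = p + q"
  by (simp_all add: poly_ring_def)

lemma poly_ring_closed:
  fixes p q :: "'k::field mpoly"
  assumes "p \<in> carrier (poly_ring m n)" "q \<in> carrier (poly_ring m n)"
  shows "p + q \<in> carrier (poly_ring m n)" "p * q \<in> carrier (poly_ring m n)" "- p \<in> carrier (poly_ring m n)"
proof -
  show "p + q \<in> carrier (poly_ring m n)" using keys_add[of p q] assms by (auto simp: carrier_poly_ring)
  show "- p \<in> carrier (poly_ring m n)" using assms by (auto simp: carrier_poly_ring)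
  show "p * q \<in> carrier (poly_ring m n)"
    unfolding carrier_poly_ring
  proof
    fix t assume "t \<in> keys (p * q)"
    then obtain a b where "t = a + b" "a \<in> keys p" "b \<in> keys q" using keys_mult[of p q] by auto
    then show "keys t \<subseteq> V_vertices m \<union> W_vertices m n"
      using assms by (auto simp: keys_add_nat carrier_poly_ring)
  qed
qed

lemma cring_poly_ring: "cring (poly_ring m n :: 'k::field mpoly ring)"
proof (rule cringI)
  show "abelian_group (poly_ring m n :: 'k mpoly ring)"
    by (rule abelian_groupI)
       (auto simp: poly_ring_closed add.assoc add.commute carrier_poly_ring[of 0]
         intro!: bexI[of _ "- _"])
  show "comm_monoid (poly_ring m n :: 'k mpoly ring)"
    by (rule comm_monoidI)
       (auto simp: poly_ring_closed mult.assoc mult.commute carrier_poly_ring[of 1])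
qed (auto simp: distrib_right)

lemma poly_ring_minus:
  assumes "p \<in> carrier (poly_ring m n)" "q \<in> carrier (poly_ring m n)"
  shows "p \<ominus>\<^bsub>poly_ring m n\<^esub> q = p - (q :: 'k::field mpoly)"
proof -
  interpret cring "poly_ring m n :: 'k mpoly ring" by (rule cring_poly_ring)
  have "\<ominus>\<^bsub>poly_ring m n\<^esub> q = - q"
    by (rule minus_equality) (use assms poly_ring_closed in auto)
  then show ?thesis by (simp add: a_minus_def)
qed

lemma single_in_poly_ring: "keys t \<subseteq> V_vertices m \<union> W_vertices m n \<Longrightarrow> single t c \<in> carrier (poly_ring m n)"
  by (auto simp: carrier_poly_ring split: if_splits)

text \<open>
  The right-hand side is an ideal since the support of a product of monomials is the union
  of the supports.  Conversely, a monomial whose support contains \<open>b\<close> is a multiple of \<open>sqfree_monomial b\<close>.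
\<close>

lemma sqfree_ideal_eq:
  assumes B: "B \<subseteq> Pow (V_vertices m \<union> W_vertices m n)"
  shows "Idl\<^bsub>poly_ring m n\<^esub> (sqfree_monomial ` B :: 'k::field mpoly set)
    = {p \<in> carrier (poly_ring m n). \<forall>t\<in>keys p. \<exists>b\<in>B. b \<subseteq> keys t}"
proof
  let ?S = "poly_ring m n :: 'k mpoly ring"
  let ?G = "sqfree_monomial ` B :: 'k mpoly set"
  let ?M = "{p \<in> carrier ?S. \<forall>t\<in>keys p. \<exists>b\<in>B. b \<subseteq> keys t}"
  interpret cring "poly_ring m n :: 'k mpoly ring" by (rule cring_poly_ring)
  have fin: "finite b" if "b \<in> B" for b
    using that B by (auto simp: V_vertices_def W_vertices_def intro: finite_subset)
  have keys_b: "keys (power_exponent 1 b) = b" if "b \<in> B" for b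
    by (auto simp: in_keys_iff lookup_power_exponent[OF fin[OF that]] split: if_splits)
  have G: "?G \<subseteq> carrier ?S"
  proof
    fix g assume "g \<in> ?G"
    then obtain b where b: "b \<in> B" "g = sqfree_monomial b" by blast
    then show "g \<in> carrier ?S"
      unfolding b(2) sqfree_monomial_eq monomial_def
      by (intro single_in_poly_ring) (use B keys_b in auto)
  qed
  have M_mult: "p * q \<in> ?M" if p: "p \<in> ?M" and q: "q \<in> carrier ?S" for p q :: "'k mpoly"
  proof -
    have "\<exists>b\<in>B. b \<subseteq> keys t" if t: "t \<in> keys (p * q)" for t
    proof -
      obtain a c where ac: "t = a + c" "a \<in> keys p" using keys_mult[of p q] t by auto
      then obtain b where "b \<in> B" "b \<subseteq> keys a" using p by auto
      then show ?thesis unfolding ac(1) keys_add_nat by auto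
    qed
    then show ?thesis using p q poly_ring_closed(2) by blast
  qed
  have "ideal ?M ?S"
  proof (rule idealI[OF ring_axioms])
    show "subgroup ?M (add_monoid ?S)"
    proof (rule add.subgroupI)
      show "?M \<noteq> {}" by (auto intro!: exI[of _ 0] simp: carrier_poly_ring)
      show "\<ominus>\<^bsub>?S\<^esub> a \<in> ?M" if "a \<in> ?M" for a
      proof -
        have "\<ominus>\<^bsub>?S\<^esub> a = - a"
          by (rule minus_equality) (use that poly_ring_closed in auto)
        then show ?thesis using that poly_ring_closed(3) by auto
      qed
      show "a \<oplus>\<^bsub>?S\<^esub> b \<in> ?M" if "a \<in> ?M" "b \<in> ?M" for a b
        using that keys_add[of a b] poly_ring_closed(1)[of a m n b] by auto
    qed auto
    fix a x assume ax: "a \<in> ?M" "x \<in> carrier ?S"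
    show "a \<otimes>\<^bsub>?S\<^esub> x \<in> ?M" using M_mult[OF ax] by simp
    then show "x \<otimes>\<^bsub>?S\<^esub> a \<in> ?M" by (simp add: mult.commute)
  qed
  moreover have "?G \<subseteq> ?M"
    using G keys_b by (auto simp: sqfree_monomial_eq monomial_def)
  ultimately show "Idl\<^bsub>?S\<^esub> ?G \<subseteq> ?M" by (rule genideal_minimal)
  interpret J: ideal "Idl\<^bsub>?S\<^esub> ?G" ?S by (rule genideal_ideal[OF G])
  show "?M \<subseteq> Idl\<^bsub>?S\<^esub> ?G"
  proof
    fix p :: "'k mpoly" assume p: "p \<in> ?M"
    have summand: "single t (lookup p t) \<in> Idl\<^bsub>?S\<^esub> ?G" if t: "t \<in> keys p" for t
    proof -
      obtain b where b: "b \<in> B" "b \<subseteq> keys t" using p t by blast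
      define t' where "t' = t - power_exponent 1 b"
      have t_eq: "t = t' + power_exponent 1 b"
        by (rule poly_mapping_eqI)
           (use b(2) in \<open>auto simp: t'_def lookup_add lookup_minus lookup_power_exponent[OF fin[OF b(1)]] in_keys_iff subset_iff Suc_le_eq\<close>)
      have "single t' (lookup p t) \<otimes>\<^bsub>?S\<^esub> sqfree_monomial b \<in> Idl\<^bsub>?S\<^esub> ?G"
      proof (rule J.I_l_closed)
        show "sqfree_monomial b \<in> Idl\<^bsub>?S\<^esub> ?G" using genideal_self[OF G] b by blast
        have "keys t' \<subseteq> keys t" unfolding t_eq keys_add_nat by blast
        then show "single t' (lookup p t) \<in> carrier ?S"
          using p t by (intro single_in_poly_ring) (auto simp: carrier_poly_ring)
      qed
      moreover have "single t' (lookup p t) * sqfree_monomial b = single t (lookup p t)"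
        unfolding sqfree_monomial_eq monomial_def mult_single t_eq[symmetric] by simp
      ultimately show ?thesis by simp
    qed
    have "T \<subseteq> keys p \<Longrightarrow> (\<Sum>t\<in>T. single t (lookup p t)) \<in> Idl\<^bsub>?S\<^esub> ?G" for T
    proof (induction T rule: infinite_finite_induct)
      case (insert t T)
      then show ?case using J.a_closed[OF summand[of t]] by simp
    qed (use J.zero_closed in simp_all)
    then show "p \<in> Idl\<^bsub>?S\<^esub> ?G" by (metis poly_mapping_expansion order_refl)
  qed
qed

locale stanley_reisner =
  fixes m n :: nat and I :: "'k::field mpoly set"
  assumes sqfree: "sqfree_monomial_ideal m n I"
begin

abbreviation "S \<equiv> poly_ring m n :: 'k mpoly ring"
abbreviation "R \<equiv> SR_ring m n I"
abbreviation "\<Delta> \<equiv> SR_complex m n I"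
abbreviation "V \<equiv> V_vertices m"
abbreviation "W \<equiv> W_vertices m n"
abbreviation "res \<equiv> residue m n I"

sublocale S: cring S by (rule cring_poly_ring)

lemma finite_vertices: "finite V" "finite W" "V \<inter> W = {}"
  by (auto simp: V_vertices_def W_vertices_def)

lemma ideal_I: "ideal I S"
proof -
  obtain B where B: "B \<subseteq> Pow (V \<union> W)" "I = Idl\<^bsub>S\<^esub> (sqfree_monomial ` B)"
    using sqfree by (auto simp: sqfree_monomial_ideal_def)
  have "sqfree_monomial b \<in> carrier S" if "b \<in> B" for b
    unfolding sqfree_monomial_eq monomial_def
    using that B(1) keys_power_exponent_subset[of b 1] finite_subset[of b "V \<union> W"] finite_vertices
    by (intro single_in_poly_ring) blast
  then show ?thesis unfolding B(2) by (intro S.genideal_ideal) auto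
qed

sublocale I: ideal I S by (rule ideal_I)

lemma complex_iff:
  obtains B where "B \<subseteq> Pow (V \<union> W)" "\<And>F. F \<in> \<Delta> \<longleftrightarrow> F \<subseteq> V \<union> W \<and> \<not> (\<exists>b\<in>B. b \<subseteq> F)"
    "I = {p \<in> carrier S. \<forall>t\<in>keys p. \<exists>b\<in>B. b \<subseteq> keys t}"
proof -
  obtain B where B: "B \<subseteq> Pow (V \<union> W)" "I = Idl\<^bsub>S\<^esub> (sqfree_monomial ` B)"
    using sqfree by (auto simp: sqfree_monomial_ideal_def)
  note I_eq = B(2)[unfolded sqfree_ideal_eq[OF B(1)]]
  have "sqfree_monomial F \<in> I \<longleftrightarrow> (\<exists>b\<in>B. b \<subseteq> F)" if "F \<subseteq> V \<union> W" for F
  proof -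
    have fin: "finite F" using that finite_vertices finite_subset by blast
    have "keys (power_exponent 1 F) = F"
      by (auto simp: in_keys_iff lookup_power_exponent[OF fin] split: if_splits)
    then show ?thesis
      unfolding I_eq sqfree_monomial_eq monomial_def
      using that single_in_poly_ring[of "power_exponent 1 F" m n "1 :: 'k"] by simp
  qed
  then have "F \<in> \<Delta> \<longleftrightarrow> F \<subseteq> V \<union> W \<and> \<not> (\<exists>b\<in>B. b \<subseteq> F)" for F
    by (auto simp: SR_complex_def)
  then show ?thesis using that B(1) I_eq by blast
qed

lemma complex_closed: "F \<in> \<Delta> \<Longrightarrow> G \<subseteq> F \<Longrightarrow> G \<in> \<Delta>"
  by (rule complex_iff) (metis subset_trans)

lemma complex_subset: "\<Delta> \<subseteq> Pow (V \<union> W)" by (auto simp: SR_complex_def)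

lemma in_ideal_iff: "p \<in> I \<longleftrightarrow> p \<in> carrier S \<and> (\<forall>t\<in>keys p. keys t \<notin> \<Delta>)"
  by (rule complex_iff) (auto simp: carrier_poly_ring)

sublocale two_part_complex \<Delta> V W
  using finite_vertices complex_subset complex_closed by unfold_locales auto

sublocale R: cring R
  unfolding SR_ring_def by (rule I.quotient_is_cring[OF S.is_cring])

lemma residue_hom: "res \<in> Ring.ring_hom S R"
proof -
  have "res = (+>\<^bsub>S\<^esub>) I" by (simp add: residue_def fun_eq_iff)
  then show ?thesis using I.rcos_ring_hom by (simp add: SR_ring_def)
qed

lemma residue_carrier [simp]: "p \<in> carrier S \<Longrightarrow> res p \<in> carrier R"
  and residue_mult: "p \<in> carrier S \<Longrightarrow> q \<in> carrier S \<Longrightarrow> res p \<otimes>\<^bsub>R\<^esub> res q = res (p * q)"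
  and residue_add: "p \<in> carrier S \<Longrightarrow> q \<in> carrier S \<Longrightarrow> res p \<oplus>\<^bsub>R\<^esub> res q = res (p + q)"
  and residue_one: "\<one>\<^bsub>R\<^esub> = res 1" and residue_zero: "\<zero>\<^bsub>R\<^esub> = res 0"
  using ring_hom_closed[OF residue_hom] ring_hom_mult[OF residue_hom] ring_hom_add[OF residue_hom]
    ring_hom_one[OF residue_hom] ring_hom_zero[OF residue_hom S.ring_axioms R.ring_axioms]
  by simp_all

lemma residue_surj: "r \<in> carrier R \<Longrightarrow> \<exists>p\<in>carrier S. r = res p"
  by (auto simp: SR_ring_def FactRing_def A_RCOSETS_def' residue_def)

lemma residue_eq_iff: "p \<in> carrier S \<Longrightarrow> q \<in> carrier S \<Longrightarrow> res p = res q \<longleftrightarrow> p - q \<in> I"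
  using S.quotient_eq_iff_same_a_r_cos[OF ideal_I, of p q] by (simp add: residue_def poly_ring_minus)

text \<open>
  The monomials supported on faces form a basis of $K[\Delta]$; these are the coefficients with
  respect to it.  They do not depend on the representative, since elements of the ideal have no such monomials.
\<close>

definition nf_coeff :: "'k mpoly set \<Rightarrow> (nat \<Rightarrow>\<^sub>0 nat) \<Rightarrow> 'k" where
  "nf_coeff r t = (if keys t \<in> \<Delta> then lookup (SOME p. p \<in> r) t else 0)"

lemma nf_coeff_residue:
  assumes "p \<in> carrier S" shows "nf_coeff (res p) t = (if keys t \<in> \<Delta> then lookup p t else 0)"
proof -
  have mem: "res p = (\<lambda>x. x + p) ` I" by (auto simp: residue_def a_r_coset_def')
  have "(SOME q. q \<in> res p) \<in> res p"
    by (rule someI[of _ p]) (use I.zero_closed in \<open>auto simp: mem intro!: image_eqI[of _ _ 0]\<close>)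
  then obtain x where "x \<in> I" "(SOME q. q \<in> res p) = x + p" unfolding mem by blast
  then show ?thesis using in_ideal_iff[of x] by (auto simp: nf_coeff_def lookup_add in_keys_iff)
qed

lemma nf_coeff_inj:
  assumes "r \<in> carrier R" "r' \<in> carrier R" "\<And>t. nf_coeff r t = nf_coeff r' t"
  shows "r = r'"
proof -
  obtain p q where pq: "p \<in> carrier S" "r = res p" "q \<in> carrier S" "r' = res q"
    using residue_surj assms by meson
  have "lookup (p - q) t = 0" if "keys t \<in> \<Delta>" for t
    using assms(3)[of t] that unfolding pq(2,4) by (simp add: nf_coeff_residue pq lookup_minus)
  moreover have "p - q \<in> carrier S" using poly_ring_closed[OF pq(1) poly_ring_closed(3)[OF pq(3,3)]] by simp
  ultimately have "p - q \<in> I" unfolding in_ideal_iff by (auto simp: in_keys_iff)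
  then show ?thesis using residue_eq_iff pq by simp
qed

end

section \<open>Coefficients of fractions\<close>

definition int_exponent :: "(nat \<Rightarrow>\<^sub>0 nat) \<Rightarrow> nat \<Rightarrow>\<^sub>0 int" where
  "int_exponent t = Poly_Mapping.map int t"

definition nat_exponent :: "(nat \<Rightarrow>\<^sub>0 int) \<Rightarrow> nat \<Rightarrow>\<^sub>0 nat" where
  "nat_exponent x = Poly_Mapping.map nat x"

definition nonneg :: "(nat \<Rightarrow>\<^sub>0 int) \<Rightarrow> bool" where
  "nonneg x \<longleftrightarrow> (\<forall>v. 0 \<le> lookup x v)"

lemma lookup_int_exponent [simp]: "lookup (int_exponent t) v = int (lookup t v)"
  unfolding int_exponent_def by transfer (simp add: when_def)

lemma lookup_nat_exponent [simp]: "lookup (nat_exponent x) v = nat (lookup x v)"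
  unfolding nat_exponent_def by transfer (simp add: when_def)

lemma nat_int_exponent [simp]: "nat_exponent (int_exponent t) = t"
  by (rule poly_mapping_eqI) simp

lemma int_nat_exponent: "nonneg x \<Longrightarrow> int_exponent (nat_exponent x) = x"
  by (rule poly_mapping_eqI) (simp add: nonneg_def)

lemma nonneg_int_exponent [simp]: "nonneg (int_exponent t)"
  by (simp add: nonneg_def)

lemma keys_int_exponent [simp]: "keys (int_exponent t) = keys t"
  by (auto simp: in_keys_iff)

lemma keys_nat_exponent: "nonneg x \<Longrightarrow> keys (nat_exponent x) = keys x"
  by (metis int_nat_exponent keys_int_exponent)

lemma int_exponent_add: "int_exponent (a + b) = int_exponent a + int_exponent b"
  by (rule poly_mapping_eqI) (simp add: lookup_add)

definition shift :: "nat \<Rightarrow> nat set \<Rightarrow> nat \<Rightarrow>\<^sub>0 int" where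
  "shift s \<sigma> = int_exponent (power_exponent s \<sigma>)"

lemma lookup_shift: "finite \<sigma> \<Longrightarrow> lookup (shift s \<sigma>) v = (if v \<in> \<sigma> then int s else 0)"
  by (simp add: shift_def lookup_power_exponent)

lemma shift_add: "shift (s + u) \<sigma> = shift s \<sigma> + shift u \<sigma>"
  by (simp add: shift_def int_exponent_add flip: power_exponent_add)

lemma shift_zero [simp]: "shift 0 \<sigma> = 0"
  by (rule poly_mapping_eqI) (cases "finite \<sigma>"; simp add: lookup_shift shift_def power_exponent_def)

lemma keys_shift: "finite \<sigma> \<Longrightarrow> keys (x + shift s \<sigma>) \<subseteq> keys x \<union> \<sigma>" "finite \<sigma> \<Longrightarrow> keys (x - shift s \<sigma>) \<subseteq> keys x \<union> \<sigma>"
  by (auto simp: in_keys_iff lookup_add lookup_minus lookup_shift split: if_splits)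

context stanley_reisner
begin

text \<open>
  Coefficients extended by 0 to all integer exponents.  With this extension, multiplication by a
  monomial is a translation of exponents, also where the monomial does not divide.
\<close>

definition int_coeff :: "'k mpoly set \<Rightarrow> (nat \<Rightarrow>\<^sub>0 int) \<Rightarrow> 'k" where
  "int_coeff r x = (if nonneg x then nf_coeff r (nat_exponent x) else 0)"

lemma int_coeff_residue: "p \<in> carrier S \<Longrightarrow>
    int_coeff (res p) x = (if nonneg x \<and> keys x \<in> \<Delta> then lookup p (nat_exponent x) else 0)"
  by (simp add: int_coeff_def nf_coeff_residue keys_nat_exponent)

lemma int_coeff_inj:
  assumes "r \<in> carrier R" "r' \<in> carrier R" "\<And>x. int_coeff r x = int_coeff r' x"
  shows "r = r'"
  using nf_coeff_inj[OF assms(1,2)] assms(3)[of "int_exponent _"] by (simp add: int_coeff_def)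

lemma int_coeff_add: "r \<in> carrier R \<Longrightarrow> r' \<in> carrier R \<Longrightarrow> int_coeff (r \<oplus>\<^bsub>R\<^esub> r') x = int_coeff r x + int_coeff r' x"
  using residue_surj[of r] residue_surj[of r']
  by (auto simp: residue_add int_coeff_residue poly_ring_closed lookup_add)

lemma int_coeff_zero: "int_coeff \<zero>\<^bsub>R\<^esub> x = 0"
  by (simp add: residue_zero int_coeff_residue carrier_poly_ring)

lemma monomial_carrier: "keys a \<subseteq> V \<union> W \<Longrightarrow> monomial a \<in> carrier S"
  unfolding monomial_def by (rule single_in_poly_ring)

lemma const_carrier: "const c \<in> carrier S"
  unfolding const_def by (rule single_in_poly_ring) simp

lemma int_coeff_const_mult: 
  assumes "r \<in> carrier R" shows "int_coeff (res (const c) \<otimes>\<^bsub>R\<^esub> r) x = c * int_coeff r x"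
proof -
  obtain p where p: "p \<in> carrier S" "r = res p" using residue_surj assms by blast
  have "lookup (const c * p) t = c * lookup p t" for t
    using lookup_single_mult[of 0 c p t] by (simp add: const_def)
  then show ?thesis
    by (simp add: p residue_mult const_carrier int_coeff_residue poly_ring_closed)
qed

text \<open>
  If \<open>x - int_exponent a\<close> is not nonnegative, then \<open>a\<close> does not divide the monomial with
  exponent \<open>x\<close>, and both sides vanish.
\<close>

lemma int_coeff_monomial_mult:
  assumes r: "r \<in> carrier R" and a: "keys a \<subseteq> V \<union> W"
  shows "int_coeff (res (monomial a) \<otimes>\<^bsub>R\<^esub> r) x = (if keys x \<in> \<Delta> then int_coeff r (x - int_exponent a) else 0)"
proof -
  obtain p where p: "p \<in> carrier S" "r = res p" using residue_surj r by blast
  have eq: "int_coeff (res (monomial a) \<otimes>\<^bsub>R\<^esub> r) x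
      = (if nonneg x \<and> keys x \<in> \<Delta> then lookup (monomial a * p) (nat_exponent x) else 0)"
    by (simp add: p residue_mult monomial_carrier[OF a] int_coeff_residue poly_ring_closed)
  show ?thesis
  proof (cases "nonneg (x - int_exponent a) \<and> keys x \<in> \<Delta>")
    case True
    define t where "t = nat_exponent (x - int_exponent a)"
    have t: "int_exponent t = x - int_exponent a" unfolding t_def using int_nat_exponent True by blast
    then have x: "x = int_exponent (a + t)" by (simp add: int_exponent_add algebra_simps)
    have "keys t \<in> \<Delta>" using True complex_closed[of "keys x" "keys t"] by (simp add: x keys_add_nat)
    then have "int_coeff r (x - int_exponent a) = lookup p t"
      unfolding t[symmetric] by (simp add: p int_coeff_residue)
    moreover have "lookup (monomial a * p) (a + t) = lookup p t"
      unfolding monomial_def lookup_single_mult by simp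
    ultimately show ?thesis unfolding eq using True by (simp add: x)
  next
    case False
    have "lookup (monomial a * p) (nat_exponent x) = 0" if x: "nonneg x" "keys x \<in> \<Delta>"
      unfolding monomial_def
    proof (rule lookup_single_mult_not_multiple)
      fix t show "nat_exponent x \<noteq> a + t"
      proof
        assume "nat_exponent x = a + t"
        then have "x = int_exponent a + int_exponent t" using int_nat_exponent[OF x(1)] int_exponent_add by metis
        then have "nonneg (x - int_exponent a)" by simp
        then show False using False x by blast
      qed
    qed
    moreover have "int_coeff r (x - int_exponent a) = 0" if "keys x \<in> \<Delta>" using False that by (simp add: int_coeff_def)
    ultimately show ?thesis unfolding eq by auto
  qed
qed

definition y_prod :: "nat set \<Rightarrow> 'k mpoly set" where
  "y_prod \<sigma> = finprod R (\<lambda>v. res (var v)) \<sigma>"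

lemma W_subset_finite: "\<sigma> \<subseteq> W \<Longrightarrow> finite \<sigma>" using finite_vertices finite_subset by blast

lemma keys_power_W: "\<sigma> \<subseteq> W \<Longrightarrow> keys (power_exponent u \<sigma>) \<subseteq> V \<union> W"
  using keys_power_exponent_subset[OF W_subset_finite] by blast

lemma var_eq: "var v = monomial (power_exponent 1 {v})"
  by (simp add: var_def monomial_def power_exponent_def)

lemma y_prod_eq: "\<sigma> \<subseteq> W \<Longrightarrow> y_prod \<sigma> = res (monomial (power_exponent 1 \<sigma>))"
proof -
  assume \<sigma>: "\<sigma> \<subseteq> W"
  have var_c: "var v \<in> carrier S" if "v \<in> W" for v
    unfolding var_eq using that by (intro monomial_carrier keys_power_W) auto
  have "finite \<sigma>" using \<sigma> by (rule W_subset_finite)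
  then show ?thesis using \<sigma>
  proof (induction \<sigma> rule: finite_induct)
    case empty
    then show ?case by (simp add: y_prod_def residue_one monomial_def power_exponent_def)
  next
    case (insert v \<sigma>)
    have "y_prod (insert v \<sigma>) = res (var v) \<otimes>\<^bsub>R\<^esub> y_prod \<sigma>"
      unfolding y_prod_def by (rule R.finprod_insert) (use insert var_c in auto)
    also have "\<dots> = res (var v * monomial (power_exponent 1 \<sigma>))"
      using insert var_c by (simp add: residue_mult monomial_carrier keys_power_W)
    also have "var v * monomial (power_exponent 1 \<sigma>) = monomial (power_exponent 1 (insert v \<sigma>))"
      using insert.hyps by (simp add: var_def monomial_def mult_single power_exponent_def)
    finally show ?case .
  qed
qed

lemma y_prod_carrier: "\<sigma> \<subseteq> W \<Longrightarrow> y_prod \<sigma> \<in> carrier R"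
  by (simp add: y_prod_eq monomial_carrier keys_power_W)

lemma y_prod_pow: "\<sigma> \<subseteq> W \<Longrightarrow> y_prod \<sigma> [^]\<^bsub>R\<^esub> u = res (monomial (power_exponent u \<sigma>))"
proof (induction u)
  case 0
  then show ?case by (simp add: residue_one monomial_def power_exponent_def)
next
  case (Suc u)
  then show ?case
    by (simp add: y_prod_eq residue_mult monomial_carrier keys_power_W monomial_mult power_exponent_add)
qed

lemma int_coeff_y_prod_mult:
  assumes "\<sigma> \<subseteq> W" "r \<in> carrier R"
  shows "int_coeff (y_prod \<sigma> [^]\<^bsub>R\<^esub> u \<otimes>\<^bsub>R\<^esub> r) x = (if keys x \<in> \<Delta> then int_coeff r (x - shift u \<sigma>) else 0)"
  unfolding y_prod_pow[OF assms(1)] shift_def by (rule int_coeff_monomial_mult) (use assms keys_power_W in auto)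

text \<open>
  The coefficient of $r / y_\sigma^s$ in multidegree \<open>e\<close>.  A monomial of \<open>r\<close> survives in the
  localization only if its product with $y_\sigma$ is nonzero in $K[\Delta]$; this is the condition
  \<open>keys e \<union> \<sigma> \<in> \<Delta>\<close>.
\<close>

definition frac_coeff :: "nat set \<Rightarrow> 'k mpoly set \<Rightarrow> nat \<Rightarrow> (nat \<Rightarrow>\<^sub>0 int) \<Rightarrow> 'k" where
  "frac_coeff \<sigma> r s e = (if keys e \<union> \<sigma> \<in> \<Delta> then int_coeff r (e + shift s \<sigma>) else 0)"

lemma frac_coeff_shift:
  assumes \<sigma>: "\<sigma> \<subseteq> W" and r: "r \<in> carrier R"
  shows "frac_coeff \<sigma> (y_prod \<sigma> [^]\<^bsub>R\<^esub> u \<otimes>\<^bsub>R\<^esub> r) (s + u) = frac_coeff \<sigma> r s"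
proof
  fix e
  show "frac_coeff \<sigma> (y_prod \<sigma> [^]\<^bsub>R\<^esub> u \<otimes>\<^bsub>R\<^esub> r) (s + u) e = frac_coeff \<sigma> r s e"
  proof (cases "keys e \<union> \<sigma> \<in> \<Delta>")
    case True
    then have "keys (e + shift (s + u) \<sigma>) \<in> \<Delta>"
      using complex_closed keys_shift(1)[OF W_subset_finite[OF \<sigma>]] by blast
    then show ?thesis using True by (simp add: frac_coeff_def int_coeff_y_prod_mult[OF \<sigma> r] shift_add algebra_simps)
  qed (simp add: frac_coeff_def)
qed

text \<open>
  One factor $y_\sigma$ kills all monomials that vanish in the localization.  What
  remains of a numerator, with denominators cleared, is determined by the coefficients of the fraction.
\<close>

lemma int_coeff_y_prod_mult_as_frac_coeff:
  assumes \<sigma>: "\<sigma> \<subseteq> W" and r: "r \<in> carrier R"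
  shows "int_coeff (y_prod \<sigma> [^]\<^bsub>R\<^esub> Suc 0 \<otimes>\<^bsub>R\<^esub> (y_prod \<sigma> [^]\<^bsub>R\<^esub> s' \<otimes>\<^bsub>R\<^esub> r)) x
     = (if keys x \<in> \<Delta> \<and> \<sigma> \<subseteq> keys x then frac_coeff \<sigma> r s (x - shift (s + s' + 1) \<sigma>) else 0)"
proof -
  let ?y = "y_prod \<sigma> [^]\<^bsub>R\<^esub> s' \<otimes>\<^bsub>R\<^esub> r"
  have fin: "finite \<sigma>" by (rule W_subset_finite[OF \<sigma>])
  have yc: "?y \<in> carrier R" using y_prod_carrier[OF \<sigma>] r by blast
  have *: "int_coeff (y_prod \<sigma> [^]\<^bsub>R\<^esub> Suc 0 \<otimes>\<^bsub>R\<^esub> ?y) x = (if keys x \<in> \<Delta> then int_coeff ?y (x - shift 1 \<sigma>) else 0)"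
    using int_coeff_y_prod_mult[OF \<sigma> yc, of "Suc 0" x] by simp
  show ?thesis
  proof (cases "keys x \<in> \<Delta>")
    case True
    show ?thesis
    proof (cases "\<sigma> \<subseteq> keys x")
      case sub: True
      have e: "x - shift 1 \<sigma> = (x - shift (s + s' + 1) \<sigma>) + shift (s + s') \<sigma>"
        unfolding shift_add by simp
      have "keys (x - shift u \<sigma>) \<union> \<sigma> \<subseteq> keys x" for u
        using keys_shift(2)[OF fin, of x u] sub by blast
      then have "keys (x - shift 1 \<sigma>) \<in> \<Delta>" "keys (x - shift (s + s' + 1) \<sigma>) \<union> \<sigma> \<in> \<Delta>"
        using complex_closed[OF True] by simp_all
      then have "int_coeff ?y (x - shift 1 \<sigma>) = frac_coeff \<sigma> ?y (s + s') (x - shift (s + s' + 1) \<sigma>)"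
        unfolding frac_coeff_def e by simp
      then show ?thesis unfolding * using frac_coeff_shift[OF \<sigma> r, of s' s] True sub by simp
    next
      case False
      then obtain v where v: "v \<in> \<sigma>" "lookup x v = 0" by (auto simp: in_keys_iff)
      then have "lookup (x - shift 1 \<sigma>) v < 0" by (simp add: lookup_minus lookup_shift[OF fin])
      then have "\<not> nonneg (x - shift 1 \<sigma>)" unfolding nonneg_def by (meson not_less)
      then show ?thesis unfolding * using False by (simp add: int_coeff_def)
    qed
  next
    case False
    then show ?thesis unfolding * by simp
  qed
qed

text \<open>
  Fractions are equal exactly if they have the same coefficients.  Expanding a fraction by a
  power of $y_\sigma$ does not change its coefficients; conversely the first power of $y_\sigma$ already
  witnesses the equality of fractions with equal coefficients.
\<close>

lemma loc_rel_iff: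
  assumes \<sigma>: "\<sigma> \<subseteq> W"
  shows "((r, s), (r', s')) \<in> loc_rel R (y_prod \<sigma>) \<longleftrightarrow> r \<in> carrier R \<and> r' \<in> carrier R \<and> frac_coeff \<sigma> r s = frac_coeff \<sigma> r' s'"
proof (intro iffI conjI)
  assume rel: "((r, s), (r', s')) \<in> loc_rel R (y_prod \<sigma>)"
  then show r: "r \<in> carrier R" and r': "r' \<in> carrier R" by (auto simp: loc_rel_def)
  obtain u :: nat where u: "y_prod \<sigma> [^]\<^bsub>R\<^esub> u \<otimes>\<^bsub>R\<^esub> (y_prod \<sigma> [^]\<^bsub>R\<^esub> s' \<otimes>\<^bsub>R\<^esub> r)
      = y_prod \<sigma> [^]\<^bsub>R\<^esub> u \<otimes>\<^bsub>R\<^esub> (y_prod \<sigma> [^]\<^bsub>R\<^esub> s \<otimes>\<^bsub>R\<^esub> r')"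
    using rel by (auto simp: loc_rel_def)
  have c: "y_prod \<sigma> [^]\<^bsub>R\<^esub> s' \<otimes>\<^bsub>R\<^esub> r \<in> carrier R" "y_prod \<sigma> [^]\<^bsub>R\<^esub> s \<otimes>\<^bsub>R\<^esub> r' \<in> carrier R"
    using y_prod_carrier[OF \<sigma>] r r' by auto
  have "frac_coeff \<sigma> r s = frac_coeff \<sigma> (y_prod \<sigma> [^]\<^bsub>R\<^esub> u \<otimes>\<^bsub>R\<^esub> (y_prod \<sigma> [^]\<^bsub>R\<^esub> s' \<otimes>\<^bsub>R\<^esub> r)) (s + s' + u)"
    using frac_coeff_shift[OF \<sigma> c(1)] frac_coeff_shift[OF \<sigma> r] by simp
  also have "\<dots> = frac_coeff \<sigma> (y_prod \<sigma> [^]\<^bsub>R\<^esub> u \<otimes>\<^bsub>R\<^esub> (y_prod \<sigma> [^]\<^bsub>R\<^esub> s \<otimes>\<^bsub>R\<^esub> r')) (s' + s + u)"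
    unfolding u by (simp add: add.commute)
  also have "\<dots> = frac_coeff \<sigma> r' s'" using frac_coeff_shift[OF \<sigma> c(2)] frac_coeff_shift[OF \<sigma> r'] by simp
  finally show "frac_coeff \<sigma> r s = frac_coeff \<sigma> r' s'" .
next
  assume a: "r \<in> carrier R \<and> r' \<in> carrier R \<and> frac_coeff \<sigma> r s = frac_coeff \<sigma> r' s'"
  have "y_prod \<sigma> [^]\<^bsub>R\<^esub> Suc 0 \<otimes>\<^bsub>R\<^esub> (y_prod \<sigma> [^]\<^bsub>R\<^esub> s' \<otimes>\<^bsub>R\<^esub> r)
      = y_prod \<sigma> [^]\<^bsub>R\<^esub> Suc 0 \<otimes>\<^bsub>R\<^esub> (y_prod \<sigma> [^]\<^bsub>R\<^esub> s \<otimes>\<^bsub>R\<^esub> r')"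
  proof (rule int_coeff_inj)
    show "y_prod \<sigma> [^]\<^bsub>R\<^esub> Suc 0 \<otimes>\<^bsub>R\<^esub> (y_prod \<sigma> [^]\<^bsub>R\<^esub> s' \<otimes>\<^bsub>R\<^esub> r) \<in> carrier R"
      "y_prod \<sigma> [^]\<^bsub>R\<^esub> Suc 0 \<otimes>\<^bsub>R\<^esub> (y_prod \<sigma> [^]\<^bsub>R\<^esub> s \<otimes>\<^bsub>R\<^esub> r') \<in> carrier R"
      using a y_prod_carrier[OF \<sigma>] by blast+
    fix x
    have "int_coeff (y_prod \<sigma> [^]\<^bsub>R\<^esub> Suc 0 \<otimes>\<^bsub>R\<^esub> (y_prod \<sigma> [^]\<^bsub>R\<^esub> s' \<otimes>\<^bsub>R\<^esub> r)) x
        = (if keys x \<in> \<Delta> \<and> \<sigma> \<subseteq> keys x then frac_coeff \<sigma> r s (x - shift (s + s' + 1) \<sigma>) else 0)"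
      using a by (intro int_coeff_y_prod_mult_as_frac_coeff[OF \<sigma>]) blast
    also have "\<dots> = (if keys x \<in> \<Delta> \<and> \<sigma> \<subseteq> keys x then frac_coeff \<sigma> r' s' (x - shift (s' + s + 1) \<sigma>) else 0)"
      using a by (simp add: add.commute)
    also have "\<dots> = int_coeff (y_prod \<sigma> [^]\<^bsub>R\<^esub> Suc 0 \<otimes>\<^bsub>R\<^esub> (y_prod \<sigma> [^]\<^bsub>R\<^esub> s \<otimes>\<^bsub>R\<^esub> r')) x"
      using a by (intro int_coeff_y_prod_mult_as_frac_coeff[OF \<sigma>, symmetric]) blast
    finally show "int_coeff (y_prod \<sigma> [^]\<^bsub>R\<^esub> Suc 0 \<otimes>\<^bsub>R\<^esub> (y_prod \<sigma> [^]\<^bsub>R\<^esub> s' \<otimes>\<^bsub>R\<^esub> r)) x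
        = int_coeff (y_prod \<sigma> [^]\<^bsub>R\<^esub> Suc 0 \<otimes>\<^bsub>R\<^esub> (y_prod \<sigma> [^]\<^bsub>R\<^esub> s \<otimes>\<^bsub>R\<^esub> r')) x" .
  qed
  then show "((r, s), (r', s')) \<in> loc_rel R (y_prod \<sigma>)" using a unfolding loc_rel_def by blast
qed

end

section \<open>Localizations as spaces of functions\<close>

context stanley_reisner
begin

abbreviation "L \<equiv> cech_loc R (\<lambda>v. res (var v))"

lemma L_eq: "L \<sigma> = localization R (y_prod \<sigma>)"
  by (simp add: cech_loc_def y_prod_def)

definition loc_coeff :: "nat set \<Rightarrow> ('k mpoly set \<times> nat) set \<Rightarrow> (nat \<Rightarrow>\<^sub>0 int) \<Rightarrow> 'k" where
  "loc_coeff \<sigma> X = (let z = SOME z. z \<in> X in frac_coeff \<sigma> (fst z) (snd z))"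

lemma in_frac_iff:
  assumes "\<sigma> \<subseteq> W" "r \<in> carrier R"
  shows "(r', s') \<in> frac R (y_prod \<sigma>) r s \<longleftrightarrow> r' \<in> carrier R \<and> frac_coeff \<sigma> r' s' = frac_coeff \<sigma> r s"
  unfolding frac_def using loc_rel_iff[OF assms(1), of r s r' s'] assms(2) by auto

lemma loc_coeff_frac:
  assumes "\<sigma> \<subseteq> W" "r \<in> carrier R"
  shows "loc_coeff \<sigma> (frac R (y_prod \<sigma>) r s) = frac_coeff \<sigma> r s"
proof -
  have "(SOME z. z \<in> frac R (y_prod \<sigma>) r s) \<in> frac R (y_prod \<sigma>) r s"
    by (rule someI[of _ "(r, s)"]) (use assms in \<open>simp add: in_frac_iff\<close>)
  then show ?thesis unfolding loc_coeff_def Let_def using in_frac_iff[OF assms] by (metis prod.collapse)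
qed

lemma carrier_L: "X \<in> carrier (L \<sigma>) \<longleftrightarrow> (\<exists>r\<in>carrier R. \<exists>s. X = frac R (y_prod \<sigma>) r s)"
  unfolding L_eq localization_def frac_def by (auto simp: quotient_def)

lemma frac_carrier [simp]: "r \<in> carrier R \<Longrightarrow> frac R (y_prod \<sigma>) r s \<in> carrier (L \<sigma>)"
  unfolding carrier_L by blast

lemma frac_eqI:
  assumes "\<sigma> \<subseteq> W" "r \<in> carrier R" "r' \<in> carrier R" "frac_coeff \<sigma> r s = frac_coeff \<sigma> r' s'"
  shows "frac R (y_prod \<sigma>) r s = frac R (y_prod \<sigma>) r' s'"
proof (rule Set.set_eqI)
  fix z
  show "z \<in> frac R (y_prod \<sigma>) r s \<longleftrightarrow> z \<in> frac R (y_prod \<sigma>) r' s'"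
    using in_frac_iff[OF assms(1,2), of "fst z" "snd z"] in_frac_iff[OF assms(1,3), of "fst z" "snd z"] assms(4) by simp
qed

text \<open>
  Equations between elements of a localization can be checked on coefficients; the laws of its additive
  group are proved in this way.
\<close>

lemma loc_coeff_inj:
  assumes "\<sigma> \<subseteq> W" "X \<in> carrier (L \<sigma>)" "Y \<in> carrier (L \<sigma>)" "loc_coeff \<sigma> X = loc_coeff \<sigma> Y"
  shows "X = Y"
proof -
  obtain r s r' s' where r: "r \<in> carrier R" "X = frac R (y_prod \<sigma>) r s" and r': "r' \<in> carrier R" "Y = frac R (y_prod \<sigma>) r' s'"
    using assms(2,3) unfolding carrier_L by auto
  have "frac_coeff \<sigma> r s = frac_coeff \<sigma> r' s'"
    using assms(4) unfolding r(2) r'(2) loc_coeff_frac[OF assms(1) r(1)] loc_coeff_frac[OF assms(1) r'(1)] .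
  then show ?thesis unfolding r(2) r'(2) by (rule frac_eqI[OF assms(1) r(1) r'(1)])
qed

lemma mem_L:
  assumes "\<sigma> \<subseteq> W" "X \<in> carrier (L \<sigma>)" "(r, s) \<in> X"
  shows "r \<in> carrier R" "frac_coeff \<sigma> r s = loc_coeff \<sigma> X"
proof -
  obtain r0 s0 where r0: "r0 \<in> carrier R" "X = frac R (y_prod \<sigma>) r0 s0" using assms(2) unfolding carrier_L by auto
  show "r \<in> carrier R" "frac_coeff \<sigma> r s = loc_coeff \<sigma> X"
    using assms(3) unfolding r0(2) in_frac_iff[OF assms(1) r0(1)] loc_coeff_frac[OF assms(1) r0(1)] by simp_all
qed

lemma L_nonempty: "\<sigma> \<subseteq> W \<Longrightarrow> X \<in> carrier (L \<sigma>) \<Longrightarrow> \<exists>r s. (r, s) \<in> X"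
proof -
  assume \<sigma>: "\<sigma> \<subseteq> W" and "X \<in> carrier (L \<sigma>)"
  then obtain r s where r: "r \<in> carrier R" "X = frac R (y_prod \<sigma>) r s" unfolding carrier_L by auto
  have "(r, s) \<in> X" unfolding r(2) in_frac_iff[OF \<sigma> r(1)] using r(1) by simp
  then show ?thesis by blast
qed

text \<open>
  The operations on a localization are unions over all representatives.  A union of equal
  sets over a nonempty index set is that set.
\<close>

lemma UN_pairs_const:
  assumes "z \<in> X" "\<And>r s. (r, s) \<in> X \<Longrightarrow> f r s = c"
  shows "(\<Union>(r, s)\<in>X. f r s) = c"
proof -
  have "(\<Union>(r, s)\<in>X. f r s) = (\<Union>x\<in>X. c)" using assms(2) by (intro SUP_cong) auto
  also have "\<dots> = c" using assms(1) by auto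
  finally show ?thesis .
qed

lemma frac_coeff_add:
  assumes "r \<in> carrier R" "r' \<in> carrier R"
  shows "frac_coeff \<sigma> (r \<oplus>\<^bsub>R\<^esub> r') s e = frac_coeff \<sigma> r s e + frac_coeff \<sigma> r' s e"
  by (simp add: frac_coeff_def int_coeff_add assms)

lemma loc_coeff_add:
  assumes \<sigma>: "\<sigma> \<subseteq> W" and X: "X \<in> carrier (L \<sigma>)" and Y: "Y \<in> carrier (L \<sigma>)"
  shows "X \<oplus>\<^bsub>L \<sigma>\<^esub> Y \<in> carrier (L \<sigma>)" "loc_coeff \<sigma> (X \<oplus>\<^bsub>L \<sigma>\<^esub> Y) e = loc_coeff \<sigma> X e + loc_coeff \<sigma> Y e"
proof -
  obtain r0 s0 r0' s0' where rs0: "(r0, s0) \<in> X" "(r0', s0') \<in> Y" using L_nonempty[OF \<sigma>] X Y by meson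
  let ?num = "\<lambda>r s r' s'. y_prod \<sigma> [^]\<^bsub>R\<^esub> (s' :: nat) \<otimes>\<^bsub>R\<^esub> r \<oplus>\<^bsub>R\<^esub> y_prod \<sigma> [^]\<^bsub>R\<^esub> (s :: nat) \<otimes>\<^bsub>R\<^esub> r'"
  have num: "?num r s r' s' \<in> carrier R" "frac_coeff \<sigma> (?num r s r' s') (s + s') = (\<lambda>e. loc_coeff \<sigma> X e + loc_coeff \<sigma> Y e)"
    if "(r, s) \<in> X" "(r', s') \<in> Y" for r s r' s'
  proof -
    note r = mem_L[OF \<sigma> X that(1)] and r' = mem_L[OF \<sigma> Y that(2)]
    have c: "y_prod \<sigma> [^]\<^bsub>R\<^esub> s' \<otimes>\<^bsub>R\<^esub> r \<in> carrier R" "y_prod \<sigma> [^]\<^bsub>R\<^esub> s \<otimes>\<^bsub>R\<^esub> r' \<in> carrier R"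
      using y_prod_carrier[OF \<sigma>] r r' by auto
    then show "?num r s r' s' \<in> carrier R" by blast
    have "frac_coeff \<sigma> (y_prod \<sigma> [^]\<^bsub>R\<^esub> s' \<otimes>\<^bsub>R\<^esub> r) (s + s') = loc_coeff \<sigma> X" using frac_coeff_shift[OF \<sigma> r(1)] r(2) by simp
    moreover have "frac_coeff \<sigma> (y_prod \<sigma> [^]\<^bsub>R\<^esub> s \<otimes>\<^bsub>R\<^esub> r') (s + s') = loc_coeff \<sigma> Y"
      using frac_coeff_shift[OF \<sigma> r'(1), of s s'] r'(2) by (simp add: add.commute)
    ultimately show "frac_coeff \<sigma> (?num r s r' s') (s + s') = (\<lambda>e. loc_coeff \<sigma> X e + loc_coeff \<sigma> Y e)"
      by (simp add: fun_eq_iff frac_coeff_add[OF c])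
  qed
  let ?Z = "frac R (y_prod \<sigma>) (?num r0 s0 r0' s0') (s0 + s0')"
  have "frac R (y_prod \<sigma>) (?num r s r' s') (s + s') = ?Z" if "(r, s) \<in> X" "(r', s') \<in> Y" for r s r' s'
    by (rule frac_eqI[OF \<sigma>]) (use num[OF that] num[OF rs0] in auto)
  then have inner: "(\<Union>(r', s')\<in>Y. frac R (y_prod \<sigma>) (?num r s r' s') (s + s')) = ?Z" if "(r, s) \<in> X" for r s
    using that rs0(2) by (intro UN_pairs_const) auto
  have "X \<oplus>\<^bsub>L \<sigma>\<^esub> Y = (\<Union>(r, s)\<in>X. \<Union>(r', s')\<in>Y. frac R (y_prod \<sigma>) (?num r s r' s') (s + s'))"
    unfolding L_eq localization_def by simp
  also have "\<dots> = ?Z" by (rule UN_pairs_const[OF rs0(1)]) (rule inner)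
  finally have eq: "X \<oplus>\<^bsub>L \<sigma>\<^esub> Y = ?Z" .
  show "X \<oplus>\<^bsub>L \<sigma>\<^esub> Y \<in> carrier (L \<sigma>)" unfolding eq by (rule frac_carrier[OF num(1)[OF rs0]])
  show "loc_coeff \<sigma> (X \<oplus>\<^bsub>L \<sigma>\<^esub> Y) e = loc_coeff \<sigma> X e + loc_coeff \<sigma> Y e"
    unfolding eq loc_coeff_frac[OF \<sigma> num(1)[OF rs0]] num(2)[OF rs0] by (rule refl)
qed

lemma loc_coeff_const_smult:
  assumes \<sigma>: "\<sigma> \<subseteq> W" and X: "X \<in> carrier (L \<sigma>)"
  shows "res (const a) \<odot>\<^bsub>L \<sigma>\<^esub> X \<in> carrier (L \<sigma>)" "loc_coeff \<sigma> (res (const a) \<odot>\<^bsub>L \<sigma>\<^esub> X) e = a * loc_coeff \<sigma> X e"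
proof -
  obtain r0 s0 where rs0: "(r0, s0) \<in> X" using L_nonempty[OF \<sigma> X] by blast
  have c: "res (const a) \<otimes>\<^bsub>R\<^esub> r \<in> carrier R" "frac_coeff \<sigma> (res (const a) \<otimes>\<^bsub>R\<^esub> r) s = (\<lambda>e. a * loc_coeff \<sigma> X e)"
    if "(r, s) \<in> X" for r s
  proof -
    note r = mem_L[OF \<sigma> X that]
    show "res (const a) \<otimes>\<^bsub>R\<^esub> r \<in> carrier R" by (intro R.m_closed residue_carrier const_carrier r(1))
    show "frac_coeff \<sigma> (res (const a) \<otimes>\<^bsub>R\<^esub> r) s = (\<lambda>e. a * loc_coeff \<sigma> X e)"
      unfolding r(2)[symmetric] by (simp add: fun_eq_iff frac_coeff_def int_coeff_const_mult[OF r(1)])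
  qed
  let ?Z = "frac R (y_prod \<sigma>) (res (const a) \<otimes>\<^bsub>R\<^esub> r0) s0"
  have "frac R (y_prod \<sigma>) (res (const a) \<otimes>\<^bsub>R\<^esub> r) s = ?Z" if "(r, s) \<in> X" for r s
    by (rule frac_eqI[OF \<sigma>]) (use c[OF that] c[OF rs0] in auto)
  then have "(\<Union>(r, s)\<in>X. frac R (y_prod \<sigma>) (res (const a) \<otimes>\<^bsub>R\<^esub> r) s) = ?Z"
    by (rule UN_pairs_const[OF rs0])
  then have eq: "res (const a) \<odot>\<^bsub>L \<sigma>\<^esub> X = ?Z" unfolding L_eq localization_def by simp
  show "res (const a) \<odot>\<^bsub>L \<sigma>\<^esub> X \<in> carrier (L \<sigma>)" unfolding eq by (rule frac_carrier[OF c(1)[OF rs0]])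
  show "loc_coeff \<sigma> (res (const a) \<odot>\<^bsub>L \<sigma>\<^esub> X) e = a * loc_coeff \<sigma> X e"
    unfolding eq loc_coeff_frac[OF \<sigma> c(1)[OF rs0]] c(2)[OF rs0] by (rule refl)
qed

lemma loc_coeff_zero:
  assumes \<sigma>: "\<sigma> \<subseteq> W"
  shows "\<zero>\<^bsub>L \<sigma>\<^esub> \<in> carrier (L \<sigma>)" "loc_coeff \<sigma> \<zero>\<^bsub>L \<sigma>\<^esub> e = 0"
proof -
  have z: "\<zero>\<^bsub>L \<sigma>\<^esub> = frac R (y_prod \<sigma>) \<zero>\<^bsub>R\<^esub> 0" unfolding L_eq localization_def by simp
  show "\<zero>\<^bsub>L \<sigma>\<^esub> \<in> carrier (L \<sigma>)" unfolding z by (rule frac_carrier[OF R.zero_closed])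
  show "loc_coeff \<sigma> \<zero>\<^bsub>L \<sigma>\<^esub> e = 0" unfolding z loc_coeff_frac[OF \<sigma> R.zero_closed] by (simp add: frac_coeff_def int_coeff_zero)
qed

lemma abelian_group_L:
  assumes \<sigma>: "\<sigma> \<subseteq> W"
  shows "abelian_group (L \<sigma>)"
proof (rule abelian_groupI)
  note add = loc_coeff_add[OF \<sigma>] and zero = loc_coeff_zero[OF \<sigma>] and sm = loc_coeff_const_smult[OF \<sigma>]
  show "\<zero>\<^bsub>L \<sigma>\<^esub> \<in> carrier (L \<sigma>)" by (rule zero)
  fix x y z assume x: "x \<in> carrier (L \<sigma>)"
  show "\<zero>\<^bsub>L \<sigma>\<^esub> \<oplus>\<^bsub>L \<sigma>\<^esub> x = x"
    by (rule loc_coeff_inj[OF \<sigma> add(1)[OF zero(1) x] x], rule ext) (simp only: add(2)[OF zero(1) x] zero(2) add_0)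
  show "\<exists>y\<in>carrier (L \<sigma>). y \<oplus>\<^bsub>L \<sigma>\<^esub> x = \<zero>\<^bsub>L \<sigma>\<^esub>"
  proof (rule bexI)
    note mx = sm[OF x, of "- 1"]
    show "res (const (- 1)) \<odot>\<^bsub>L \<sigma>\<^esub> x \<oplus>\<^bsub>L \<sigma>\<^esub> x = \<zero>\<^bsub>L \<sigma>\<^esub>"
      by (rule loc_coeff_inj[OF \<sigma> add(1)[OF mx(1) x] zero(1)], rule ext)
         (simp only: add(2)[OF mx(1) x] zero(2) mx(2) mult_minus1 left_minus)
  qed (rule sm(1)[OF x])
  assume y: "y \<in> carrier (L \<sigma>)"
  show xy: "x \<oplus>\<^bsub>L \<sigma>\<^esub> y \<in> carrier (L \<sigma>)" by (rule add(1)[OF x y])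
  show "x \<oplus>\<^bsub>L \<sigma>\<^esub> y = y \<oplus>\<^bsub>L \<sigma>\<^esub> x"
    by (rule loc_coeff_inj[OF \<sigma> xy add(1)[OF y x]], rule ext) (simp only: add(2)[OF x y] add(2)[OF y x] add.commute)
  assume z: "z \<in> carrier (L \<sigma>)"
  note yz = add(1)[OF y z]
  show "x \<oplus>\<^bsub>L \<sigma>\<^esub> y \<oplus>\<^bsub>L \<sigma>\<^esub> z = x \<oplus>\<^bsub>L \<sigma>\<^esub> (y \<oplus>\<^bsub>L \<sigma>\<^esub> z)"
    by (rule loc_coeff_inj[OF \<sigma> add(1)[OF xy z] add(1)[OF x yz]], rule ext)
       (simp only: add(2)[OF xy z] add(2)[OF x y] add(2)[OF x yz] add(2)[OF y z] add.assoc)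
qed

lemma loc_coeff_minus:
  assumes \<sigma>: "\<sigma> \<subseteq> W" and X: "X \<in> carrier (L \<sigma>)"
  shows "loc_coeff \<sigma> (\<ominus>\<^bsub>L \<sigma>\<^esub> X) e = - loc_coeff \<sigma> X e"
proof -
  interpret abelian_group "L \<sigma>" by (rule abelian_group_L[OF \<sigma>])
  have "loc_coeff \<sigma> (X \<oplus>\<^bsub>L \<sigma>\<^esub> \<ominus>\<^bsub>L \<sigma>\<^esub> X) e = 0" using X r_neg loc_coeff_zero(2)[OF \<sigma>] by simp
  then show ?thesis using loc_coeff_add(2)[OF \<sigma> X a_inv_closed[OF X]] by (simp add: eq_neg_iff_add_eq_0 add.commute)
qed

lemma loc_coeff_finsum:
  assumes \<sigma>: "\<sigma> \<subseteq> W" and f: "\<And>q. q \<in> A \<Longrightarrow> f q \<in> carrier (L \<sigma>)" and fin: "finite A"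
  shows "loc_coeff \<sigma> (finsum (L \<sigma>) f A) e = (\<Sum>q\<in>A. loc_coeff \<sigma> (f q) e)"
proof -
  interpret abelian_group "L \<sigma>" by (rule abelian_group_L[OF \<sigma>])
  from fin f show ?thesis
  proof (induction A rule: finite_induct)
    case empty
    then show ?case by (simp add: loc_coeff_zero[OF \<sigma>])
  next
    case (insert q A)
    have "finsum (L \<sigma>) f (insert q A) = f q \<oplus>\<^bsub>L \<sigma>\<^esub> finsum (L \<sigma>) f A"
      by (rule finsum_insert) (use insert in auto)
    moreover have "finsum (L \<sigma>) f A \<in> carrier (L \<sigma>)" using insert by (intro finsum_closed) auto
    ultimately show ?case using insert by (simp add: loc_coeff_add[OF \<sigma>])
  qed
qed

text \<open>
  Passing from $R_{y_{\tau \setminus q}}$ to $R_{y_\tau}$ keeps all coefficients except those of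
  monomials that become zero when $y_q$ is inverted.
\<close>

lemma loc_coeff_loc_map:
  assumes \<tau>: "\<tau> \<subseteq> W" "q \<in> \<tau>" and X: "X \<in> carrier (L (\<tau> - {q}))"
  shows "loc_map R (y_prod (\<tau> - {q})) (res (var q)) X \<in> carrier (L \<tau>)"
    "loc_coeff \<tau> (loc_map R (y_prod (\<tau> - {q})) (res (var q)) X) e = (if keys e \<union> \<tau> \<in> \<Delta> then loc_coeff (\<tau> - {q}) X e else 0)"
proof -
  let ?\<sigma> = "\<tau> - {q}"
  have \<sigma>: "?\<sigma> \<subseteq> W" and q: "{q} \<subseteq> W" using \<tau> by auto
  have fin: "finite \<tau>" by (rule W_subset_finite[OF \<tau>(1)])
  have yq: "res (var q) = y_prod {q}" unfolding y_prod_eq[OF q] var_eq by (rule refl)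
  have "power_exponent 1 ?\<sigma> + power_exponent 1 {q} = power_exponent 1 \<tau>"
    by (rule poly_mapping_eqI) (use fin \<tau>(2) in \<open>auto simp: lookup_add lookup_power_exponent\<close>)
  then have yprod: "y_prod ?\<sigma> \<otimes>\<^bsub>R\<^esub> res (var q) = y_prod \<tau>"
    unfolding yq y_prod_eq[OF \<sigma>] y_prod_eq[OF q] y_prod_eq[OF \<tau>(1)] monomial_mult
      residue_mult[OF monomial_carrier[OF keys_power_W[OF \<sigma>]] monomial_carrier[OF keys_power_W[OF q]]]
    by (simp only:)
  have sh: "shift s \<tau> - shift s {q} = shift s ?\<sigma>" for s
    by (rule poly_mapping_eqI) (use fin \<tau>(2) in \<open>auto simp: lookup_minus lookup_shift\<close>)
  have c: "r \<otimes>\<^bsub>R\<^esub> res (var q) [^]\<^bsub>R\<^esub> s \<in> carrier R"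
    "frac_coeff \<tau> (r \<otimes>\<^bsub>R\<^esub> res (var q) [^]\<^bsub>R\<^esub> s) s = (\<lambda>e. if keys e \<union> \<tau> \<in> \<Delta> then loc_coeff ?\<sigma> X e else 0)"
    if "(r, s) \<in> X" for r s
  proof -
    note r = mem_L[OF \<sigma> X that]
    have yc: "y_prod {q} [^]\<^bsub>R\<^esub> s \<in> carrier R" using y_prod_carrier[OF q] by blast
    then show "r \<otimes>\<^bsub>R\<^esub> res (var q) [^]\<^bsub>R\<^esub> s \<in> carrier R" unfolding yq using r(1) by blast
    show "frac_coeff \<tau> (r \<otimes>\<^bsub>R\<^esub> res (var q) [^]\<^bsub>R\<^esub> s) s = (\<lambda>e. if keys e \<union> \<tau> \<in> \<Delta> then loc_coeff ?\<sigma> X e else 0)"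
    proof
      fix e
      show "frac_coeff \<tau> (r \<otimes>\<^bsub>R\<^esub> res (var q) [^]\<^bsub>R\<^esub> s) s e = (if keys e \<union> \<tau> \<in> \<Delta> then loc_coeff ?\<sigma> X e else 0)"
      proof (cases "keys e \<union> \<tau> \<in> \<Delta>")
        case True
        have "keys (e + shift s \<tau>) \<in> \<Delta>" by (rule complex_closed[OF True keys_shift(1)[OF fin]])
        moreover have "keys e \<union> ?\<sigma> \<in> \<Delta>" by (rule complex_closed[OF True]) auto
        moreover have "r \<otimes>\<^bsub>R\<^esub> y_prod {q} [^]\<^bsub>R\<^esub> s = y_prod {q} [^]\<^bsub>R\<^esub> s \<otimes>\<^bsub>R\<^esub> r"
          by (rule R.m_comm[OF r(1) yc])
        moreover have ee: "e + shift s \<tau> - shift s {q} = e + shift s ?\<sigma>"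
          unfolding sh[symmetric] by (rule add_diff_eq[symmetric])
        ultimately show ?thesis
          using True unfolding r(2)[symmetric] yq frac_coeff_def by (simp add: int_coeff_y_prod_mult[OF q r(1)] ee)
      qed (simp add: frac_coeff_def)
    qed
  qed
  obtain r0 s0 where rs0: "(r0, s0) \<in> X" using L_nonempty[OF \<sigma> X] by blast
  let ?Z = "frac R (y_prod \<tau>) (r0 \<otimes>\<^bsub>R\<^esub> res (var q) [^]\<^bsub>R\<^esub> s0) s0"
  have "frac R (y_prod \<tau>) (r \<otimes>\<^bsub>R\<^esub> res (var q) [^]\<^bsub>R\<^esub> s) s = ?Z" if "(r, s) \<in> X" for r s
    by (rule frac_eqI[OF \<tau>(1)]) (use c[OF that] c[OF rs0] in auto)
  then have eq: "loc_map R (y_prod ?\<sigma>) (res (var q)) X = ?Z"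
    unfolding loc_map_def yprod by (rule UN_pairs_const[OF rs0])
  show "loc_map R (y_prod ?\<sigma>) (res (var q)) X \<in> carrier (L \<tau>)" unfolding eq by (rule frac_carrier[OF c(1)[OF rs0]])
  show "loc_coeff \<tau> (loc_map R (y_prod ?\<sigma>) (res (var q)) X) e = (if keys e \<union> \<tau> \<in> \<Delta> then loc_coeff ?\<sigma> X e else 0)"
    unfolding eq loc_coeff_frac[OF \<tau>(1) c(1)[OF rs0]] c(2)[OF rs0] by (rule refl)
qed

lemma loc_coeff_support:
  assumes \<sigma>: "\<sigma> \<subseteq> W" and X: "X \<in> carrier (L \<sigma>)"
  shows "loc_coeff \<sigma> X e \<noteq> 0 \<Longrightarrow> \<sigma> \<in> degree_complex \<Delta> W e" "finite {e. loc_coeff \<sigma> X e \<noteq> 0}"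
proof -
  obtain r s where r: "r \<in> carrier R" and X_eq: "X = frac R (y_prod \<sigma>) r s" using X carrier_L by blast
  obtain p where p: "p \<in> carrier S" "r = res p" using residue_surj r by blast
  note fin = W_subset_finite[OF \<sigma>]
  have loc_coeff_eq: "loc_coeff \<sigma> X = frac_coeff \<sigma> r s" unfolding X_eq by (rule loc_coeff_frac[OF \<sigma> r])
  have nz: "keys e \<union> \<sigma> \<in> \<Delta> \<and> nonneg (e + shift s \<sigma>) \<and> lookup p (nat_exponent (e + shift s \<sigma>)) \<noteq> 0"
    if "loc_coeff \<sigma> X e \<noteq> 0" for e
    using that unfolding loc_coeff_eq frac_coeff_def p(2) int_coeff_residue[OF p(1)] by (auto split: if_splits)
  show "\<sigma> \<in> degree_complex \<Delta> W e" if "loc_coeff \<sigma> X e \<noteq> 0"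
  proof -
    have "v \<in> \<sigma>" if "lookup e v < 0" for v
    proof (rule ccontr)
      assume "v \<notin> \<sigma>"
      then have "lookup (e + shift s \<sigma>) v < 0" using that by (simp add: lookup_add lookup_shift[OF fin])
      then show False using nz[OF \<open>loc_coeff \<sigma> X e \<noteq> 0\<close>] unfolding nonneg_def by (meson not_less)
    qed
    then show ?thesis using nz[OF that] \<sigma> by (auto simp: degree_complex_def neg_support_def)
  qed
  have "{e. loc_coeff \<sigma> X e \<noteq> 0} \<subseteq> (\<lambda>t. int_exponent t - shift s \<sigma>) ` keys p"
  proof
    fix e assume "e \<in> {e. loc_coeff \<sigma> X e \<noteq> 0}"
    then have "nonneg (e + shift s \<sigma>)" "nat_exponent (e + shift s \<sigma>) \<in> keys p"
      using nz by (auto simp: in_keys_iff)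
    moreover from this(1) have "e = int_exponent (nat_exponent (e + shift s \<sigma>)) - shift s \<sigma>"
      by (simp add: int_nat_exponent)
    ultimately show "e \<in> (\<lambda>t. int_exponent t - shift s \<sigma>) ` keys p" by blast
  qed
  then show "finite {e. loc_coeff \<sigma> X e \<noteq> 0}" by (rule finite_subset) simp
qed

text \<open>
  A common denominator exists since only finitely many multidegrees are involved and each is negative
  at most on \<open>\<sigma>\<close>; the exponent \<open>s\<close> below, the sum of the absolute values of all negative entries, is large enough.
  The third conclusion keeps the numerator homogeneous when \<open>g\<close> is supported in one bidegree.
\<close>

lemma loc_coeff_surj:
  assumes \<sigma>: "\<sigma> \<subseteq> W" and g: "finite {e. g e \<noteq> 0}" "\<And>e. g e \<noteq> 0 \<Longrightarrow> \<sigma> \<in> degree_complex \<Delta> W e"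
  obtains p s where "p \<in> carrier S" "loc_coeff \<sigma> (frac R (y_prod \<sigma>) (res p) s) = g"
    "\<And>t. t \<in> keys p \<Longrightarrow> g (int_exponent t - shift s \<sigma>) \<noteq> 0"
proof -
  note fin = W_subset_finite[OF \<sigma>]
  define E where "E = {e. g e \<noteq> 0}"
  define s where "s = (\<Sum>e\<in>E. \<Sum>v\<in>\<sigma>. nat (- lookup e v))"
  have finE: "finite E" unfolding E_def by (rule g(1))
  have nn: "nonneg (e + shift s \<sigma>)" if e: "e \<in> E" for e
    unfolding nonneg_def
  proof
    fix v
    show "0 \<le> lookup (e + shift s \<sigma>) v"
    proof (cases "v \<in> \<sigma>")
      case True
      have "nat (- lookup e v) \<le> (\<Sum>v\<in>\<sigma>. nat (- lookup e v))"
        by (rule member_le_sum[OF True]) (use fin in auto)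
      also have "\<dots> \<le> s" unfolding s_def by (rule member_le_sum[OF e]) (use finE in auto)
      finally show ?thesis using True by (simp add: lookup_add lookup_shift[OF fin])
    next
      case False
      then have "\<not> lookup e v < 0" using g(2)[of e] e by (auto simp: E_def degree_complex_def neg_support_def)
      then show ?thesis using False by (simp add: lookup_add lookup_shift[OF fin])
    qed
  qed
  define p where "p = (\<Sum>e\<in>E. single (nat_exponent (e + shift s \<sigma>)) (g e))"
  have lookup_p: "lookup p t = g (int_exponent t - shift s \<sigma>)" for t
  proof -
    have "lookup p t = (\<Sum>e\<in>E. if e = int_exponent t - shift s \<sigma> then g e else 0)"
      unfolding p_def lookup_sum
    proof (rule sum.cong[OF refl])
      fix e assume e: "e \<in> E"
      have "nat_exponent (e + shift s \<sigma>) = t \<longleftrightarrow> e = int_exponent t - shift s \<sigma>"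
        using int_nat_exponent[OF nn[OF e]] by (metis add_diff_cancel_right' diff_add_cancel nat_int_exponent)
      then show "lookup (single (nat_exponent (e + shift s \<sigma>)) (g e)) t
        = (if e = int_exponent t - shift s \<sigma> then g e else 0)" by (simp add: lookup_single when_def)
    qed
    also have "\<dots> = g (int_exponent t - shift s \<sigma>)" using finE by (simp add: E_def)
    finally show ?thesis .
  qed
  have p_supp: "g (int_exponent t - shift s \<sigma>) \<noteq> 0" if "t \<in> keys p" for t
    using that lookup_p by (simp add: in_keys_iff)
  have keys_t: "keys t \<in> \<Delta>" if "t \<in> keys p" for t
  proof -
    have "keys (int_exponent t - shift s \<sigma>) \<union> \<sigma> \<in> \<Delta>" using g(2)[OF p_supp[OF that]] by (simp add: degree_complex_def)
    moreover have "keys t \<subseteq> keys (int_exponent t - shift s \<sigma>) \<union> \<sigma>"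
      using keys_shift(1)[OF fin, of "int_exponent t - shift s \<sigma>" s] by simp
    ultimately show ?thesis by (rule complex_closed)
  qed
  have p: "p \<in> carrier S" using keys_t complex_subset by (auto simp: carrier_poly_ring)
  have "loc_coeff \<sigma> (frac R (y_prod \<sigma>) (res p) s) e = g e" for e
  proof -
    have "loc_coeff \<sigma> (frac R (y_prod \<sigma>) (res p) s) e = (if keys e \<union> \<sigma> \<in> \<Delta> \<and> nonneg (e + shift s \<sigma>) \<and> keys (e + shift s \<sigma>) \<in> \<Delta>
        then g e else 0)"
      unfolding loc_coeff_frac[OF \<sigma> residue_carrier[OF p]] frac_coeff_def int_coeff_residue[OF p] lookup_p
      by (simp add: int_nat_exponent)
    moreover have "keys e \<union> \<sigma> \<in> \<Delta> \<and> nonneg (e + shift s \<sigma>) \<and> keys (e + shift s \<sigma>) \<in> \<Delta>" if "g e \<noteq> 0"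
    proof -
      have a: "keys e \<union> \<sigma> \<in> \<Delta>" using g(2)[OF that] by (simp add: degree_complex_def)
      moreover have "nonneg (e + shift s \<sigma>)" using nn that by (simp add: E_def)
      moreover have "keys (e + shift s \<sigma>) \<in> \<Delta>" by (rule complex_closed[OF a keys_shift(1)[OF fin]])
      ultimately show ?thesis by simp
    qed
    ultimately show ?thesis by auto
  qed
  then show ?thesis using that p p_supp by blast
qed

lemma sum_int_exponent: "sum (lookup (int_exponent t - shift s \<sigma>)) A = int (sum (lookup t) A) - int s * int (card (\<sigma> \<inter> A))"
  if "finite \<sigma>" "finite A"
proof -
  have "(\<Sum>v\<in>A. lookup (shift s \<sigma>) v) = (\<Sum>v\<in>A \<inter> \<sigma>. int s)"
    unfolding lookup_shift[OF that(1)] by (rule sum.inter_restrict[OF that(2), symmetric])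
  then show ?thesis by (simp add: lookup_minus sum_subtractf Int_commute mult.commute)
qed

text \<open>
  Dividing by $y_\sigma^s$ lowers the second degree by \<open>s * card \<sigma>\<close>, which is the shift in the
  definition of the components.
\<close>

lemma loc_component_iff:
  assumes \<sigma>: "\<sigma> \<subseteq> W"
  shows "X \<in> loc_component m n I \<sigma> k j \<longleftrightarrow>
    X \<in> carrier (L \<sigma>) \<and> (\<forall>e. loc_coeff \<sigma> X e \<noteq> 0 \<longrightarrow> e \<in> bidegrees V W k j)"
proof
  note fin = W_subset_finite[OF \<sigma>]
  have "\<sigma> \<inter> V = {}" "\<sigma> \<inter> W = \<sigma>" using \<sigma> finite_vertices(3) by auto
  then have deg: "int_exponent t - shift s \<sigma> \<in> bidegrees V W k j \<longleftrightarrow>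
      int (sum (lookup t) V) = k \<and> int (sum (lookup t) W) = j + int s * int (card \<sigma>)" for t s
    unfolding bidegrees_def mem_Collect_eq sum_int_exponent[OF fin finite_vertices(1)] sum_int_exponent[OF fin finite_vertices(2)]
    by auto
  {
    assume "X \<in> loc_component m n I \<sigma> k j"
    then obtain p s where p: "p \<in> poly_component m n k (j + int s * int (card \<sigma>))"
      and X: "X = frac R (y_prod \<sigma>) (res p) s"
      unfolding loc_component_def SR_component_def y_prod_def by auto
    have pc: "p \<in> carrier S" using p by (simp add: poly_component_def)
    have "e \<in> bidegrees V W k j" if "loc_coeff \<sigma> X e \<noteq> 0" for e
    proof -
      have nz: "nonneg (e + shift s \<sigma>)" "nat_exponent (e + shift s \<sigma>) \<in> keys p"
        using that unfolding X loc_coeff_frac[OF \<sigma> residue_carrier[OF pc]] frac_coeff_def int_coeff_residue[OF pc]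
        by (auto simp: in_keys_iff split: if_splits)
      have "int_exponent (nat_exponent (e + shift s \<sigma>)) - shift s \<sigma> \<in> bidegrees V W k j"
        using p nz(2) unfolding deg poly_component_def by blast
      then show ?thesis using int_nat_exponent[OF nz(1)] by simp
    qed
    then show "X \<in> carrier (L \<sigma>) \<and> (\<forall>e. loc_coeff \<sigma> X e \<noteq> 0 \<longrightarrow> e \<in> bidegrees V W k j)"
      unfolding X using pc by simp
  next
    assume X: "X \<in> carrier (L \<sigma>) \<and> (\<forall>e. loc_coeff \<sigma> X e \<noteq> 0 \<longrightarrow> e \<in> bidegrees V W k j)"
    obtain p s where p: "p \<in> carrier S" "loc_coeff \<sigma> (frac R (y_prod \<sigma>) (res p) s) = loc_coeff \<sigma> X"
      "\<And>t. t \<in> keys p \<Longrightarrow> loc_coeff \<sigma> X (int_exponent t - shift s \<sigma>) \<noteq> 0"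
      using loc_coeff_surj[OF \<sigma>, of "loc_coeff \<sigma> X"] loc_coeff_support[OF \<sigma>] X by metis
    have "X = frac R (y_prod \<sigma>) (res p) s"
      by (rule loc_coeff_inj[OF \<sigma>]) (use X p in auto)
    moreover have "p \<in> poly_component m n k (j + int s * int (card \<sigma>))"
    proof -
      have "int_exponent t - shift s \<sigma> \<in> bidegrees V W k j" if "t \<in> keys p" for t using X p(3)[OF that] by blast
      then show ?thesis using p(1) unfolding deg poly_component_def by blast
    qed
    ultimately show "X \<in> loc_component m n I \<sigma> k j"
      unfolding loc_component_def SR_component_def y_prod_def by blast
  }
qed

end

section \<open>The Cech complex in multidegrees\<close>

context stanley_reisner
begin

abbreviation "cochains \<equiv> cech_cochains R (\<lambda>v. res (var v)) W"
abbreviation "C i \<equiv> carrier (cochains i)"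
abbreviation "\<delta> \<equiv> cech_diff R (\<lambda>v. res (var v)) W"
abbreviation "cocycles \<equiv> cech_cocycles R (\<lambda>v. res (var v)) W"
abbreviation "coboundaries \<equiv> cech_coboundaries R (\<lambda>v. res (var v)) W"
abbreviation "K \<equiv> degree_complex \<Delta> W"

text \<open>
  The coefficients of a Cech cochain in all multidegrees.
\<close>

definition \<Phi> :: "nat \<Rightarrow> (nat set \<Rightarrow> ('k mpoly set \<times> nat) set) \<Rightarrow> nat set \<Rightarrow> (nat \<Rightarrow>\<^sub>0 int) \<Rightarrow> 'k" where
  "\<Phi> i c = (\<lambda>\<sigma> e. if \<sigma> \<in> cech_index W i then loc_coeff \<sigma> (c \<sigma>) e else 0)"

lemma cech_indexD: "\<sigma> \<in> cech_index W i \<Longrightarrow> \<sigma> \<subseteq> W" "\<sigma> \<in> cech_index W i \<Longrightarrow> card \<sigma> = i"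
  by (auto simp: cech_index_def)

lemma cochain_component:
  "c \<in> C i \<Longrightarrow> \<sigma> \<in> cech_index W i \<Longrightarrow> c \<sigma> \<in> carrier (L \<sigma>)"
  by (auto simp: cech_cochains_def PiE_iff)

lemma \<Phi>_inj: "inj_on (\<Phi> i) (C i)"
proof (rule inj_onI)
  fix c d assume c: "c \<in> C i" and d: "d \<in> C i" and eq: "\<Phi> i c = \<Phi> i d"
  show "c = d"
  proof
    fix \<sigma>
    show "c \<sigma> = d \<sigma>"
    proof (cases "\<sigma> \<in> cech_index W i")
      case True
      have "loc_coeff \<sigma> (c \<sigma>) = loc_coeff \<sigma> (d \<sigma>)" using fun_cong[OF eq, of \<sigma>] True by (simp add: \<Phi>_def)
      then show ?thesis
        by (rule loc_coeff_inj[OF cech_indexD(1)[OF True] cochain_component[OF c True] cochain_component[OF d True]])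
    next
      case False
      have "c \<sigma> = undefined" "d \<sigma> = undefined"
        using c d False PiE_arb[of _ "cech_index W i" _ \<sigma>] unfolding cech_cochains_def by auto
      then show ?thesis by simp
    qed
  qed
qed

lemma \<Phi>_add:
  assumes c: "c \<in> C i" and d: "d \<in> C i"
  shows "c \<oplus>\<^bsub>cochains i\<^esub> d \<in> C i"
    "\<Phi> i (c \<oplus>\<^bsub>cochains i\<^esub> d) \<sigma> e = \<Phi> i c \<sigma> e + \<Phi> i d \<sigma> e"
proof -
  have eq: "(c \<oplus>\<^bsub>cochains i\<^esub> d) = (\<lambda>\<sigma>\<in>cech_index W i. c \<sigma> \<oplus>\<^bsub>L \<sigma>\<^esub> d \<sigma>)"
    by (simp add: cech_cochains_def)
  have add: "c \<sigma> \<oplus>\<^bsub>L \<sigma>\<^esub> d \<sigma> \<in> carrier (L \<sigma>)" "loc_coeff \<sigma> (c \<sigma> \<oplus>\<^bsub>L \<sigma>\<^esub> d \<sigma>) e = loc_coeff \<sigma> (c \<sigma>) e + loc_coeff \<sigma> (d \<sigma>) e"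
    if "\<sigma> \<in> cech_index W i" for \<sigma> e
    using loc_coeff_add[OF cech_indexD(1)[OF that] cochain_component[OF c that] cochain_component[OF d that]] by simp_all
  show "c \<oplus>\<^bsub>cochains i\<^esub> d \<in> C i"
    unfolding eq using add(1) by (auto simp: cech_cochains_def)
  show "\<Phi> i (c \<oplus>\<^bsub>cochains i\<^esub> d) \<sigma> e = \<Phi> i c \<sigma> e + \<Phi> i d \<sigma> e"
    unfolding eq \<Phi>_def using add(2)[of \<sigma>] by (cases "\<sigma> \<in> cech_index W i") simp_all
qed

lemma \<Phi>_smult:
  assumes c: "c \<in> C i"
  shows "res (const a) \<odot>\<^bsub>cochains i\<^esub> c \<in> C i"
    "\<Phi> i (res (const a) \<odot>\<^bsub>cochains i\<^esub> c) \<sigma> e = a * \<Phi> i c \<sigma> e"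
proof -
  have eq: "(res (const a) \<odot>\<^bsub>cochains i\<^esub> c) = (\<lambda>\<sigma>\<in>cech_index W i. res (const a) \<odot>\<^bsub>L \<sigma>\<^esub> c \<sigma>)"
    by (simp add: cech_cochains_def)
  have sm: "res (const a) \<odot>\<^bsub>L \<sigma>\<^esub> c \<sigma> \<in> carrier (L \<sigma>)" "loc_coeff \<sigma> (res (const a) \<odot>\<^bsub>L \<sigma>\<^esub> c \<sigma>) e = a * loc_coeff \<sigma> (c \<sigma>) e"
    if "\<sigma> \<in> cech_index W i" for \<sigma> e
    using loc_coeff_const_smult[OF cech_indexD(1)[OF that] cochain_component[OF c that]] by simp_all
  show "res (const a) \<odot>\<^bsub>cochains i\<^esub> c \<in> C i"
    unfolding eq using sm(1) by (auto simp: cech_cochains_def)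
  show "\<Phi> i (res (const a) \<odot>\<^bsub>cochains i\<^esub> c) \<sigma> e = a * \<Phi> i c \<sigma> e"
    unfolding eq \<Phi>_def using sm(2)[of \<sigma>] by (cases "\<sigma> \<in> cech_index W i") simp_all
qed

lemma \<Phi>_zero:
  "\<zero>\<^bsub>cochains i\<^esub> \<in> C i" "\<Phi> i \<zero>\<^bsub>cochains i\<^esub> = (\<lambda>\<sigma> e. 0)"
proof -
  have eq: "\<zero>\<^bsub>cochains i\<^esub> = (\<lambda>\<sigma>\<in>cech_index W i. \<zero>\<^bsub>L \<sigma>\<^esub>)" by (simp add: cech_cochains_def)
  note z = loc_coeff_zero[OF cech_indexD(1)]
  show "\<zero>\<^bsub>cochains i\<^esub> \<in> C i" unfolding eq using z(1) by (auto simp: cech_cochains_def)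
  show "\<Phi> i \<zero>\<^bsub>cochains i\<^esub> = (\<lambda>\<sigma> e. 0)" unfolding eq \<Phi>_def using z(2) by (auto simp: fun_eq_iff)
qed

lemma faces_K_iff: "\<sigma> \<in> faces (K e) (int i - 1) \<longleftrightarrow> \<sigma> \<in> cech_index W i \<and> \<sigma> \<in> K e"
  by (auto simp: faces_def cech_index_def degree_complex_def)

lemma \<Phi>_graded_cochain:
  assumes c: "c \<in> C i"
  shows "\<Phi> i c \<in> graded_cochains K (int i - 1)"
proof -
  have supp: "loc_coeff \<sigma> (c \<sigma>) e \<noteq> 0 \<Longrightarrow> \<sigma> \<in> K e" "finite {e. loc_coeff \<sigma> (c \<sigma>) e \<noteq> 0}"
    if "\<sigma> \<in> cech_index W i" for \<sigma> e
    using loc_coeff_support[OF cech_indexD(1)[OF that] cochain_component[OF c that]] by simp_all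
  show ?thesis
    unfolding graded_cochains_def
  proof (intro CollectI conjI allI impI)
    fix \<sigma> e assume "\<Phi> i c \<sigma> e \<noteq> 0"
    then have "\<sigma> \<in> cech_index W i" "loc_coeff \<sigma> (c \<sigma>) e \<noteq> 0" by (auto simp: \<Phi>_def split: if_splits)
    then show "\<sigma> \<in> faces (K e) (int i - 1)" unfolding faces_K_iff using supp(1) by blast
  next
    fix \<sigma> show "finite {e. \<Phi> i c \<sigma> e \<noteq> 0}"
      using supp(2)[of \<sigma>] by (cases "\<sigma> \<in> cech_index W i") (simp_all add: \<Phi>_def)
  qed
qed

lemma \<Phi>_surj:
  assumes g: "g \<in> graded_cochains K (int i - 1)"
  obtains c where "c \<in> C i" "\<Phi> i c = g"
proof -
  have supp: "\<sigma> \<in> cech_index W i \<and> \<sigma> \<in> K e" if "g \<sigma> e \<noteq> 0" for \<sigma> e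
    using g that unfolding graded_cochains_def faces_K_iff by blast
  have "\<exists>X\<in>carrier (L \<sigma>). loc_coeff \<sigma> X = g \<sigma>" if \<sigma>: "\<sigma> \<in> cech_index W i" for \<sigma>
  proof -
    have fin: "finite {e. g \<sigma> e \<noteq> 0}" using g by (simp add: graded_cochains_def)
    have "\<sigma> \<in> degree_complex \<Delta> W e" if "g \<sigma> e \<noteq> 0" for e using supp[OF that] by blast
    from loc_coeff_surj[OF cech_indexD(1)[OF \<sigma>] fin this] obtain p s
      where "p \<in> carrier S" "loc_coeff \<sigma> (frac R (y_prod \<sigma>) (res p) s) = g \<sigma>" by metis
    then show ?thesis using frac_carrier residue_carrier by blast
  qed
  then obtain X where X: "\<And>\<sigma>. \<sigma> \<in> cech_index W i \<Longrightarrow> X \<sigma> \<in> carrier (L \<sigma>) \<and> loc_coeff \<sigma> (X \<sigma>) = g \<sigma>" by metis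
  show ?thesis
  proof (rule that)
    show "(\<lambda>\<sigma>\<in>cech_index W i. X \<sigma>) \<in> C i" using X by (auto simp: cech_cochains_def)
    show "\<Phi> i (\<lambda>\<sigma>\<in>cech_index W i. X \<sigma>) = g"
    proof (intro ext)
      fix \<sigma> e
      show "\<Phi> i (\<lambda>\<sigma>\<in>cech_index W i. X \<sigma>) \<sigma> e = g \<sigma> e"
        using X[of \<sigma>] supp[of \<sigma> e] by (cases "\<sigma> \<in> cech_index W i") (auto simp: \<Phi>_def)
    qed
  qed
qed

text \<open>
  In multidegree \<open>e\<close> the Cech differential is the coboundary of \<open>K e\<close>: the map to
  $R_{y_\tau}$ preserves coefficients if \<open>keys e \<union> \<tau> \<in> \<Delta>\<close> and annihilates them otherwise, and if \<open>\<tau>\<close> does not contain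
  the negative support of \<open>e\<close>, then neither does any of its subsets.
\<close>

lemma \<Phi>_diff:
  assumes c: "c \<in> C i"
  shows "\<delta> i c \<in> C (Suc i)"
    "\<Phi> (Suc i) (\<delta> i c) = graded_coboundary K (\<Phi> i c)"
proof -
  let ?x = "\<lambda>\<tau> q. loc_map R (y_prod (\<tau> - {q})) (res (var q)) (c (\<tau> - {q}))"
  let ?t = "\<lambda>\<tau> q. if even (card {p \<in> \<tau>. p < q}) then ?x \<tau> q else \<ominus>\<^bsub>L \<tau>\<^esub> ?x \<tau> q"
  have diff: "\<delta> i c = (\<lambda>\<tau>\<in>cech_index W (Suc i). finsum (L \<tau>) (?t \<tau>) \<tau>)"
    unfolding cech_diff_def Let_def y_prod_def by (rule refl)
  have idx: "\<tau> - {q} \<in> cech_index W i" if "\<tau> \<in> cech_index W (Suc i)" "q \<in> \<tau>" for \<tau> q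
    using that by (auto simp: cech_index_def)
  have x: "?x \<tau> q \<in> carrier (L \<tau>)" "loc_coeff \<tau> (?x \<tau> q) e = (if keys e \<union> \<tau> \<in> \<Delta> then loc_coeff (\<tau> - {q}) (c (\<tau> - {q})) e else 0)"
    if "\<tau> \<in> cech_index W (Suc i)" "q \<in> \<tau>" for \<tau> q e
    using loc_coeff_loc_map[OF cech_indexD(1)[OF that(1)] that(2) cochain_component[OF c idx[OF that]]] by blast+
  have t: "?t \<tau> q \<in> carrier (L \<tau>)" "loc_coeff \<tau> (?t \<tau> q) e = sgn_in \<tau> q * (if keys e \<union> \<tau> \<in> \<Delta> then loc_coeff (\<tau> - {q}) (c (\<tau> - {q})) e else 0)"
    if "\<tau> \<in> cech_index W (Suc i)" "q \<in> \<tau>" for \<tau> q e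
  proof -
    note \<tau> = cech_indexD(1)[OF that(1)]
    interpret abelian_group "L \<tau>" by (rule abelian_group_L[OF \<tau>])
    show "?t \<tau> q \<in> carrier (L \<tau>)" using x(1)[OF that] a_inv_closed by simp
    show "loc_coeff \<tau> (?t \<tau> q) e = sgn_in \<tau> q * (if keys e \<union> \<tau> \<in> \<Delta> then loc_coeff (\<tau> - {q}) (c (\<tau> - {q})) e else 0)"
      using x[OF that] loc_coeff_minus[OF \<tau> x(1)[OF that]] by (simp add: sgn_in_def)
  qed
  have sum_closed: "finsum (L \<tau>) (?t \<tau>) \<tau> \<in> carrier (L \<tau>)" if "\<tau> \<in> cech_index W (Suc i)" for \<tau>
  proof -
    interpret abelian_group "L \<tau>" by (rule abelian_group_L[OF cech_indexD(1)[OF that]])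
    show ?thesis by (rule finsum_closed) (use t(1)[OF that] in blast)
  qed
  then show "\<delta> i c \<in> C (Suc i)"
    unfolding diff by (simp add: cech_cochains_def)
  have nz: "\<Phi> i c \<sigma> e \<noteq> 0 \<Longrightarrow> neg_support e \<subseteq> \<sigma>" for \<sigma> e
  proof -
    assume "\<Phi> i c \<sigma> e \<noteq> 0"
    then have "\<sigma> \<in> K e" using \<Phi>_graded_cochain[OF c] unfolding graded_cochains_def faces_K_iff by blast
    then show "neg_support e \<subseteq> \<sigma>" by (simp add: degree_complex_def)
  qed
  show "\<Phi> (Suc i) (\<delta> i c) = graded_coboundary K (\<Phi> i c)"
  proof (intro ext)
    fix \<tau> e
    show "\<Phi> (Suc i) (\<delta> i c) \<tau> e = graded_coboundary K (\<Phi> i c) \<tau> e"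
    proof (cases "\<tau> \<in> cech_index W (Suc i)")
      case True
      have "\<Phi> (Suc i) (\<delta> i c) \<tau> e = loc_coeff \<tau> (finsum (L \<tau>) (?t \<tau>) \<tau>) e"
        using True by (simp add: \<Phi>_def diff)
      also have "\<dots> = (\<Sum>q\<in>\<tau>. loc_coeff \<tau> (?t \<tau> q) e)"
        by (rule loc_coeff_finsum[OF cech_indexD(1)[OF True] t(1)[OF True] W_subset_finite[OF cech_indexD(1)[OF True]]])
      also have "\<dots> = (\<Sum>q\<in>\<tau>. sgn_in \<tau> q * (if keys e \<union> \<tau> \<in> \<Delta> then \<Phi> i c (\<tau> - {q}) e else 0))"
        by (rule sum.cong[OF refl]) (simp only: t(2)[OF True] \<Phi>_def idx[OF True] if_True)
      also have "\<dots> = graded_coboundary K (\<Phi> i c) \<tau> e"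
      proof (cases "\<tau> \<in> K e")
        case in_K: True
        then show ?thesis by (simp add: graded_coboundary_def coboundary_def degree_complex_def)
      next
        case False
        have "(if keys e \<union> \<tau> \<in> \<Delta> then \<Phi> i c (\<tau> - {q}) e else 0) = 0" for q
          using False nz[of "\<tau> - {q}" e] cech_indexD(1)[OF True] by (auto simp: degree_complex_def)
        then show ?thesis using False by (simp add: graded_coboundary_def coboundary_def)
      qed
      finally show ?thesis .
    next
      case False
      have "\<Phi> i c (\<tau> - {q}) e = 0" if "\<tau> \<in> K e" "q \<in> \<tau>" for q
      proof -
        have "\<tau> \<subseteq> W" using that by (simp add: degree_complex_def)
        then have "card \<tau> = Suc (card (\<tau> - {q}))" using W_subset_finite that(2) by (metis card_Suc_Diff1)
        then have "\<tau> - {q} \<notin> cech_index W i" using False \<open>\<tau> \<subseteq> W\<close> by (auto simp: cech_index_def)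
        then show ?thesis by (simp add: \<Phi>_def)
      qed
      then show ?thesis using False by (simp add: \<Phi>_def graded_coboundary_def coboundary_def)
    qed
  qed
qed

lemma cocycles_iff:
  "c \<in> cocycles i \<longleftrightarrow>
     c \<in> C i \<and> graded_coboundary K (\<Phi> i c) = (\<lambda>\<sigma> e. 0)"
proof -
  have "\<delta> i c = \<zero>\<^bsub>cochains (Suc i)\<^esub> \<longleftrightarrow> graded_coboundary K (\<Phi> i c) = (\<lambda>\<sigma> e. 0)"
    if c: "c \<in> C i"
    using inj_on_eq_iff[OF \<Phi>_inj \<Phi>_diff(1)[OF c] \<Phi>_zero(1)] unfolding \<Phi>_diff(2)[OF c] \<Phi>_zero(2) by blast
  then show ?thesis unfolding cech_cocycles_def by blast
qed

lemma graded_cochains_below: "graded_cochains K (- 2) = {\<lambda>\<sigma> e. 0}"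
proof -
  have "faces (K e) (- 2) = {}" for e by (auto simp: faces_def)
  then show ?thesis by (auto simp: graded_cochains_def fun_eq_iff)
qed

lemma coboundaries_carrier: "coboundaries i \<subseteq> C i"
  using \<Phi>_zero(1) \<Phi>_diff(1) by (auto simp: cech_coboundaries_def split: nat.splits)

text \<open>
  For \<open>i = 0\<close> the only cochain of dimension \<open>- 2\<close> is 0, so the separate definition of
  coboundaries in degree 0 fits the general pattern.
\<close>

lemma coboundaries_iff:
  assumes c: "c \<in> C i"
  shows "c \<in> coboundaries i \<longleftrightarrow>
     (\<exists>h\<in>graded_cochains K (int i - 1 - 1). \<Phi> i c = graded_coboundary K h)"
proof (cases i)
  case 0
  have "c \<in> coboundaries i \<longleftrightarrow> \<Phi> i c = (\<lambda>\<sigma> e. 0)"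
    using inj_on_eq_iff[OF \<Phi>_inj c \<Phi>_zero(1)] \<Phi>_zero(2)[of i] by (simp add: cech_coboundaries_def 0)
  then show ?thesis
    by (simp add: 0 graded_cochains_below graded_coboundary_def coboundary_zero)
next
  case (Suc i')
  have p: "int i - 1 - 1 = int i' - 1" by (simp add: Suc)
  have "c \<in> coboundaries i \<longleftrightarrow>
     (\<exists>b\<in>C i'. c = \<delta> i' b)"
    by (auto simp: cech_coboundaries_def Suc)
  also have "\<dots> \<longleftrightarrow> (\<exists>b\<in>C i'. \<Phi> i c = graded_coboundary K (\<Phi> i' b))"
  proof (rule bex_cong[OF refl])
    fix b assume b: "b \<in> C i'"
    show "c = \<delta> i' b \<longleftrightarrow> \<Phi> i c = graded_coboundary K (\<Phi> i' b)"
      using inj_on_eq_iff[OF \<Phi>_inj c] \<Phi>_diff[OF b] unfolding Suc by metis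
  qed
  also have "\<dots> \<longleftrightarrow> (\<exists>h\<in>graded_cochains K (int i - 1 - 1). \<Phi> i c = graded_coboundary K h)"
    unfolding p using \<Phi>_graded_cochain \<Phi>_surj by metis
  finally show ?thesis .
qed

lemma homogeneous_iff:
  assumes c: "c \<in> C i"
  shows "(\<forall>\<sigma>\<in>cech_index W i. c \<sigma> \<in> loc_component m n I \<sigma> k j) \<longleftrightarrow>
     (\<forall>\<sigma> e. \<Phi> i c \<sigma> e \<noteq> 0 \<longrightarrow> e \<in> bidegrees V W k j)"
  using loc_component_iff[OF cech_indexD(1)] cochain_component[OF c] by (auto simp: \<Phi>_def)

lemma graded_coboundary_add:
  "graded_coboundary K (\<lambda>\<sigma> e. g \<sigma> e + h \<sigma> e) = (\<lambda>\<sigma> e. graded_coboundary K g \<sigma> e + graded_coboundary K h \<sigma> (e::nat \<Rightarrow>\<^sub>0 int) :: 'k)"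
  by (auto simp: graded_coboundary_def coboundary_def fun_eq_iff algebra_simps sum.distrib)

lemma graded_coboundary_smult:
  "graded_coboundary K (\<lambda>\<sigma> e. a * g \<sigma> e) = (\<lambda>\<sigma> e. a * graded_coboundary K g \<sigma> (e::nat \<Rightarrow>\<^sub>0 int) :: 'k)"
  by (auto simp: graded_coboundary_def coboundary_def fun_eq_iff sum_distrib_left algebra_simps)

lemma graded_cochains_linear:
  assumes "g \<in> graded_cochains K p" "h \<in> graded_cochains K p"
  shows "(\<lambda>\<sigma> e. g \<sigma> e + h \<sigma> e) \<in> graded_cochains K p" "(\<lambda>\<sigma> e. a * g \<sigma> e :: 'k) \<in> graded_cochains K p"
proof -
  have sub: "{e. g \<sigma> e + h \<sigma> e \<noteq> 0} \<subseteq> {e. g \<sigma> e \<noteq> 0} \<union> {e. h \<sigma> e \<noteq> 0}" for \<sigma> by auto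
  have "finite {e. g \<sigma> e + h \<sigma> e \<noteq> 0}" for \<sigma>
    by (rule finite_subset[OF sub]) (use assms in \<open>auto simp: graded_cochains_def\<close>)
  then show "(\<lambda>\<sigma> e. g \<sigma> e + h \<sigma> e) \<in> graded_cochains K p"
    using assms sub unfolding graded_cochains_def by blast
  have sub': "{e. a * g \<sigma> e \<noteq> 0} \<subseteq> {e. g \<sigma> e \<noteq> 0}" for \<sigma> by auto
  have "finite {e. a * g \<sigma> e \<noteq> 0}" for \<sigma>
    by (rule finite_subset[OF sub']) (use assms in \<open>auto simp: graded_cochains_def\<close>)
  then show "(\<lambda>\<sigma> e. a * g \<sigma> e) \<in> graded_cochains K p"
    using assms sub' unfolding graded_cochains_def by blast
qed

text \<open>
  The coordinates of a class are indexed by pairs of a contributing multidegree and an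
  element of the basis of its cohomology.  The cocycle with given coordinates is the preimage under \<open>\<Phi>\<close> of the corresponding
  combination of basis cocycles.
\<close>

lemma has_dim_component:
  "has_dim (H_P_component m n I i k j)
     (\<Sum>e\<in>contributing_degrees \<Delta> V W k j. d_num TYPE('k) \<Delta> W i (neg_support e) (keys e \<inter> V))"
proof -
  let ?D = "contributing_degrees \<Delta> V W k j" and ?H = "bidegrees V W k j" and ?p = "int i - 1"
  let ?d = "\<lambda>e. d_num TYPE('k) \<Delta> W i (neg_support e) (keys e \<inter> V)"
  have DH: "?D \<subseteq> ?H" by (auto simp: contributing_degrees_def)
  have finD: "finite ?D" by (rule contributing_degrees_sum(1))
  have KW: "K e \<subseteq> Pow W" for e by (auto simp: degree_complex_def)
  define P where "P = (\<lambda>e (A :: (nat set \<Rightarrow> 'k) set) \<zeta> :: (nat set \<Rightarrow> 'k) \<Rightarrow> nat set \<Rightarrow> 'k.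
      cohomology_basis (K e) ?p A \<zeta> \<and> (if e \<in> ?D then card A = ?d e else A = {}))"
  have "\<exists>A \<zeta>. P e A \<zeta>" if "e \<in> ?H" for e
  proof (cases "e \<in> ?D")
    case True
    then show ?thesis unfolding P_def using cohomology_contributing[OF True, of i] by simp
  next
    case False
    then have "P e {} (\<lambda>_ _. 0)" unfolding P_def using cohomology_not_contributing[of e k j ?p] that by simp
    then show ?thesis by blast
  qed
  then obtain A \<zeta> where P: "\<And>e. e \<in> ?H \<Longrightarrow> P e (A e) (\<zeta> e)" by metis
  have basis: "cohomology_basis (K e) ?p (A e) (\<zeta> e)" if "e \<in> ?H" for e using P[OF that] by (simp add: P_def)
  have empty: "A e = {}" if "e \<in> ?H - ?D" for e using P[of e] that by (simp add: P_def)
  have cardA: "card (A e) = ?d e" if "e \<in> ?D" for e using P[of e] that DH by (auto simp: P_def)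
  have finA: "finite (A e)" if "e \<in> ?D" for e using cohomology_basisD(1)[OF basis] that DH by blast
  let ?T = "graded_combination ?D A \<zeta>"
  note asm = finW KW finD DH basis empty
  define T where "T = (\<lambda>\<alpha>. inv_into (C i) (\<Phi> i) (?T \<alpha>))"
  have T: "T \<alpha> \<in> C i" "\<Phi> i (T \<alpha>) = ?T \<alpha>" for \<alpha>
  proof -
    obtain c where c: "c \<in> C i" "\<Phi> i c = ?T \<alpha>"
      using \<Phi>_surj[OF graded_combination_cochain[OF asm, where \<alpha> = \<alpha>]] by blast
    then have "?T \<alpha> \<in> \<Phi> i ` C i" by (metis imageI)
    then show "T \<alpha> \<in> C i" "\<Phi> i (T \<alpha>) = ?T \<alpha>"
      unfolding T_def by (rule inv_into_into, rule f_inv_into_f)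
  qed
  define E where "E = (\<lambda>c (\<sigma>, e). \<Phi> i c \<sigma> e)"
  have E_eq: "E c = E d \<longleftrightarrow> \<Phi> i c = \<Phi> i d" for c d by (auto simp: E_def fun_eq_iff)
  define N where "N = coboundaries i"
  define Z where "Z = {c \<in> cocycles i. \<forall>\<sigma>\<in>cech_index W i. c \<sigma> \<in> loc_component m n I \<sigma> k j}"
  have NC: "N \<subseteq> C i" unfolding N_def by (rule coboundaries_carrier)
  have N_iff: "c \<in> N \<longleftrightarrow> (\<exists>h\<in>graded_cochains K (?p - 1). \<Phi> i c = graded_coboundary K h)"
    if "c \<in> C i" for c unfolding N_def by (rule coboundaries_iff[OF that])
  have Z_iff: "c \<in> Z \<longleftrightarrow> c \<in> C i \<and> graded_coboundary K (\<Phi> i c) = (\<lambda>\<sigma> e. 0)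
     \<and> (\<forall>\<sigma> e. \<Phi> i c \<sigma> e \<noteq> 0 \<longrightarrow> e \<in> ?H)" for c
    unfolding Z_def mem_Collect_eq cocycles_iff using homogeneous_iff by blast
  have "has_dim (H_P_component m n I i k j) (card (Sigma ?D A))"
  proof (rule has_dim_quotient_by_coordinates[where e = E and C = "C i" and N = N and Z = Z
        and ad = "(\<oplus>\<^bsub>cochains i\<^esub>)" and sm = "\<lambda>a x. res (const a) \<odot>\<^bsub>cochains i\<^esub> x" and T = T])
    show "finite (Sigma ?D A)" using finD finA by blast
    show "inj_on E (C i)" using \<Phi>_inj unfolding inj_on_def E_eq by blast
    show "x \<oplus>\<^bsub>cochains i\<^esub> y \<in> C i \<and> E (x \<oplus>\<^bsub>cochains i\<^esub> y) = (\<lambda>t. E x t + E y t)"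
      if "x \<in> C i" "y \<in> C i" for x y
      using \<Phi>_add[OF that] by (simp add: E_def fun_eq_iff)
    show "res (const a) \<odot>\<^bsub>cochains i\<^esub> x \<in> C i \<and> E (res (const a) \<odot>\<^bsub>cochains i\<^esub> x) = (\<lambda>t. a * E x t)"
      if "x \<in> C i" for a x
      using \<Phi>_smult[OF that] by (simp add: E_def fun_eq_iff)
    show "Z \<subseteq> C i" using Z_iff by blast
    show "N \<subseteq> C i" by (rule NC)
    show "(\<lambda>t. 0) \<in> E ` N"
    proof
      show "(\<lambda>t. 0) = E \<zero>\<^bsub>cochains i\<^esub>" by (auto simp: E_def \<Phi>_zero(2))
      have zero: "(\<lambda>\<sigma> e. 0 :: 'k) \<in> graded_cochains K (?p - 1)" by (simp add: graded_cochains_def)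
      have "graded_coboundary K (\<lambda>\<sigma> (e :: nat \<Rightarrow>\<^sub>0 int). 0 :: 'k) = (\<lambda>\<sigma> e. 0)"
        by (simp add: graded_coboundary_def coboundary_zero)
      then show "\<zero>\<^bsub>cochains i\<^esub> \<in> N"
        unfolding N_iff[OF \<Phi>_zero(1)] \<Phi>_zero(2) by (intro bexI[OF _ zero]) simp
    qed
    show "x \<oplus>\<^bsub>cochains i\<^esub> y \<in> N" if xN: "x \<in> N" and yN: "y \<in> N" for x y
    proof -
      have xy: "x \<in> C i" "y \<in> C i" using xN yN NC by auto
      obtain g where g: "g \<in> graded_cochains K (?p - 1)" "\<Phi> i x = graded_coboundary K g"
        using iffD1[OF N_iff[OF xy(1)] xN] by (elim bexE)
      obtain h where h: "h \<in> graded_cochains K (?p - 1)" "\<Phi> i y = graded_coboundary K h"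
        using iffD1[OF N_iff[OF xy(2)] yN] by (elim bexE)
      have "\<Phi> i (x \<oplus>\<^bsub>cochains i\<^esub> y) = graded_coboundary K (\<lambda>\<sigma> e. g \<sigma> e + h \<sigma> e)"
        unfolding graded_coboundary_add g(2)[symmetric] h(2)[symmetric] by (intro ext) (rule \<Phi>_add(2)[OF xy])
      then show ?thesis unfolding N_iff[OF \<Phi>_add(1)[OF xy]] by (rule bexI[OF _ graded_cochains_linear(1)[OF g(1) h(1)]])
    qed
    show "res (const a) \<odot>\<^bsub>cochains i\<^esub> x \<in> N" if xN: "x \<in> N" for a x
    proof -
      have x: "x \<in> C i" using xN NC by auto
      obtain g where g: "g \<in> graded_cochains K (?p - 1)" "\<Phi> i x = graded_coboundary K g"
        using iffD1[OF N_iff[OF x] xN] by (elim bexE)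
      have "\<Phi> i (res (const a) \<odot>\<^bsub>cochains i\<^esub> x) = graded_coboundary K (\<lambda>\<sigma> e. a * g \<sigma> e)"
        unfolding graded_coboundary_smult g(2)[symmetric] by (intro ext) (rule \<Phi>_smult(2)[OF x])
      then show ?thesis unfolding N_iff[OF \<Phi>_smult(1)[OF x]] by (rule bexI[OF _ graded_cochains_linear(2)[OF g(1) g(1)]])
    qed
    show "carrier (H_P_component m n I i k j) = (\<lambda>c. (\<lambda>b. b \<oplus>\<^bsub>cochains i\<^esub> c) ` N) ` Z"
      by (auto simp: H_P_component_def Let_def a_r_coset_def' Z_def N_def)
    show "\<zero>\<^bsub>H_P_component m n I i k j\<^esub> = N"
      by (simp add: H_P_component_def Let_def H_P_def local_cohomology_def quot_module_def N_def)
    show "X \<oplus>\<^bsub>H_P_component m n I i k j\<^esub> Y = (\<Union>x\<in>X. \<Union>y\<in>Y. {x \<oplus>\<^bsub>cochains i\<^esub> y})" for X Y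
      by (simp add: H_P_component_def Let_def H_P_def local_cohomology_def quot_module_def set_add_def')
    show "a \<odot>\<^bsub>H_P_component m n I i k j\<^esub> X
        = (\<Union>x\<in>X. (\<lambda>b. b \<oplus>\<^bsub>cochains i\<^esub> (res (const a) \<odot>\<^bsub>cochains i\<^esub> x)) ` N)" for a X
      by (auto simp: H_P_component_def Let_def H_P_def local_cohomology_def quot_module_def a_r_coset_def' N_def)
    show "T \<alpha> \<in> Z" for \<alpha>
      unfolding Z_iff T(2)
    proof (intro conjI allI impI)
      show "graded_coboundary K (?T \<alpha>) = (\<lambda>\<sigma> e. 0)" by (rule graded_combination_cocycle[OF asm])
      show "e \<in> ?H" if "?T \<alpha> \<sigma> e \<noteq> 0" for \<sigma> e
        using that DH unfolding graded_combination_def by (auto split: if_splits)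
    qed (rule T(1))
    show "E (T (\<lambda>a. \<alpha> a + \<beta> a)) = (\<lambda>t. E (T \<alpha>) t + E (T \<beta>) t)" for \<alpha> \<beta>
      by (auto simp: E_def T(2) graded_combination_def fun_eq_iff algebra_simps sum.distrib)
    show "E (T (\<lambda>a. c * \<alpha> a)) = (\<lambda>t. c * E (T \<alpha>) t)" for c \<alpha>
      by (auto simp: E_def T(2) graded_combination_def fun_eq_iff algebra_simps sum_distrib_left)
    show "\<alpha> = (\<lambda>a. 0)" if \<alpha>: "\<alpha> \<in> coord_space (Sigma ?D A)" and TN: "T \<alpha> \<in> N" for \<alpha>
    proof -
      obtain h where h: "h \<in> graded_cochains K (?p - 1)" "?T \<alpha> = graded_coboundary K h"
        using TN unfolding N_iff[OF T(1)] T(2) by (elim bexE)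
      show ?thesis by (rule graded_combination_independent[OF asm \<alpha> h])
    qed
    show "\<exists>\<alpha>\<in>coord_space (Sigma ?D A). \<exists>b\<in>N. E z = (\<lambda>t. E b t + E (T \<alpha>) t)" if "z \<in> Z" for z
    proof -
      have z: "z \<in> C i" "graded_coboundary K (\<Phi> i z) = (\<lambda>\<sigma> e. 0)"
        "\<And>\<sigma> e. \<Phi> i z \<sigma> e \<noteq> 0 \<Longrightarrow> e \<in> ?H" using that Z_iff by blast+
      obtain \<alpha> h where \<alpha>: "\<alpha> \<in> coord_space (Sigma ?D A)" and h: "h \<in> graded_cochains K (?p - 1)"
        and eq: "\<Phi> i z = (\<lambda>\<sigma> e. graded_coboundary K h \<sigma> e + ?T \<alpha> \<sigma> e)"
        by (rule graded_combination_spanning[OF asm \<Phi>_graded_cochain[OF z(1)] z(2,3)])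
      \<comment> \<open>the difference of \<open>z\<close> and \<open>T \<alpha>\<close>, written with the module operations\<close>
      let ?b = "z \<oplus>\<^bsub>cochains i\<^esub> (res (const (- 1)) \<odot>\<^bsub>cochains i\<^esub> T \<alpha>)"
      have b: "?b \<in> C i" using \<Phi>_add(1)[OF z(1) \<Phi>_smult(1)[OF T(1)]] .
      have b_eq: "\<Phi> i ?b \<sigma> e = graded_coboundary K h \<sigma> e" for \<sigma> e
        unfolding \<Phi>_add(2)[OF z(1) \<Phi>_smult(1)[OF T(1)]] \<Phi>_smult(2)[OF T(1)] T(2) eq by simp
      show ?thesis
      proof (intro bexI)
        show "?b \<in> N" unfolding N_iff[OF b] by (rule bexI[OF _ h], intro ext) (rule b_eq)
        show "E z = (\<lambda>t. E ?b t + E (T \<alpha>) t)" by (auto simp: E_def b_eq eq T(2))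
      qed (rule \<alpha>)
    qed
  qed
  also have "card (Sigma ?D A) = (\<Sum>e\<in>?D. ?d e)"
    using finD finA cardA by (simp add: card_SigmaI)
  finally show ?thesis .
qed

end

theorem proposition1p7:
  fixes m n i :: nat and k j :: int and I :: "('k::field) mpoly set"
  assumes "sqfree_monomial_ideal m n I"
  shows "has_dim (H_P_component m n I i k j)
           (\<Sum>F\<in>induced (SR_complex m n I) (W_vertices m n). \<Sum>G\<in>Pow (V_vertices m).
              d_num TYPE('k) (SR_complex m n I) (W_vertices m n) i F G
              * binom (k - 1) (int (card G) - 1)
              * binom (- j - 1) (int (card F) - 1))"
proof -
  interpret stanley_reisner m n I by unfold_locales (rule assms)
  show ?thesis
    using has_dim_component[of i k j]
    unfolding contributing_degrees_sum(2)[of "d_num TYPE('k) \<Delta> W i"] .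
qed

end
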